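(* Let $\alpha$ be an integer with $\alpha\notin\{0,1,2\}$, let $p$ be a prime factor of $\alpha-1$, let $m=v_p(\alpha-1)$, and let $J$ be the Sylow $p$-subgroup of the Macdonald group $G(\alpha)$, with elements $A,B,C\in J$ as defined in the context. (a) In Case 1, the nilpotency class of $J$ is $5$, and $$Z_1(J)=\langle A^{p^{2m}}\rangle,\ Z_2(J)=\langle A^{p^{2m}},C^{p^{m}}\rangle,\ Z_3(J)=\langle A^{p^{m}},B^{p^{m}},C^{p^{m}}\rangle,\ Z_4(J)=\langle A^{p^{m}},B^{p^{m}},C\rangle.$$ (b) In Case 2, if $m>1$, the nilpotency class of $J$ is $5$, and $$Z_1(J)=\langle A^{2^{2m-1}}\rangle,\ Z_2(J)=\langle A^{2^{2m-1}},C^{2^{m-1}}\rangle,\ Z_3(J)=\langle A^{2^{m}},B^{2^{m}},C^{2^{m-1}}\rangle,\ Z_4(J)=\langle A^{2^{m-1}},B^{2^{m-1}},C\rangle.$$ (c) In Case 3, the nilpotency class of $J$ is $7$, and $$Z_1(J)=\langle A^{27}\rangle,\ Z_2(J)=\langle A^{27},C^{9}\rangle,\ Z_3(J)=\langle A^{9},B^{9},C^{9}\rangle,$$ $$Z_4(J)=\langle A^{9},B^{9},C^{3}\rangle,\ Z_5(J)=\langle A^{3},B^{3},C^{3}\rangle,\ Z_6(J)=\langle A^{3},B^{3},C\rangle.$$ Moreover, in Cases 1 and 3 the terms of the upper and lower central series of $J$ coincide in reverse order (that is, $\gamma_i(J)=Z_{c+1-i}(J)$ for $1\le i\le c+1$,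 where $c$ is the nilpotency class of $J$), while in Case 2, if $m>1$, we have $$\gamma_2(J)=\langle A^{2^{m}},B^{2^{m}},C\rangle,\ \gamma_3(J)=\langle A^{2^{m}},B^{2^{m}},C^{2^{m}}\rangle,\ \gamma_4(J)=\langle A^{2^{2m}},[A,B^{2^{m}}]\rangle,\ \gamma_5(J)=\langle A^{2^{2m}}\rangle.$$
   Context: For elements $a,b$ of a group, $[a,b]=a^{-1}b^{-1}ab$ and $b^a=a^{-1}ba$. For a group $T$, $Z_0(T)=1$ and $Z_{i+1}(T)/Z_i(T)$ is the center of $T/Z_i(T)$ (upper central series); $\gamma_1(T)=T$ and $\gamma_{i+1}(T)=[T,\gamma_i(T)]$ (lower central series). The Macdonald group is $G(\alpha)=\langle A,B\mid A^{[A,B]}=A^\alpha,\ B^{[B,A]}=B^\alpha\rangle$; for $\alpha\notin\{0,1,2\}$ it is finite and nilpotent, hence the direct product of its Sylow subgroups. $J$ is the Sylow $p$-subgroup; by abuse of notation $A,B\in J$ denote the images of the two generators of $G(\alpha)$ under the projection $G(\alpha)\to J$ (so $A,B$ generate $J$), and $C=[A,B]\in J$. $v_p$ denotes the $p$-adic valuation. Case 1: either $p>3$, or $p=3$ and ($m>1$ or $(\alpha-1)/3\equiv 1 \bmod 3$). Case 2: $p=2$. Case 3: $p=3$, $m=1$, and $(\alpha-1)/3\equiv -1\bmod 3$. *)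

theory Defs
  imports
    "HOL-Algebra.Generated_Groups"
    "HOL-Number_Theory.Cong"
    "HOL-Computational_Algebra.Primes"
begin

section \<open>Commutators, conjugates and central series\<close>

definition commutator :: "('a, 'b) monoid_scheme \<Rightarrow> 'a \<Rightarrow> 'a \<Rightarrow> 'a" where
  "commutator G a b = inv\<^bsub>G\<^esub> a \<otimes>\<^bsub>G\<^esub> inv\<^bsub>G\<^esub> b \<otimes>\<^bsub>G\<^esub> a \<otimes>\<^bsub>G\<^esub> b"

text \<open>The element written \<open>b\<close> to the power \<open>a\<close>: conjugation acts on the right.\<close>

definition conjugate :: "('a, 'b) monoid_scheme \<Rightarrow> 'a \<Rightarrow> 'a \<Rightarrow> 'a" where
  "conjugate G b a = inv\<^bsub>G\<^esub> a \<otimes>\<^bsub>G\<^esub> b \<otimes>\<^bsub>G\<^esub> a"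

definition center :: "('a, 'b) monoid_scheme \<Rightarrow> 'a set" where
  "center G = {z \<in> carrier G. \<forall>x \<in> carrier G. z \<otimes>\<^bsub>G\<^esub> x = x \<otimes>\<^bsub>G\<^esub> z}"

text \<open>The next term is the full preimage, under the quotient map, of the center of the quotient
  by the current one.\<close>

primrec upper_central :: "('a, 'b) monoid_scheme \<Rightarrow> nat \<Rightarrow> 'a set" where
  "upper_central G 0 = {\<one>\<^bsub>G\<^esub>}"
| "upper_central G (Suc i) =
     {x \<in> carrier G. upper_central G i #>\<^bsub>G\<^esub> x \<in> center (G Mod upper_central G i)}"

text \<open>Numbered from 1; the value at 0 is a dummy.\<close>

fun lower_central :: "('a, 'b) monoid_scheme \<Rightarrow> nat \<Rightarrow> 'a set" where
  "lower_central G 0 = carrier G"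
| "lower_central G (Suc 0) = carrier G"
| "lower_central G (Suc (Suc i)) =
     generate G {commutator G x y | x y. x \<in> carrier G \<and> y \<in> lower_central G (Suc i)}"

definition has_nilpotency_class :: "('a, 'b) monoid_scheme \<Rightarrow> nat \<Rightarrow> bool" where
  "has_nilpotency_class G c \<longleftrightarrow>
     upper_central G c = carrier G \<and> (\<forall>i < c. upper_central G i \<noteq> carrier G)"

section \<open>Sylow subgroups and the associated projections\<close>

text \<open>Meant for finite \<open>G\<close>; the order of an infinite group is 0 in the library.\<close>

definition sylow_subgroup :: "('a, 'b) monoid_scheme \<Rightarrow> nat \<Rightarrow> 'a set \<Rightarrow> bool" where
  "sylow_subgroup G p J \<longleftrightarrow> subgroup J G \<and> card J = p ^ multiplicity p (order G)"

text \<open>When \<open>G\<close> is the direct product of its Sylow subgroups, the projection onto the factor \<open>J\<close>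
  is the retraction onto \<open>J\<close> whose kernel is the product of all the other factors.\<close>

definition sylow_projection ::
  "('a, 'b) monoid_scheme \<Rightarrow> nat \<Rightarrow> 'a set \<Rightarrow> ('a \<Rightarrow> 'a) \<Rightarrow> bool" where
  "sylow_projection G p J \<pi> \<longleftrightarrow>
     \<pi> \<in> hom G (G\<lparr>carrier := J\<rparr>) \<and>
     (\<forall>x \<in> J. \<pi> x = x) \<and>
     kernel G (G\<lparr>carrier := J\<rparr>) \<pi> =
       generate G (\<Union>{Q. \<exists>q. prime q \<and> q \<noteq> p \<and> sylow_subgroup G q Q})"

section \<open>Free groups and the Macdonald groups\<close>

text \<open>A letter \<open>(x, True)\<close> stands for the generator \<open>x\<close> and \<open>(x, False)\<close> for its inverse. The free
  group consists of the words modulo the congruence generated by cancellation of inverse letters.\<close>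

type_synonym 'g word = "('g \<times> bool) list"

inductive free_eq :: "'g word \<Rightarrow> 'g word \<Rightarrow> bool" where
  cancel: "free_eq (u @ [(x, b), (x, \<not> b)] @ v) (u @ v)"
| refl: "free_eq u u"
| sym: "free_eq u v \<Longrightarrow> free_eq v u"
| trans: "free_eq u v \<Longrightarrow> free_eq v w \<Longrightarrow> free_eq u w"

definition free_class :: "'g word \<Rightarrow> 'g word set" where
  "free_class u = {v. free_eq u v}"

definition free_group :: "'g word set monoid" where
  "free_group = \<lparr>carrier = range free_class,
     monoid.mult = (\<lambda>X Y. {w. \<exists>u \<in> X. \<exists>v \<in> Y. free_eq (u @ v) w}),
     one = free_class []\<rparr>"

definition free_gen :: "'g \<Rightarrow> 'g word set" where
  "free_gen x = free_class [(x, True)]"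

definition normal_closure :: "('a, 'b) monoid_scheme \<Rightarrow> 'a set \<Rightarrow> 'a set" where
  "normal_closure G S = generate G {conjugate G s g | s g. s \<in> S \<and> g \<in> carrier G}"

definition presented_group :: "'g word set set \<Rightarrow> 'g word set set monoid" where
  "presented_group R = free_group Mod normal_closure free_group R"

definition presented_gen :: "'g word set set \<Rightarrow> 'g \<Rightarrow> 'g word set set" where
  "presented_gen R x = normal_closure free_group R #>\<^bsub>free_group\<^esub> free_gen x"

datatype gen = GenA | GenB

definition macdonald_relators :: "int \<Rightarrow> gen word set set" where
  "macdonald_relators \<alpha> =
    (let F = free_group; a = free_gen GenA; b = free_gen GenB in
      {conjugate F a (commutator F a b) \<otimes>\<^bsub>F\<^esub> inv\<^bsub>F\<^esub> (a [^]\<^bsub>F\<^esub> \<alpha>),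
       conjugate F b (commutator F b a) \<otimes>\<^bsub>F\<^esub> inv\<^bsub>F\<^esub> (b [^]\<^bsub>F\<^esub> \<alpha>)})"

definition macdonald_group :: "int \<Rightarrow> gen word set set monoid" where
  "macdonald_group \<alpha> = presented_group (macdonald_relators \<alpha>)"

definition macdonald_gen :: "int \<Rightarrow> gen \<Rightarrow> gen word set set" where
  "macdonald_gen \<alpha> = presented_gen (macdonald_relators \<alpha>)"

section \<open>These are groups\<close>

lemma free_eq_append_left: "free_eq u v \<Longrightarrow> free_eq (w @ u) (w @ v)"
proof (induction rule: free_eq.induct)
  case (cancel u x b v)
  then show ?case using free_eq.cancel[of "w @ u" x b v] by simp
qed (auto intro: free_eq.intros)

lemma free_eq_append_right: "free_eq u v \<Longrightarrow> free_eq (u @ w) (v @ w)"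
proof (induction rule: free_eq.induct)
  case (cancel u x b v)
  then show ?case using free_eq.cancel[of u x b "v @ w"] by simp
qed (auto intro: free_eq.intros)

lemma free_eq_append: "free_eq u u' \<Longrightarrow> free_eq v v' \<Longrightarrow> free_eq (u @ v) (u' @ v')"
  by (meson free_eq.trans free_eq_append_left free_eq_append_right)

lemma free_class_eq_iff: "free_class u = free_class v \<longleftrightarrow> free_eq u v"
  unfolding free_class_def by (auto intro: free_eq.intros)

lemma free_group_simps [simp]:
  "carrier free_group = range free_class"
  "\<one>\<^bsub>free_group\<^esub> = free_class []"
  "free_class u \<otimes>\<^bsub>free_group\<^esub> free_class v = free_class (u @ v)"
proof -
  show "free_class u \<otimes>\<^bsub>free_group\<^esub> free_class v = free_class (u @ v)"
    unfolding free_group_def free_class_def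
    by (auto intro: free_eq.intros free_eq_append)
qed (simp_all add: free_group_def)

lemma free_eq_inverse: "free_eq (rev (map (\<lambda>(x, b). (x, \<not> b)) u) @ u) []"
proof (induction u)
  case (Cons c u)
  obtain x b where c: "c = (x, b)" by fastforce
  have "free_eq (rev (map (\<lambda>(x, b). (x, \<not> b)) u) @ [(x, \<not> b), (x, \<not> \<not> b)] @ u)
          (rev (map (\<lambda>(x, b). (x, \<not> b)) u) @ u)"
    by (rule free_eq.cancel)
  then show ?case using Cons c by (auto intro: free_eq.trans)
qed (simp add: free_eq.refl)

lemma group_free_group: "group free_group"
proof (rule groupI)
  fix X :: "'a word set"
  assume "X \<in> carrier free_group"
  then obtain u where "X = free_class u" by auto
  then have "free_class (rev (map (\<lambda>(x, b). (x, \<not> b)) u)) \<otimes>\<^bsub>free_group\<^esub> X = \<one>\<^bsub>free_group\<^esub>"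
    by (simp add: free_class_eq_iff free_eq_inverse)
  then show "\<exists>Y \<in> carrier free_group. Y \<otimes>\<^bsub>free_group\<^esub> X = \<one>\<^bsub>free_group\<^esub>"
    by auto
qed auto

lemma (in group) normal_normal_closure:
  assumes "S \<subseteq> carrier G"
  shows "normal_closure G S \<lhd> G"
  unfolding normal_closure_def
proof (rule normal_generateI)
  show "{conjugate G s g | s g. s \<in> S \<and> g \<in> carrier G} \<subseteq> carrier G"
    using assms by (auto simp: conjugate_def)
next
  fix h g
  assume "h \<in> {conjugate G s g | s g. s \<in> S \<and> g \<in> carrier G}" and g: "g \<in> carrier G"
  then obtain s k where h: "h = conjugate G s k" and s: "s \<in> S" and k: "k \<in> carrier G"
    by blast
  have "g \<otimes> h \<otimes> inv g = conjugate G s (k \<otimes> inv g)"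
    using g k s assms by (auto simp: h conjugate_def inv_mult_group m_assoc subset_iff)
  then show "g \<otimes> h \<otimes> inv g \<in> {conjugate G s g | s g. s \<in> S \<and> g \<in> carrier G}"
    using s k g by blast
qed

lemma macdonald_relators_subset: "macdonald_relators \<alpha> \<subseteq> carrier free_group"
proof -
  interpret F: group "free_group :: gen word set monoid" by (rule group_free_group)
  have "free_gen x \<in> carrier free_group" for x :: gen by (simp add: free_gen_def)
  then show ?thesis
    unfolding macdonald_relators_def Let_def commutator_def conjugate_def
    by (auto simp del: free_group_simps)
qed

lemma group_macdonald_group: "group (macdonald_group \<alpha>)"
  unfolding macdonald_group_def presented_group_def
  by (intro normal.factorgroup_is_group group.normal_normal_closure group_free_group
      macdonald_relators_subset)

end

theory Submission
  imports Defs "HOL-Algebra.Bij" "HOL-Algebra.Multiplicative_Group"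
begin

text \<open>Let \<open>\<beta>\<close> be an inverse of \<open>\<alpha>\<close> modulo a large power of \<open>p\<close>. In \<open>J\<close> the defining relations
  become \<open>C A = A^\<beta> C\<close>, \<open>B C = C B^\<beta>\<close>, \<open>A B = B A C\<close>, so every element has the form
  \<open>A^i C^k B^j\<close>. Evaluating suitable products in two ways shows that, for a power \<open>q\<close> of \<open>p\<close>
  depending on the case, \<open>A^q\<close> is central, \<open>A^q B^q = 1\<close>, \<open>A^(q p^m) = 1\<close>, and \<open>C^q\<close> is a power
  of \<open>A^q\<close>. Conversely, the triples \<open>(i, k, j)\<close> modulo these identifications carry permutations
  that satisfy the relations and generate a \<open>p\<close>-group; since \<open>J\<close> maps onto that group, the
  normal forms are unique up to the identifications. The commutators of a normal form with \<open>A\<close> and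
  \<open>B\<close> involve the q-numbers \<open>1 + \<beta> + ... + \<beta>^(n - 1)\<close>, and congruences for these decide in which
  term of a central series it lies.\<close>

section \<open>Arithmetic of q-numbers\<close>

text \<open>The number q is a valuation. Write [x] for 1 + \<beta> + ... + \<beta>^(x-1). Two
  evaluations of one word leave powers of A and B with exponent [x] - x, x = \<beta>^n, and q is the
  power of p exactly dividing it. For \<beta> = 1 + e the difference [\<beta>] - \<beta> begins with
  e^2/2 + e^3/3: this gives p^(2m) in general, p = 2 loses a factor to the denominator, and for p =
  3, m = 1 both terms have the same size and can cancel. The number \<sigma> records that [n] = (1 -
  \<sigma>) n modulo q p^m for multiples n of q. The obstacle is to exclude that J is smaller than
  the normal forms suggest. In the model the inverse D of B acts rather than B, since D A^i = A^[i]
  C^i D is explicit while B A^i would need the inverse of x -> [x]. Two of the three relations then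
  hold identically; the third, D C = C D^\<beta>, becomes congruences for the \<beta>-fold iterate
  of x -> [x], and these account for the long computations with binomial coefficients. In the
  exceptional case they are needed with one more factor 3.\<close>

definition qnum :: "nat \<Rightarrow> nat \<Rightarrow> nat" where
  "qnum b n = (\<Sum>s<n. b ^ s)"

lemma qnum_0 [simp]: "qnum b 0 = 0" and qnum_1 [simp]: "qnum b (Suc 0) = 1"
  by (simp_all add: qnum_def)

lemma qnum_Suc: "qnum b (Suc n) = qnum b n + b ^ n"
  by (simp add: qnum_def)

lemma qnum_Suc': "qnum b (Suc n) = 1 + b * qnum b n"
proof (induction n)
  case (Suc n)
  have "qnum b (Suc (Suc n)) = (1 + b * qnum b n) + b * b ^ n"
    by (subst qnum_Suc) (simp add: Suc)
  also have "\<dots> = 1 + b * qnum b (Suc n)"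
    by (simp only: qnum_Suc[of b n] distrib_left add.assoc)
  finally show ?case .
qed simp

lemma qnum_add: "qnum b (m + n) = qnum b m + b ^ m * qnum b n"
  by (induction n) (simp_all add: qnum_Suc algebra_simps power_add)

lemma qnum_mult: "qnum b (m * n) = qnum b m * qnum (b ^ m) n"
proof (induction n)
  case (Suc n)
  have "qnum b (m * Suc n) = qnum b (m * n + m)" by (simp add: add.commute)
  then show ?case by (simp add: qnum_add Suc qnum_Suc distrib_left power_mult mult.commute)
qed simp

lemma power_eq_qnum: "Suc e ^ n = 1 + e * qnum (Suc e) n"
  by (induction n) (simp_all add: qnum_Suc' algebra_simps)

lemma qnum_ge: "b > 0 \<Longrightarrow> n \<le> qnum b n"
proof (induction n)
  case (Suc n)
  then have "b ^ n \<ge> 1" by simp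
  then show ?case using Suc unfolding qnum_Suc by linarith
qed simp

text \<open>The binomial coefficients are taken on the integers: Vandermonde's identity, which is
  what the addition rules below express, is then available for shifts of either sign.\<close>

definition c2 :: "int \<Rightarrow> int" where "c2 x = x * (x - 1) div 2"

definition c3 :: "int \<Rightarrow> int" where "c3 x = x * (x - 1) * (x - 2) div 6"

lemma two_c2: "2 * c2 x = x * (x - 1)"
  unfolding c2_def by simp

lemma six_c3: "6 * c3 x = x * (x - 1) * (x - 2)"
proof -
  have "6 dvd x * (x - 1) * (x - 2)"
  proof -
    have "2 dvd x * (x - 1) * (x - 2)" by simp
    moreover have "3 dvd x * (x - 1) * (x - 2)"
    proof -
      have "x mod 3 = 0 \<or> x mod 3 = 1 \<or> x mod 3 = 2" by presburger
      then have "3 dvd x \<or> 3 dvd x - 1 \<or> 3 dvd x - 2" by presburger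
      then show ?thesis by (auto simp: dvd_mult dvd_mult2)
    qed
    ultimately have "2 * 3 dvd x * (x - 1) * (x - 2)"
      by (intro divides_mult) auto
    then show ?thesis by simp
  qed
  then show ?thesis unfolding c3_def by simp
qed

lemma c2_add: "c2 (x + y) = c2 x + x * y + c2 y"
proof -
  have "2 * c2 (x + y) = 2 * (c2 x + x * y + c2 y)"
    by (simp only: distrib_left two_c2 mult.assoc[symmetric]) (simp add: algebra_simps)
  then show ?thesis by simp
qed

lemma c3_add: "c3 (x + y) = c3 x + c2 x * y + x * c2 y + c3 y"
proof -
  have "2 * (6 * c3 (x + y)) = 2 * (6 * c3 x) + 6 * ((2 * c2 x) * y) + 6 * (x * (2 * c2 y)) + 2 * (6 * c3 y)"
    unfolding two_c2 six_c3 by Groebner_Basis.algebra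
  then show ?thesis by simp
qed

lemma c2_0 [simp]: "c2 0 = 0" "c2 1 = 0" and c3_0 [simp]: "c3 0 = 0" "c3 1 = 0"
  by (simp_all add: c2_def c3_def)

lemma sum_c2: "(\<Sum>t<n. int t) = c2 (int n)"
  by (induction n) (simp_all add: c2_add add.commute)

lemma sum_c3: "(\<Sum>t<n. c2 (int t)) = c3 (int n)"
  by (induction n) (simp_all add: c3_add add.commute)

lemma sum_squares_c: "(\<Sum>t<n. int t * int t) = 2 * c3 (int n) + c2 (int n)"
proof -
  have "(\<Sum>t<n. int t * int t) = (\<Sum>t<n. 2 * c2 (int t) + int t)"
    by (rule sum.cong) (simp_all add: two_c2 algebra_simps)
  then show ?thesis by (simp add: sum.distrib sum_c2 sum_c3 flip: sum_distrib_left)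
qed

lemma c2_mult: "c2 (x * y) = x * x * c2 y + c2 x * y"
proof -
  have "2 * c2 (x * y) = x * x * (2 * c2 y) + 2 * c2 x * y"
    unfolding two_c2 by Groebner_Basis.algebra
  then show ?thesis by simp
qed

lemma sum_c2_mult:
  "(\<Sum>t<n. c2 (int t * x)) = (2 * c3 (int n) + c2 (int n)) * c2 x + c3 (int n) * x"
  by (simp add: c2_mult sum.distrib sum_squares_c sum_c3 flip: sum_distrib_right)

definition c4 :: "int \<Rightarrow> int" where "c4 x = x * (x - 1) * (x - 2) * (x - 3) div 24"

lemma c4_eq: "24 * c4 x = x * (x - 1) * (x - 2) * (x - 3)"
proof -
  obtain k where k: "x * (x - 3) = 2 * k"
  proof -
    have "even (x * (x - 3))" by simp
    then show thesis using that by blast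
  qed
  have "even (k * (k + 1))" by simp
  then obtain l where l: "k * (k + 1) = 2 * l" by blast
  have "x * (x - 1) * (x - 2) * (x - 3) = (2 * k) * (2 * k + 2)"
    unfolding k[symmetric] by Groebner_Basis.algebra
  also have "\<dots> = 8 * l" using l by Groebner_Basis.algebra
  finally have "8 dvd x * (x - 1) * (x - 2) * (x - 3)" by simp
  moreover have "3 dvd x * (x - 1) * (x - 2) * (x - 3)"
    unfolding six_c3[symmetric] by simp
  moreover have "24 dvd y" if "8 dvd y" "3 dvd y" for y :: int using that by presburger
  ultimately have "24 dvd x * (x - 1) * (x - 2) * (x - 3)" by blast
  then show ?thesis unfolding c4_def by simp
qed

lemma c4_add: "c4 (x + y) = c4 x + c3 x * y + c2 x * c2 y + x * c3 y + c4 y"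
proof -
  have "24 * c4 (x + y) = 24 * c4 x + 4 * (6 * c3 x) * y + 6 * (2 * c2 x) * (2 * c2 y) + 4 * x * (6 * c3 y) + 24 * c4 y"
    unfolding two_c2 six_c3 c4_eq by Groebner_Basis.algebra
  then show ?thesis by simp
qed

lemma c4_0 [simp]: "c4 0 = 0" "c4 1 = 0"
  by (simp_all add: c4_def)

lemma sum_c4: "(\<Sum>t<n. c3 (int t)) = c4 (int n)"
  by (induction n) (simp_all add: c4_add add.commute)

text \<open>This is ((1 + e)^n - 1) / e expanded binomially. Going from n to n + 1 multiplies by 1 +
  e and adds 1, which is Pascal's rule on the coefficients; everything from e^4 on is collected in
  r.\<close>

lemma qnum_expansion4:
  "\<exists>r. int (qnum (Suc e) n) = int n + int e * c2 (int n) + int e ^ 2 * c3 (int n)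
    + int e ^ 3 * c4 (int n) + int e ^ 4 * r"
proof (induction n)
  case (Suc n)
  then obtain r where r: "int (qnum (Suc e) n) = int n + int e * c2 (int n) + int e ^ 2 * c3 (int n)
      + int e ^ 3 * c4 (int n) + int e ^ 4 * r"
    by blast
  have "int (qnum (Suc e) (Suc n)) = 1 + (1 + int e) * int (qnum (Suc e) n)"
    by (simp add: qnum_Suc' distrib_right)
  also have "\<dots> = int (Suc n) + int e * c2 (int (Suc n)) + int e ^ 2 * c3 (int (Suc n))
      + int e ^ 3 * c4 (int (Suc n)) + int e ^ 4 * (r + c4 (int n) + int e * r)"
  proof -
    have s: "c2 (int (Suc n)) = c2 (int n) + int n" "c3 (int (Suc n)) = c3 (int n) + c2 (int n)"
        "c4 (int (Suc n)) = c4 (int n) + c3 (int n)"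
      using c2_add[of "int n" 1] c3_add[of "int n" 1] c4_add[of "int n" 1] by (simp_all add: add.commute)
    show ?thesis unfolding r s unfolding of_nat_Suc by Groebner_Basis.algebra
  qed
  finally show ?case by blast
qed (auto intro: exI[of _ 0])

lemma power_expansion4:
  "\<exists>r. int (Suc e ^ n) = 1 + int e * int n + int e ^ 2 * c2 (int n) + int e ^ 3 * c3 (int n) + int e ^ 4 * r"
proof -
  obtain r where r: "int (qnum (Suc e) n) = int n + int e * c2 (int n) + int e ^ 2 * c3 (int n)
      + int e ^ 3 * c4 (int n) + int e ^ 4 * r"
    using qnum_expansion4 by blast
  have "int (Suc e ^ n) = 1 + int e * int (qnum (Suc e) n)"
    by (simp only: power_eq_qnum of_nat_add of_nat_mult of_nat_1)
  also have "\<dots> = 1 + int e * int n + int e ^ 2 * c2 (int n) + int e ^ 3 * c3 (int n)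
      + int e ^ 4 * (c4 (int n) + int e * r)"
    unfolding r by Groebner_Basis.algebra
  finally show ?thesis by blast
qed

lemma qnum_expansion:
  "\<exists>r. int (qnum (Suc e) n) = int n + int e * c2 (int n) + int e ^ 2 * c3 (int n) + int e ^ 3 * r"
proof -
  obtain r where "int (qnum (Suc e) n) = int n + int e * c2 (int n) + int e ^ 2 * c3 (int n)
      + int e ^ 3 * c4 (int n) + int e ^ 4 * r"
    using qnum_expansion4 by blast
  also have "\<dots> = int n + int e * c2 (int n) + int e ^ 2 * c3 (int n) + int e ^ 3 * (c4 (int n) + int e * r)"
    by Groebner_Basis.algebra
  finally show ?thesis by blast
qed

lemma power_expansion:
  "\<exists>r. int (Suc e ^ n) = 1 + int e * int n + int e ^ 2 * c2 (int n) + int e ^ 3 * r"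
proof -
  obtain r where "int (Suc e ^ n) = 1 + int e * int n + int e ^ 2 * c2 (int n) + int e ^ 3 * c3 (int n) + int e ^ 4 * r"
    using power_expansion4 by blast
  also have "\<dots> = 1 + int e * int n + int e ^ 2 * c2 (int n) + int e ^ 3 * (c3 (int n) + int e * r)"
    by Groebner_Basis.algebra
  finally show ?thesis by blast
qed

lemma c2_triple: "c2 (3 * x) = 3 * x + 9 * c2 x"
proof -
  have "2 * c2 (3 * x) = 2 * (3 * x) + 9 * (2 * c2 x)" unfolding two_c2 by Groebner_Basis.algebra
  then show ?thesis by simp
qed

lemma c3_triple: "c3 (3 * x) = x + 9 * x * c2 x"
proof -
  have "6 * c3 (3 * x) = 6 * x + 27 * x * (2 * c2 x)" unfolding two_c2 six_c3 by Groebner_Basis.algebra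
  then show ?thesis by simp
qed

lemma c4_triple: "3 dvd c4 (3 * x)"
proof -
  have "3 * (8 * c4 (3 * x)) = 3 * (3 * (x * (x - 1) * (3 * x - 1) * (3 * x - 2)))"
    using c4_eq[of "3 * x"] by (simp add: algebra_simps)
  then have "3 dvd 8 * c4 (3 * x)" by simp
  then show ?thesis by presburger
qed

lemma c3_mult: "c3 (t * x) = t * c3 x + 2 * (c2 x * x) * c2 t + x ^ 3 * c3 t"
proof -
  have "6 * c3 (t * x) = t * (6 * c3 x) + 3 * (2 * c2 x * x) * (2 * c2 t) + x ^ 3 * (6 * c3 t)"
    unfolding two_c2 six_c3 by Groebner_Basis.algebra
  then show ?thesis by simp
qed

lemma times_c2: "t * c2 t = 3 * c3 t + 2 * c2 t"
proof -
  have "2 * (t * c2 t) = t * (2 * c2 t)" by simp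
  also have "\<dots> = 6 * c3 t + 2 * (2 * c2 t)" unfolding two_c2 six_c3 by Groebner_Basis.algebra
  then show ?thesis by simp
qed

section \<open>Congruences for q-numbers modulo powers of p\<close>

lemma dvd_diffE:
  fixes d :: "'a :: comm_ring_1"
  assumes "d dvd x - y"
  obtains s where "x = y + d * s"
proof -
  from assms obtain s where "x - y = d * s" by blast
  then show thesis by (intro that[of s]) (simp add: algebra_simps)
qed

lemma cong_intE:
  fixes d :: int
  assumes "[x = y] (mod d)"
  obtains s where "x = y + d * s"
  using assms dvd_diffE that by (metis cong_iff_dvd_diff)

text \<open>The base \<open>b\<close> = 1 + p^m u is the inverse of \<alpha>, written so that p^m
  divides b - 1 exactly. Asking m \<ge> 2 for p = 2 makes b = 1 modulo 4; otherwise [2] = 1 + b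
  would be divisible by 4, and n and [n] would not have the same valuation.\<close>

locale padic_base =
  fixes p m u :: nat
  assumes p: "prime p" and m: "m \<ge> 1" and u: "\<not> p dvd u" and p2: "p = 2 \<longrightarrow> m \<ge> 2"
begin

definition e :: nat where "e = p ^ m * u"

definition b :: nat where "b = Suc e"

lemma p_gt_1: "p > 1" and p_pos: "p > 0"
  using p prime_gt_1_nat prime_gt_0_nat by auto

lemma prime_int_p: "prime (int p)"
  using p by simp

lemma e_dvd: "int p ^ m dvd int e"
  by (simp add: e_def)

lemma odd_half: "odd p \<Longrightarrow> int p ^ a dvd 2 * x \<longleftrightarrow> int p ^ a dvd x"
  by (subst coprime_dvd_mult_right_iff) (auto intro!: coprime_power_left_iff[THEN iffD2])

lemma qnum_cong_id: "[int (qnum (Suc f) c) = int c] (mod int f)"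
proof -
  obtain r where "int (qnum (Suc f) c) = int c + int f * c2 (int c) + int f ^ 2 * c3 (int c) + int f ^ 3 * r"
    using qnum_expansion by blast
  then have "int (qnum (Suc f) c) - int c = int f * (c2 (int c) + int f * c3 (int c) + int f ^ 2 * r)"
    by Groebner_Basis.algebra
  then show ?thesis by (simp add: cong_iff_dvd_diff)
qed

text \<open>For n = p the coefficient of f is p(p-1)/2, itself a multiple of the odd prime p; the
  later terms contain f^2, and 2m \<ge> m + 1.\<close>

lemma qnum_prime_odd:
  assumes "odd p" "p ^ m dvd f"
  shows "int p ^ Suc m dvd int (qnum (Suc f) p) - int p"
proof -
  obtain r where r: "int (qnum (Suc f) p) = int p + int f * c2 (int p) + int f ^ 2 * c3 (int p) + int f ^ 3 * r"
    using qnum_expansion by blast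
  obtain t where t: "int f = int p ^ m * t" using assms(2)
    by (metis dvdE of_nat_mult of_nat_power)
  have "int p dvd c2 (int p)"
    using odd_half[OF assms(1), of 1 "c2 (int p)"] by (simp add: two_c2)
  then obtain s where s: "c2 (int p) = int p * s" by blast
  obtain m' where m': "m = Suc m'" using m by (cases m) auto
  have "int (qnum (Suc f) p) - int p = int p ^ Suc m * (t * s + int p ^ m' * t ^ 2 * c3 (int p) + int p ^ m' * t ^ 2 * int f * r)"
    unfolding r s by (simp add: t m' algebra_simps power2_eq_square power3_eq_cube)
  then show ?thesis by simp
qed

text \<open>The induction rests on [p^(a+1)] = [p^a] [p]', where the second factor has base b^(p^a)
  = 1 + f and p^m still divides f.\<close>

lemma qnum_ppow_odd:
  assumes "odd p"
  shows "int p ^ (a + m) dvd int (qnum b (p ^ a)) - int p ^ a"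
proof (induction a)
  case (Suc a)
  then obtain s where s: "int (qnum b (p ^ a)) = int p ^ a + int p ^ (a + m) * s"
    by (rule dvd_diffE)
  define f where "f = e * qnum b (p ^ a)"
  have f: "b ^ (p ^ a) = Suc f" by (simp add: f_def b_def power_eq_qnum)
  have "p ^ m dvd f" by (simp add: f_def e_def)
  from qnum_prime_odd[OF assms this] obtain t where
    t: "int (qnum (Suc f) p) = int p + int p ^ Suc m * t"
    by (rule dvd_diffE)
  have "int (qnum b (p ^ Suc a)) = int (qnum b (p ^ a)) * int (qnum (Suc f) p)"
    by (simp add: qnum_mult mult.commute[of p] f)
  also have "\<dots> - int p ^ Suc a = int p ^ (Suc a + m) * (t + s + int p ^ m * s * t)"
    unfolding s t by (simp add: algebra_simps power_add)
  finally show ?case by simp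
qed simp

lemma qnum_odd:
  assumes "odd p" "p ^ a dvd n"
  shows "int p ^ (a + m) dvd int (qnum b n) - int n"
proof -
  obtain c where c: "n = p ^ a * c" using assms by blast
  define f where "f = e * qnum b (p ^ a)"
  have f: "b ^ (p ^ a) = Suc f" by (simp add: f_def b_def power_eq_qnum)
  obtain s where s: "int (qnum b (p ^ a)) = int p ^ a + int p ^ (a + m) * s"
    using qnum_ppow_odd[OF assms(1), of a] by (rule dvd_diffE)
  have "int p ^ m dvd int f" by (simp add: f_def e_def)
  then have "[int (qnum (Suc f) c) = int c] (mod int p ^ m)"
    using qnum_cong_id[of f c] cong_dvd_modulus by blast
  then obtain t where t: "int (qnum (Suc f) c) = int c + int p ^ m * t"
    by (rule cong_intE)
  have "int (qnum b n) = int (qnum b (p ^ a)) * int (qnum (Suc f) c)"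
    by (simp add: qnum_mult f c)
  also have "\<dots> - int n = int p ^ (a + m) * (s * int c + t + int p ^ m * s * t)"
    unfolding s t by (simp add: c algebra_simps power_add)
  finally show ?thesis by simp
qed

text \<open>The correction 2^(a+m) is born at [2] = 2 + e, where the binomial coefficient 2 over 2
  is odd. Afterwards w = [2^(a+1)] passes to 2 w + e w^2; the square is too divisible to matter, so
  the correction just doubles.\<close>

lemma qnum_ppow_two:
  assumes "p = 2"
  shows "2 ^ (Suc a + m) dvd int (qnum b (2 ^ Suc a)) - 2 ^ Suc a - 2 ^ (a + m)"
proof (induction a)
  case 0
  obtain v where v: "u = 2 * v + 1" using u assms by (auto elim: oddE)
  have "qnum b (2 ^ Suc 0) = 2 + e" by (simp add: qnum_def b_def numeral_2_eq_2)
  moreover have "int e = 2 ^ m * (2 * int v + 1)" unfolding e_def unfolding assms v by (simp add: algebra_simps)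
  ultimately have "int (qnum b (2 ^ Suc 0)) - 2 ^ Suc 0 - 2 ^ (0 + m) = 2 ^ (Suc 0 + m) * int v"
    by (simp add: algebra_simps)
  then show ?case by (metis dvd_triv_left)
next
  case (Suc a)
  define w where "w = qnum b (2 ^ Suc a)"
  from Suc obtain s where s: "int w = 2 ^ Suc a + 2 ^ (a + m) + 2 ^ (Suc a + m) * s"
    unfolding w_def diff_diff_eq by (rule dvd_diffE)
  define k where "k = 1 + 2 ^ (m - 1) + 2 ^ m * s"
  have mm: "(2::int) ^ m = 2 * 2 ^ (m - 1)" using m by (cases m) auto
  have w: "int w = 2 ^ Suc a * k" unfolding s k_def by (simp add: algebra_simps power_add mm)
  define f where "f = e * w"
  have f: "b ^ (2 ^ Suc a) = Suc f" by (simp add: f_def b_def power_eq_qnum w_def)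
  have "qnum b (2 ^ Suc (Suc a)) = qnum b (2 ^ Suc a * 2)" by (simp add: mult.commute)
  also have "\<dots> = w * qnum (Suc f) 2"
    by (simp only: qnum_mult f w_def)
  also have "qnum (Suc f) 2 = 2 + f" by (simp add: qnum_def numeral_2_eq_2)
  finally have *: "int (qnum b (2 ^ Suc (Suc a))) = 2 * int w + int e * int w * int w"
    by (simp add: f_def algebra_simps)
  have e: "int e = 2 ^ m * int u" unfolding e_def unfolding assms by simp
  define x :: int where "x = 2 ^ a"
  define N :: int where "N = 2 ^ (m - 1)"
  have "int (qnum b (2 ^ Suc (Suc a))) - 2 ^ Suc (Suc a) - 2 ^ (Suc a + m)
     = 2 ^ (Suc (Suc a) + m) * (s + 2 ^ a * k ^ 2 * int u)"
    unfolding * unfolding w e k_def power_add power_Suc mm x_def[symmetric] N_def[symmetric] by Groebner_Basis.algebra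
  then show ?case by simp
qed

text \<open>Modulo 2^(a+m) adding 2^(m-1) n is the same as subtracting it. The sign is chosen so
  that \<sigma> = 2^(m-1) appears here as it does in the relation C^q = A^(\<sigma> q).\<close>

lemma qnum_two:
  assumes "p = 2" "2 ^ a dvd n" "a \<ge> 1"
  shows "2 ^ (a + m) dvd int (qnum b n) - int n + 2 ^ (m - 1) * int n"
proof -
  obtain a' where a': "a = Suc a'" using assms(3) by (cases a) auto
  obtain c where c: "n = 2 ^ a * c" using assms by blast
  define f where "f = e * qnum b (2 ^ a)"
  have f: "b ^ (2 ^ a) = Suc f" by (simp add: f_def b_def power_eq_qnum)
  obtain s where s: "int (qnum b (2 ^ a)) = 2 ^ a + 2 ^ (a' + m) + 2 ^ (a + m) * s"
    using qnum_ppow_two[OF assms(1), of a'] unfolding a' diff_diff_eq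
    by (rule dvd_diffE)
  have mm: "(2::int) ^ m = 2 * 2 ^ (m - 1)" using m by (cases m) auto
  have s': "int (qnum b (2 ^ a)) = 2 ^ a * (1 + 2 ^ (m - 1) + 2 ^ m * s)"
    unfolding s by (simp add: a' algebra_simps power_add mm)
  have "2 ^ m dvd int e" unfolding e_def unfolding assms by simp
  then have "2 ^ m dvd int f" by (simp add: f_def)
  then have "[int (qnum (Suc f) c) = int c] (mod 2 ^ m)"
    using qnum_cong_id[of f c] cong_dvd_modulus by blast
  then obtain t where t: "int (qnum (Suc f) c) = int c + 2 ^ m * t"
    by (rule cong_intE)
  have "int (qnum b n) = int (qnum b (2 ^ a)) * int (qnum (Suc f) c)"
    by (simp add: qnum_mult f c)
  also have "\<dots> - int n + 2 ^ (m - 1) * int n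
      = 2 ^ (a + m) * (s * int c + int c + t * (1 + 2 ^ (m - 1) + 2 ^ m * s))"
    unfolding s' t by (simp add: c algebra_simps power_add mm)
  finally show ?thesis by simp
qed

text \<open>A form common to all p. For p = 2 the correction 2^(m-1) n is absorbed because m \<ge> 2
  leaves it at least one factor 2.\<close>

lemma qnum_weak:
  assumes "p ^ a dvd n"
  shows "int p ^ Suc a dvd int (qnum b n) - int n"
proof (cases "p = 2")
  case False
  then have "odd p" using p primes_dvd_imp_eq two_is_prime_nat by blast
  from qnum_odd[OF this assms] show ?thesis
    using m by (rule_tac dvd_trans[OF le_imp_power_dvd]) auto
next
  case True
  then have m2: "m \<ge> 2" using p2 by auto
  show ?thesis
  proof (cases "a \<ge> 1")
    case True
    have "2 ^ (a + m) dvd int (qnum b n) - int n + 2 ^ (m - 1) * int n"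
      using qnum_two[OF \<open>p = 2\<close> _ True] assms \<open>p = 2\<close> by metis
    moreover have "int p ^ Suc a dvd 2 ^ (a + m)"
      using m \<open>p = 2\<close> by (simp add: le_imp_power_dvd flip: power_Suc)
    ultimately have "int p ^ Suc a dvd int (qnum b n) - int n + 2 ^ (m - 1) * int n"
      using dvd_trans by blast
    moreover have "int p ^ Suc a dvd 2 ^ (m - 1) * int n"
    proof -
      have "int 2 ^ a dvd int n" using assms \<open>p = 2\<close> by (metis of_nat_dvd_iff of_nat_power)
      moreover have "(2::int) dvd 2 ^ (m - 1)" using m2 by simp
      ultimately have "2 * 2 ^ a dvd 2 ^ (m - 1) * int n" by (intro mult_dvd_mono) auto
      then show ?thesis using \<open>p = 2\<close> by simp
    qed
    ultimately show ?thesis by (simp add: dvd_add_left_iff)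
  next
    case False
    then have "a = 0" by simp
    moreover have "p dvd e" using m by (simp add: e_def dvd_power)
    then have "int p dvd int e" by (rule of_nat_dvd_iff[THEN iffD2])
    ultimately show ?thesis using qnum_cong_id[of e n] unfolding b_def
      by (auto simp: cong_iff_dvd_diff simp del: of_nat_dvd_iff intro: dvd_trans)
  qed
qed

text \<open>By \<open>qnum_weak\<close>, n and [n] agree modulo one power of p more than the one
  already dividing n, so their valuations are equal.\<close>

lemma dvd_qnum_iff: "p ^ a dvd qnum b n \<longleftrightarrow> p ^ a dvd n"
proof (induction a)
  case (Suc a)
  show ?case
  proof (cases "p ^ a dvd n")
    case True
    have "int p ^ Suc a dvd int (qnum b n) \<longleftrightarrow> int p ^ Suc a dvd int n"
      using qnum_weak[OF True] by (metis dvd_diff_right_iff dvd_diff_left_iff)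
    then show ?thesis by (metis of_nat_dvd_iff of_nat_power)
  next
    case False
    then show ?thesis using Suc by (metis power_Suc dvd_mult_right)
  qed
qed simp

text \<open>Lifting the exponent: b^n - 1 = p^m u [n], and [n] has the valuation of n.\<close>

lemma dvd_power_iff: "p ^ (m + a) dvd b ^ n - 1 \<longleftrightarrow> p ^ a dvd n"
proof -
  have "b ^ n - 1 = p ^ m * (u * qnum b n)"
    unfolding b_def power_eq_qnum by (simp add: e_def)
  then have "p ^ (m + a) dvd b ^ n - 1 \<longleftrightarrow> p ^ a dvd u * qnum b n"
    using p_pos by (simp add: power_add)
  also have "\<dots> \<longleftrightarrow> p ^ a dvd qnum b n"
    using u p by (intro coprime_dvd_mult_right_iff) (simp add: prime_imp_coprime coprime_power_left_iff)
  finally show ?thesis by (simp add: dvd_qnum_iff)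
qed

lemma b_cong_1: "[b = 1] (mod p)"
proof -
  have "p dvd e" using m by (simp add: e_def dvd_power)
  then show ?thesis by (simp add: b_def cong_altdef_nat)
qed

lemma coprime_b: "coprime b (p ^ a)"
  using b_cong_1 p 
    by (meson cong_imp_coprime cong_sym coprime_1_left coprime_power_right_iff)

end

section \<open>Iterated q-numbers\<close>

text \<open>In the permutation model the \<open>t\<close>-th power of the inverse of \<open>B\<close> replaces the exponent
  \<open>i\<close> of \<open>A\<close> by \<open>qiter b i t\<close> and adds \<open>qiter_sum b i t\<close> to the exponent of \<open>C\<close>;
  \<open>qiter_psum\<close> governs the change of the exponent of \<open>B\<close>.\<close>

definition qiter :: "nat \<Rightarrow> nat \<Rightarrow> nat \<Rightarrow> nat" where
  "qiter b i t = (qnum b ^^ t) i"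

definition qiter_sum :: "nat \<Rightarrow> nat \<Rightarrow> nat \<Rightarrow> nat" where
  "qiter_sum b i t = (\<Sum>s<t. qiter b i s)"

definition qiter_psum :: "nat \<Rightarrow> nat \<Rightarrow> nat \<Rightarrow> nat" where
  "qiter_psum b i t = (\<Sum>s<t. b ^ qiter_sum b i s)"

lemma c2_add_of_dvd_odd:
  assumes "odd p" "int p ^ a dvd h"
  shows "int p ^ a dvd c2 (x + h) - c2 x"
proof -
  have "2 * (c2 (x + h) - c2 x) = h * (2 * x + h - 1)"
    unfolding right_diff_distrib two_c2 by Groebner_Basis.algebra
  moreover have "int p ^ a dvd h * (2 * x + h - 1)" using assms(2) by simp
  moreover have "coprime (int p ^ a) 2"
    using assms(1) by (simp add: coprime_commute)
  ultimately show ?thesis by (metis coprime_dvd_mult_right_iff)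
qed

section \<open>The congruences required by the model: odd p, then p = 2\<close>

context padic_base
begin

lemma qiter_0 [simp]: "qiter b i 0 = i"
  and qiter_Suc: "qiter b i (Suc t) = qnum b (qiter b i t)"
  by (simp_all add: qiter_def)

lemma qnum_b_expansion:
  obtains r where "int (qnum b n) = int n + int e * c2 (int n) + int e ^ 2 * c3 (int n) + int e ^ 3 * r"
  using qnum_expansion[of e n] unfolding b_def by blast

text \<open>Each iteration adds e c2(x) for the current x. As x differs from i by a multiple of p^m,
  for odd p so does c2(x) from c2(i), and the factor e makes the difference vanish modulo
  p^(2m).\<close>

lemma qiter_odd:
  assumes "odd p"
  shows "int p ^ (2 * m) dvd int (qiter b i t) - (int i + int t * int e * c2 (int i))"
proof (induction t)
  case (Suc t)
  define P where "P = int p ^ m"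
  have PP: "int p ^ (2 * m) = P * P" by (simp add: P_def power_mult power2_eq_square mult.commute power_mult_distrib)
  obtain E where E: "int e = P * E" using e_dvd P_def by blast
  from Suc obtain s where s: "int (qiter b i t) = int i + int t * int e * c2 (int i) + P * P * s"
    unfolding PP by (rule dvd_diffE)
  have "int p ^ m dvd c2 (int i + P * (int t * E * c2 (int i) + P * s)) - c2 (int i)"
    by (rule c2_add_of_dvd_odd[OF assms]) (simp add: P_def)
  also have "int i + P * (int t * E * c2 (int i) + P * s) = int (qiter b i t)"
    unfolding s E by Groebner_Basis.algebra
  finally obtain w where w: "c2 (int (qiter b i t)) = c2 (int i) + P * w"
    unfolding P_def[symmetric] by (rule dvd_diffE)
  obtain r where r: "int (qnum b (qiter b i t)) = int (qiter b i t) + int e * c2 (int (qiter b i t))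
      + int e ^ 2 * c3 (int (qiter b i t)) + int e ^ 3 * r"
    by (rule qnum_b_expansion)
  define C where "C = c3 (int (qiter b i t))"
  have "int (qiter b i (Suc t)) - (int i + int (Suc t) * int e * c2 (int i))
     = P * P * (s + E * w + E ^ 2 * C + E ^ 3 * P * r)"
    unfolding qiter_Suc r w C_def[symmetric] unfolding s E of_nat_Suc by Groebner_Basis.algebra
  then show ?case unfolding PP by simp
qed simp

text \<open>Dividing by 6 costs at most one factor 3, and 2m - 1 \<ge> m.\<close>

lemma dvd_six:
  assumes "odd p" "int p ^ (2 * m) dvd 6 * y"
  shows "int p ^ m dvd y"
proof (cases "p = 3")
  case True
  have "2 * m = Suc (2 * m - 1)" using m by simp
  then have "int p ^ (2 * m) = 3 * 3 ^ (2 * m - 1)"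
    unfolding True by (metis of_nat_numeral power_Suc)
  moreover have "6 * y = 3 * (2 * y)" by simp
  ultimately have "(3::int) * 3 ^ (2 * m - 1) dvd 3 * (2 * y)"
    using assms(2) by simp
  then have "(3::int) ^ (2 * m - 1) dvd 2 * y"
    by (subst (asm) dvd_times_left_cancel_iff) simp_all
  then have "int p ^ (2 * m - 1) dvd 2 * y" using True by simp
  then have "int p ^ (2 * m - 1) dvd y" using odd_half assms by blast
  moreover have "int p ^ m dvd int p ^ (2 * m - 1)" using m by (intro le_imp_power_dvd) simp
  ultimately show ?thesis by (rule dvd_trans[rotated])
next
  case False
  have "coprime p 6"
  proof -
    have "coprime p 2" using assms(1) by simp
    moreover have "coprime p 3" using False p by (simp add: primes_coprime)
    ultimately have "coprime p (2 * 3)" by (simp only: coprime_mult_right_iff)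
    then show ?thesis by simp
  qed
  then have "coprime (int p ^ (2 * m)) 6"
  proof -
    have "coprime (int p) (int 6)" using \<open>coprime p 6\<close> by (simp only: coprime_int_iff)
    then show ?thesis by simp
  qed
  then have "int p ^ (2 * m) dvd y" using assms(2) by (simp add: coprime_dvd_mult_right_iff)
  moreover have "int p ^ m dvd int p ^ (2 * m)" by (intro le_imp_power_dvd) simp
  ultimately show ?thesis by (rule dvd_trans[rotated])
qed

text \<open>With D the inverse of B, these are the conditions for D C and C D^b to send A^i C^k B^j
  to the same element: they compare the exponents of C, of B and of A. Everything is expanded in
  powers of P = p^m up to P^3.\<close>

lemma model_relation_odd:
  assumes odd: "odd p"
  shows "int p ^ (2 * m) dvd int (qiter_sum b i b) - int (b * i)"
    and "int p ^ (2 * m) dvd int (qiter_psum b i b) - int b"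
    and "int p ^ (3 * m) dvd
      int (qnum b (b * i)) - int (b * qiter b i b) - (int (qiter_psum b i b) - int b)"
proof -
  define P where "P = int p ^ m"
  define I where "I = int i"
  define B where "B = int b"
  define X where "X t = int (qiter b i t)" for t
  define S where "S t = int (qiter_sum b i t)" for t
  define U where "U = int (qiter_psum b i b)"
  have P2: "int p ^ (2 * m) = P ^ 2" and P3: "int p ^ (3 * m) = P ^ 3"
    by (simp_all add: P_def flip: power_mult) (simp_all add: mult.commute)
  obtain E where E: "int e = P * E" using e_dvd P_def by blast
  have B: "B = 1 + P * E" by (simp add: B_def b_def E[symmetric])
  have half: "P ^ n dvd 2 * x \<longleftrightarrow> P ^ n dvd x" for n x
    using odd_half[OF odd, of "m * n" x] by (simp add: P_def power_mult)
  have half1: "P dvd 2 * x \<longleftrightarrow> P dvd x" for x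
    using half[of 1] by simp
  have dvd_c2: "P dvd c2 x" if "P dvd x * (x - 1)" for x
    using half1[of "c2 x"] that by (simp only: two_c2)
  have "P dvd c2 B" by (rule dvd_c2) (simp add: B)
  then obtain b2 where b2: "c2 B = P * b2" by blast
  have c3B: "3 * c3 B = P * b2 * (B - 2)"
  proof -
    have "2 * (3 * c3 B) = 2 * c2 B * (B - 2)" unfolding two_c2 using six_c3[of B] by simp
    then show ?thesis unfolding b2 by simp
  qed
  have "\<exists>r. X t = I + int t * (P * E) * c2 I + P ^ 2 * r" for t
    using qiter_odd[OF odd, of i t] unfolding X_def I_def P2 E by (elim dvd_diffE) blast
  then obtain r where r: "\<And>t. X t = I + int t * (P * E) * c2 I + P ^ 2 * r t" by metis
  define h where "h t = int t * E * c2 I + P * r t" for t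
  have X: "X t = I + P * h t" for t unfolding r h_def by Groebner_Basis.algebra
  have "S t = (\<Sum>s<t. X s)" for t by (simp add: S_def qiter_sum_def X_def)
  then have S: "S t = int t * I + P * E * c2 I * c2 (int t) + P ^ 2 * (\<Sum>s<t. r s)" for t
    by (simp only: r sum.distrib sum_distrib_left sum_distrib_right sum_c2[symmetric])
      (simp add: mult_ac)
  have "S b - B * I = P ^ 2 * (E * c2 I * b2 + (\<Sum>s<b. r s))"
    unfolding S B_def[symmetric] b2 by Groebner_Basis.algebra
  then show "int p ^ (2 * m) dvd int (qiter_sum b i b) - int (b * i)"
    by (simp add: P2 S_def B_def I_def)

  have "\<exists>w. int (b ^ qiter_sum b i t) = 1 + P * E * S t + (P * E) ^ 2 * c2 (int t * I) + P ^ 3 * w" for t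
  proof -
    obtain k where k: "int (b ^ qiter_sum b i t) = 1 + P * E * S t + (P * E) ^ 2 * c2 (S t) + (P * E) ^ 3 * k"
      using power_expansion[of e "qiter_sum b i t"] unfolding S_def E b_def by blast
    have "P dvd c2 (int t * I + P * (E * c2 I * c2 (int t) + P * (\<Sum>s<t. r s))) - c2 (int t * I)"
      using c2_add_of_dvd_odd[OF odd, of m] by (simp add: P_def)
    also have "int t * I + P * (E * c2 I * c2 (int t) + P * (\<Sum>s<t. r s)) = S t"
      unfolding S by Groebner_Basis.algebra
    finally obtain l where l: "c2 (S t) = c2 (int t * I) + P * l" by (rule dvd_diffE)
    have "int (b ^ qiter_sum b i t) = 1 + P * E * S t + (P * E) ^ 2 * c2 (int t * I) + P ^ 3 * (E ^ 2 * l + E ^ 3 * k)"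
      unfolding k l by Groebner_Basis.algebra
    then show ?thesis by blast
  qed
  then obtain w where w: "\<And>t. int (b ^ qiter_sum b i t) = 1 + P * E * S t + (P * E) ^ 2 * c2 (int t * I) + P ^ 3 * w t"
    by metis
  define W where "W = (\<Sum>t<b. w t)"
  define R where "R = (\<Sum>t<b. \<Sum>s<t. r s)"
  have sumS: "(\<Sum>t<b. S t) = I * c2 B + P * E * c2 I * c3 B + P ^ 2 * R"
  proof -
    have "(\<Sum>t<b. S t) = (\<Sum>t<b. I * int t + P * E * c2 I * c2 (int t) + P ^ 2 * (\<Sum>s<t. r s))"
      unfolding S by (simp only: mult.commute)
    also have "\<dots> = I * (\<Sum>t<b. int t) + P * E * c2 I * (\<Sum>t<b. c2 (int t)) + P ^ 2 * R"
      by (simp only: sum.distrib sum_distrib_left R_def)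
    finally show ?thesis unfolding sum_c2 sum_c3 B_def .
  qed
  have "U = (\<Sum>t<b. int (b ^ qiter_sum b i t))"
    by (simp add: U_def qiter_psum_def)
  also have "\<dots> = B + P * E * (\<Sum>t<b. S t) + (P * E) ^ 2 * (\<Sum>t<b. c2 (int t * I)) + P ^ 3 * W"
    unfolding w by (simp add: sum.distrib sum_distrib_left B_def W_def)
  finally have U: "U - B = P * E * I * c2 B + (P * E) ^ 2 * I * c3 B + P ^ 3 * (E * R + W + E ^ 2 * c2 I * b2 * (B - 2) + E ^ 2 * b2 * c2 I)"
  proof -
    assume "U = B + P * E * (\<Sum>t<b. S t) + (P * E) ^ 2 * (\<Sum>t<b. c2 (int t * I)) + P ^ 3 * W"
    then have "U - B = P * E * I * c2 B + (P * E) ^ 2 * I * c3 B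
        + (P * E) ^ 2 * c2 I * (3 * c3 B + c2 B) + P ^ 3 * (E * R + W)"
      unfolding sumS sum_c2_mult B_def[symmetric] by Groebner_Basis.algebra
    then show ?thesis unfolding c3B unfolding b2 by Groebner_Basis.algebra
  qed
  have "U - B = P ^ 2 * (E * I * b2 + E ^ 2 * I * c3 B + P * (E * R + W + E ^ 2 * c2 I * b2 * (B - 2) + E ^ 2 * b2 * c2 I))"
    unfolding U b2 by Groebner_Basis.algebra
  then show "int p ^ (2 * m) dvd int (qiter_psum b i b) - int b"
    by (simp add: P2 U_def B_def)

  have "\<exists>k. X (Suc t) = X t + P * E * c2 (X t) + (P * E) ^ 2 * c3 (X t) + P ^ 3 * k" for t
  proof -
    obtain k where "int (qnum b (qiter b i t)) = int (qiter b i t) + int e * c2 (int (qiter b i t))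
      + int e ^ 2 * c3 (int (qiter b i t)) + int e ^ 3 * k" by (rule qnum_b_expansion)
    then have "X (Suc t) = X t + P * E * c2 (X t) + (P * E) ^ 2 * c3 (X t) + P ^ 3 * (E ^ 3 * k)"
      by (simp add: X_def qiter_Suc E power_mult_distrib)
    then show ?thesis by blast
  qed
  then obtain k where k: "\<And>t. X (Suc t) = X t + P * E * c2 (X t) + (P * E) ^ 2 * c3 (X t) + P ^ 3 * k t"
    by metis
  define K where "K = (\<Sum>t<b. k t)"
  have "X n = I + P * E * (\<Sum>t<n. c2 (X t)) + (P * E) ^ 2 * (\<Sum>t<n. c3 (X t)) + P ^ 3 * (\<Sum>t<n. k t)" for n
    by (induction n) (simp_all add: k distrib_left, simp add: X_def I_def)
  then have Xb: "X b = I + P * E * (\<Sum>t<b. c2 (X t)) + (P * E) ^ 2 * (\<Sum>t<b. c3 (X t)) + P ^ 3 * K"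
    unfolding K_def .
  \<comment> \<open>The linear part of h sums to a multiple of the binomial coefficient b over 2,
    which P divides; so the displacement of first order disappears over a full run of b
    iterations.\<close>
  have sumh: "(\<Sum>t<b. h t) = P * (E * c2 I * b2 + (\<Sum>t<b. r t))"
  proof -
    have "(\<Sum>t<b. h t) = (\<Sum>t<b. E * c2 I * int t + P * r t)"
      unfolding h_def by (simp only: mult_ac)
    also have "\<dots> = E * c2 I * (\<Sum>t<b. int t) + P * (\<Sum>t<b. r t)"
      by (simp only: sum.distrib sum_distrib_left)
    finally show ?thesis unfolding sum_c2 B_def[symmetric] b2 by Groebner_Basis.algebra
  qed
  have "2 * ((\<Sum>t<b. c2 (X t)) - B * c2 I) = (\<Sum>t<b. 2 * c2 (X t)) - B * (2 * c2 I)"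
    by (simp add: sum_distrib_left algebra_simps)
  also have "(\<Sum>t<b. 2 * c2 (X t)) = (\<Sum>t<b. 2 * c2 I + P * (2 * I - 1) * h t + P ^ 2 * (h t) ^ 2)"
    by (rule sum.cong) (simp_all add: two_c2 X, Groebner_Basis.algebra)
  also have "\<dots> = B * (2 * c2 I) + P * (2 * I - 1) * (\<Sum>t<b. h t) + P ^ 2 * (\<Sum>t<b. (h t) ^ 2)"
    by (simp add: sum.distrib sum_distrib_left B_def)
  also have "\<dots> - B * (2 * c2 I) = P ^ 2 * ((2 * I - 1) * (E * c2 I * b2 + (\<Sum>t<b. r t)) + (\<Sum>t<b. (h t) ^ 2))"
    unfolding sumh by Groebner_Basis.algebra
  finally have "P ^ 2 dvd 2 * ((\<Sum>t<b. c2 (X t)) - B * c2 I)" by simp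
  then obtain g2 where g2: "(\<Sum>t<b. c2 (X t)) = B * c2 I + P ^ 2 * g2"
    unfolding half by (rule dvd_diffE)

  have c2h: "P dvd c2 (P * h t)" for t by (rule dvd_c2) simp
  \<comment> \<open>For p = 3 a single c3 (P h) need not be divisible by P. Only the sum is, because
    \<open>sumh\<close> provides a second factor P before division by 6.\<close>
  have "6 * (\<Sum>t<b. c3 (P * h t)) = (\<Sum>t<b. P ^ 3 * (h t) ^ 3 - 3 * P ^ 2 * (h t) ^ 2 + 2 * P * h t)"
    unfolding sum_distrib_left six_c3 by (rule sum.cong) (simp, Groebner_Basis.algebra)
  also have "\<dots> = P ^ 3 * (\<Sum>t<b. (h t) ^ 3) - 3 * P ^ 2 * (\<Sum>t<b. (h t) ^ 2) + 2 * P * (\<Sum>t<b. h t)"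
    by (simp add: sum.distrib sum_subtractf sum_distrib_left)
  also have "\<dots> = P ^ 2 * (P * (\<Sum>t<b. (h t) ^ 3) - 3 * (\<Sum>t<b. (h t) ^ 2) + 2 * (E * c2 I * b2 + (\<Sum>t<b. r t)))"
    unfolding sumh by Groebner_Basis.algebra
  finally have c3h: "P dvd (\<Sum>t<b. c3 (P * h t))"
    using dvd_six[OF odd] unfolding P2 P_def[symmetric] by (metis dvd_triv_left)
  have "(\<Sum>t<b. c3 (X t)) - B * c3 I = c2 I * P * (\<Sum>t<b. h t) + I * (\<Sum>t<b. c2 (P * h t)) + (\<Sum>t<b. c3 (P * h t))"
    by (simp add: X c3_add sum.distrib sum_distrib_left B_def mult_ac)
  also have "P dvd c2 I * P * (\<Sum>t<b. h t)" by simp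
  then have "P dvd c2 I * P * (\<Sum>t<b. h t) + I * (\<Sum>t<b. c2 (P * h t)) + (\<Sum>t<b. c3 (P * h t))"
  proof (intro dvd_add)
    show "P dvd I * (\<Sum>t<b. c2 (P * h t))" by (intro dvd_mult dvd_sum c2h)
  qed (use c3h in auto)
  finally obtain g3 where g3: "(\<Sum>t<b. c3 (X t)) = B * c3 I + P * g3" by (rule dvd_diffE)

  obtain g where g: "int (qnum b (b * i)) = B * I + P * E * c2 (B * I) + (P * E) ^ 2 * c3 (B * I) + P ^ 3 * g"
  proof -
    obtain k where "int (qnum b (b * i)) = int (b * i) + int e * c2 (int (b * i)) + int e ^ 2 * c3 (int (b * i)) + int e ^ 3 * k"
      by (rule qnum_b_expansion)
    then show thesis by (intro that[of "E ^ 3 * k"]) (simp add: B_def I_def E power_mult_distrib)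
  qed
  have BI: "B * I = I + P * E * I" unfolding B by Groebner_Basis.algebra
  have e2: "c2 (B * I) = c2 I + I * (P * E * I) + c2 (P * E * I)"
    and e3: "c3 (B * I) = c3 I + c2 I * (P * E * I) + I * c2 (P * E * I) + c3 (P * E * I)"
    unfolding BI c2_add c3_add by simp_all
  have "P dvd c2 (P * E * I)" by (rule dvd_c2) (simp add: mult.assoc)
  then obtain l where l: "c2 (P * E * I) = P * l" by blast
  have l2: "2 * (P * l) = P * E * I * (P * E * I - 1)" using two_c2[of "P * E * I"] unfolding l by simp
  have b22: "2 * (P * b2) = B * (B - 1)" using two_c2[of B] unfolding b2 by simp
  \<comment> \<open>Both terms may lack a factor 3 when p = 3. In the difference the cubes combine
    to I^3 - I = 6 c3 (I + 1), which repairs this.\<close>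
  have "P dvd c3 (P * E * I) - I * c3 B"
  proof -
    have "3 * (2 * (c3 (P * E * I) - I * c3 B)) = 6 * c3 (P * E * I) - I * (6 * c3 B)" by simp
    also have "\<dots> = 3 * (P * (E * I * (1 - P * E * I) + 2 * P ^ 2 * E ^ 3 * c3 (I + 1)))"
      unfolding six_c3 B using six_c3[of "I + 1"] by Groebner_Basis.algebra
    finally have "2 * (c3 (P * E * I) - I * c3 B) = P * (E * I * (1 - P * E * I) + 2 * P ^ 2 * E ^ 3 * c3 (I + 1))"
      by simp
    then show ?thesis using half1 by (metis dvd_triv_left)
  qed
  then obtain z where z: "c3 (P * E * I) = I * c3 B + P * z" by (rule dvd_diffE)
  define G where "G = E * R + W + E ^ 2 * c2 I * b2 * (B - 2) + E ^ 2 * b2 * c2 I"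
  define A where "A = int (qnum b (b * i)) - B * X b - (U - B)"
  have A: "A = P ^ 3 * (E ^ 2 * I * l + E ^ 2 * z - B * E * g2 - B * E ^ 2 * g3 - B * K - G + g
       + E ^ 3 * I * c2 I - E ^ 3 * c3 I * (2 + P * E))
      + P ^ 2 * E ^ 2 * I ^ 2 - P ^ 2 * E ^ 2 * (2 + P * E) * c2 I + P * E * (P * l) - P * E * I * (P * b2)"
    unfolding A_def Xb g2 g3 g e2 e3 z U G_def[symmetric] l unfolding b2 unfolding B by Groebner_Basis.algebra
  \<comment> \<open>Doubling replaces l, b2 and c2 I by polynomials in P, E and I, and all terms of
    order below P^3 then cancel identically.\<close>
  have "2 * A = 2 * (P ^ 3 * (E ^ 2 * I * l + E ^ 2 * z - B * E * g2 - B * E ^ 2 * g3 - B * K - G + g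
       + E ^ 3 * I * c2 I - E ^ 3 * c3 I * (2 + P * E)))
      + 2 * P ^ 2 * E ^ 2 * I ^ 2 - P ^ 2 * E ^ 2 * (2 + P * E) * (2 * c2 I) + P * E * (2 * (P * l)) - P * E * I * (2 * (P * b2))"
    unfolding A by Groebner_Basis.algebra
  also have "\<dots> = P ^ 3 * (2 * (E ^ 2 * I * l + E ^ 2 * z - B * E * g2 - B * E ^ 2 * g3 - B * K - G + g
       + E ^ 3 * I * c2 I - E ^ 3 * c3 I * (2 + P * E)))"
    unfolding l2 b22 two_c2 unfolding B by Groebner_Basis.algebra
  finally have "P ^ 3 dvd 2 * A" by (metis dvd_triv_left)
  then have "P ^ 3 dvd A" unfolding half .
  then show "int p ^ (3 * m) dvd
      int (qnum b (b * i)) - int (b * qiter b i b) - (int (qiter_psum b i b) - int b)"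
    by (simp add: A_def P3 X_def U_def B_def)
qed


text \<open>Shifting x by P h changes c2(x) by -P h / 2 among other terms, which is only a multiple
  of 2^(m-1). This half survives multiplication by e modulo 2^(2m) and accumulates over t steps to
  the term with c2 t.\<close>

lemma qiter_two:
  assumes "p = 2"
  shows "\<exists>r. int (qiter b i t) = int i + int t * int e * c2 (int i)
    - 2 ^ m * 2 ^ (m - 1) * int u ^ 2 * c2 (int t) * c2 (int i) + 2 ^ (2 * m) * r"
proof (induction t)
  case 0
  show ?case by (auto intro: exI[of _ 0])
next
  case (Suc t)
  obtain m' where m': "m = Suc (Suc m')" using p2 assms by (metis Suc_le_D One_nat_def Suc_le_mono numeral_2_eq_2)
  define M :: int where "M = 2 ^ m'"
  define N :: int where "N = 2 * M"
  define P :: int where "P = 2 * N"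
  define E where "E = int u"
  have pw1: "(2::int) ^ m = P" "(2::int) ^ (m - 1) = N"
    by (simp_all add: P_def N_def M_def m')
  have pw2: "(2::int) ^ (2 * m) = P ^ 2"
    by (simp only: pw1[symmetric] power_mult[symmetric] mult.commute)
  note pw = pw1 pw2
  have e: "int e = P * E" unfolding e_def unfolding assms by (simp add: pw E_def)
  define I where "I = int i"
  define X where "X = int (qiter b i t)"
  from Suc obtain r where r: "X = I + int t * (P * E) * c2 I - P * N * E ^ 2 * c2 (int t) * c2 I + P ^ 2 * r"
    unfolding pw e X_def[symmetric] I_def[symmetric] E_def[symmetric] by blast
  define h where "h = int t * E * c2 I - N * E ^ 2 * c2 (int t) * c2 I + P * r"
  have X: "X = I + P * h" unfolding r h_def by Groebner_Basis.algebra
  obtain k where k: "int (qiter b i (Suc t)) = X + P * E * c2 X + (P * E) ^ 2 * c3 X + (P * E) ^ 3 * k"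
    using qnum_b_expansion[of "qiter b i t"] unfolding X_def[symmetric] e qiter_Suc by blast
  have "2 * c2 X = 2 * c2 I + 2 * I * (P * h) + P * P * h ^ 2 - P * h"
    unfolding two_c2 unfolding X by Groebner_Basis.algebra
  also have "P * h = P * (int t * E * c2 I) - P * (N * E ^ 2 * c2 (int t) * c2 I) + P * P * r"
    unfolding h_def by Groebner_Basis.algebra
  also have "2 * c2 I + 2 * I * (P * (int t * E * c2 I) - P * (N * E ^ 2 * c2 (int t) * c2 I) + P * P * r) + P * P * h ^ 2
      - (P * (int t * E * c2 I) - P * (N * E ^ 2 * c2 (int t) * c2 I) + P * P * r)
    = 2 * (c2 I - int t * N * E * c2 I + P * (I * h + N * h ^ 2 + M * E ^ 2 * c2 (int t) * c2 I - N * r))"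
    unfolding h_def P_def N_def by Groebner_Basis.algebra
  finally have "2 * c2 X = 2 * (c2 I - int t * N * E * c2 I + P * (I * h + N * h ^ 2 + M * E ^ 2 * c2 (int t) * c2 I - N * r))" .
  then have c: "c2 X = c2 I - int t * N * E * c2 I + P * (I * h + N * h ^ 2 + M * E ^ 2 * c2 (int t) * c2 I - N * r)"
    by simp
  have s: "c2 (int (Suc t)) = c2 (int t) + int t"
    using c2_add[of "int t" 1] by (simp add: add.commute)
  have "int (qiter b i (Suc t)) = I + int (Suc t) * (P * E) * c2 I - P * N * E ^ 2 * c2 (int (Suc t)) * c2 I
     + P ^ 2 * (r + E * (I * h + N * h ^ 2 + M * E ^ 2 * c2 (int t) * c2 I - N * r) + E ^ 2 * c3 X + E ^ 3 * P * k)"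
    unfolding k s unfolding c unfolding r of_nat_Suc by Groebner_Basis.algebra
  then show ?case unfolding pw e I_def[symmetric] E_def[symmetric] by blast
qed

text \<open>The exponent of C is now off by 2^(2m-1) u^2 c2(i) modulo 2^(2m): a multiple of q, yet
  possibly not of 2q. Since C^q = A^(\<sigma> q), this defect re-enters the exponent of A, which
  explains the last summand with factor \<sigma> = 2^(m-1).\<close>

lemma model_relation_two:
  assumes two: "p = 2"
  shows "2 ^ (2 * m - 1) dvd int (qiter_sum b i b) - int (b * i)"
    and "2 ^ (2 * m - 1) dvd int (qiter_psum b i b) - int b"
    and "2 ^ (3 * m - 1) dvd
      int (qnum b (b * i)) - int (b * qiter b i b) - (int (qiter_psum b i b) - int b)
      + 2 ^ (m - 1) * (int (b * i) - int (qiter_sum b i b))"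
proof -
  obtain m' where m': "m = Suc (Suc m')" using p2 assms by (metis Suc_le_D One_nat_def Suc_le_mono numeral_2_eq_2)
  define M :: int where "M = 2 ^ m'"
  define N :: int where "N = 2 * M"
  define P :: int where "P = 2 * N"
  define E where "E = int u"
  have pw1: "(2::int) ^ m = P" "(2::int) ^ (m - 1) = N"
    by (simp_all add: P_def N_def M_def m')
  have pw2: "(2::int) ^ (2 * m) = P ^ 2"
    by (simp only: pw1[symmetric] power_mult[symmetric] mult.commute)
  have "2 * m - 1 = m + (m - 1)" "3 * m - 1 = 2 * m + (m - 1)" using m by auto
  then have pw3: "(2::int) ^ (2 * m - 1) = P * N" "(2::int) ^ (3 * m - 1) = P ^ 2 * N"
    by (simp_all only: power_add pw1 pw2)
  note pw = pw1 pw2 pw3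
  have e: "int e = P * E" unfolding e_def unfolding two by (simp add: pw E_def)
  obtain f where f: "E = 2 * f + 1" using u two by (metis E_def even_of_nat oddE)
  define I where "I = int i"
  define B where "B = int b"
  define X where "X t = int (qiter b i t)" for t
  define S where "S t = int (qiter_sum b i t)" for t
  define U where "U = int (qiter_psum b i b)"
  define a where "a = c2 I"
  have a2: "2 * a = I * (I - 1)" unfolding a_def by (rule two_c2)
  have B: "B = 1 + P * E" by (simp add: B_def b_def e[symmetric])
  have c2B: "c2 B = N * E * B"
  proof -
    have "2 * c2 B = 2 * (N * E * B)" unfolding two_c2 unfolding B P_def by Groebner_Basis.algebra
    then show ?thesis by simp
  qed
  have c2P: "c2 (P * x) = N * (x * (P * x - 1))" for x
  proof -
    have "2 * c2 (P * x) = 2 * (N * (x * (P * x - 1)))" unfolding two_c2 P_def by Groebner_Basis.algebra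
    then show ?thesis by simp
  qed
  have co: "coprime N 3" unfolding N_def M_def by (simp add: coprime_mult_left_iff)
  have "N dvd c3 (P * x)" for x
  proof -
    have "2 * (3 * c3 (P * x)) = 2 * (N * (x * (P * x - 1) * (P * x - 2)))"
      using six_c3[of "P * x"] by (simp add: P_def mult_ac)
    then have "N dvd 3 * c3 (P * x)" by simp
    then show ?thesis using co by (simp add: coprime_dvd_mult_right_iff)
  qed
  then obtain c3P where c3P: "\<And>x. c3 (P * x) = N * c3P x" unfolding dvd_def by metis
  have "N dvd c3 B"
  proof -
    have "2 * (3 * c3 B) = 2 * (N * (E * B * (B - 2)))"
      using six_c3[of B] unfolding B by (simp add: P_def mult_ac)
    then have "N dvd 3 * c3 B" by simp
    then show ?thesis using co by (simp add: coprime_dvd_mult_right_iff)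
  qed
  then obtain b3 where c3B: "c3 B = N * b3" by blast
  have "\<exists>r. X t = I + int t * (P * E) * a - P * N * E ^ 2 * c2 (int t) * a + P ^ 2 * r" for t
    using qiter_two[OF two, of i t] unfolding X_def I_def pw e E_def a_def .
  then obtain r where r: "\<And>t. X t = I + int t * (P * E) * a - P * N * E ^ 2 * c2 (int t) * a + P ^ 2 * r t" by metis
  define h where "h t = int t * E * a - N * E ^ 2 * c2 (int t) * a + P * r t" for t
  have X: "X t = I + P * h t" for t unfolding r h_def by Groebner_Basis.algebra
  have SX: "S t = (\<Sum>s<t. X s)" for t by (simp add: S_def qiter_sum_def X_def)
  have S: "S t = int t * I + P * E * a * c2 (int t) - P * N * E ^ 2 * a * c3 (int t) + P ^ 2 * (\<Sum>s<t. r s)" for t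
  proof -
    have "S t = (\<Sum>s<t. I + P * E * a * int s - P * N * E ^ 2 * a * c2 (int s) + P ^ 2 * r s)"
      unfolding SX r by (rule sum.cong) (simp_all only: mult_ac)
    also have "\<dots> = (\<Sum>s<t. I) + P * E * a * (\<Sum>s<t. int s) - P * N * E ^ 2 * a * (\<Sum>s<t. c2 (int s)) + P ^ 2 * (\<Sum>s<t. r s)"
      by (simp only: sum.distrib sum_subtractf sum_distrib_left)
    finally show ?thesis unfolding sum_c2 sum_c3 by simp
  qed
  define G where "G = N * E ^ 3 * a - M * E ^ 2 * a * b3 + (\<Sum>s<b. r s)"
  have SB: "S b - B * I = P * N * E ^ 2 * a + P ^ 2 * G"
    unfolding S G_def B_def[symmetric] c2B c3B unfolding B P_def N_def by Groebner_Basis.algebra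
  have "S b - B * I = P * N * (E ^ 2 * a + 2 * G)"
    unfolding SB P_def by Groebner_Basis.algebra
  then show "2 ^ (2 * m - 1) dvd int (qiter_sum b i b) - int (b * i)"
    unfolding pw by (simp add: S_def B_def I_def)

  have "\<exists>w. int (b ^ qiter_sum b i t) = 1 + P * E * S t + (P * E) ^ 2 * c2 (int t * I) + P ^ 2 * N * w" for t
  proof -
    obtain k where k: "int (b ^ qiter_sum b i t) = 1 + P * E * S t + (P * E) ^ 2 * c2 (S t) + (P * E) ^ 3 * k"
      using power_expansion[of e "qiter_sum b i t"] unfolding S_def e b_def by blast
    define w where "w = E * a * c2 (int t) - N * E ^ 2 * a * c3 (int t) + P * (\<Sum>s<t. r s)"
    have St: "S t = int t * I + P * w" unfolding S w_def by Groebner_Basis.algebra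
    have c: "c2 (S t) = c2 (int t * I) + N * (2 * int t * I * w + w * (P * w - 1))"
      unfolding St c2_add c2P by (simp add: P_def algebra_simps)
    have "int (b ^ qiter_sum b i t) = 1 + P * E * S t + (P * E) ^ 2 * c2 (int t * I)
        + P ^ 2 * N * (E ^ 2 * (2 * int t * I * w + w * (P * w - 1)) + 2 * E ^ 3 * k)"
      unfolding k c unfolding P_def by Groebner_Basis.algebra
    then show ?thesis by blast
  qed
  then obtain w where w: "\<And>t. int (b ^ qiter_sum b i t) = 1 + P * E * S t + (P * E) ^ 2 * c2 (int t * I) + P ^ 2 * N * w t"
    by metis
  define W where "W = (\<Sum>t<b. w t)"
  define R where "R = (\<Sum>t<b. \<Sum>s<t. r s)"
  define T where "T = (\<Sum>t<b. c3 (int t))"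
  have sumS: "(\<Sum>t<b. S t) = I * c2 B + P * E * a * c3 B - P * N * E ^ 2 * a * T + P ^ 2 * R"
  proof -
    have "(\<Sum>t<b. S t) = (\<Sum>t<b. I * int t + P * E * a * c2 (int t) - P * N * E ^ 2 * a * c3 (int t) + P ^ 2 * (\<Sum>s<t. r s))"
      unfolding S by (simp only: mult.commute)
    also have "\<dots> = I * (\<Sum>t<b. int t) + P * E * a * (\<Sum>t<b. c2 (int t)) - P * N * E ^ 2 * a * T + P ^ 2 * R"
      by (simp only: sum.distrib sum_subtractf sum_distrib_left R_def T_def)
    finally show ?thesis unfolding sum_c2 sum_c3 B_def .
  qed
  define G1 where "G1 = E ^ 2 * a * b3 - E ^ 3 * a * T + 2 * E * R + E ^ 2 * ((2 * b3 + E * B) * a + b3 * I) + W"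
  have "U = (\<Sum>t<b. int (b ^ qiter_sum b i t))"
    by (simp add: U_def qiter_psum_def)
  also have "\<dots> = B + P * E * (\<Sum>t<b. S t) + (P * E) ^ 2 * (\<Sum>t<b. c2 (int t * I)) + P ^ 2 * N * W"
    unfolding w by (simp add: sum.distrib sum_distrib_left B_def W_def)
  finally have U: "U - B = P * E * I * c2 B + P ^ 2 * N * G1"
  proof -
    assume U: "U = B + P * E * (\<Sum>t<b. S t) + (P * E) ^ 2 * (\<Sum>t<b. c2 (int t * I)) + P ^ 2 * N * W"
    show ?thesis unfolding U sumS sum_c2_mult B_def[symmetric] G1_def a_def[symmetric] c3B c2B
      unfolding P_def by Groebner_Basis.algebra
  qed
  have "U - B = P * N * (E ^ 2 * I * B + P * G1)"
    unfolding U c2B by Groebner_Basis.algebra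
  then show "2 ^ (2 * m - 1) dvd int (qiter_psum b i b) - int b"
    unfolding pw by (simp add: U_def B_def)

  have "\<exists>k. X (Suc t) = X t + P * E * c2 (X t) + (P * E) ^ 2 * c3 (X t) + P ^ 2 * N * k" for t
  proof -
    obtain k where "int (qnum b (qiter b i t)) = int (qiter b i t) + int e * c2 (int (qiter b i t))
      + int e ^ 2 * c3 (int (qiter b i t)) + int e ^ 3 * k" by (rule qnum_b_expansion)
    then have "X (Suc t) = X t + P * E * c2 (X t) + (P * E) ^ 2 * c3 (X t) + (P * E) ^ 3 * k"
      by (simp add: X_def qiter_Suc e)
    also have "(P * E) ^ 3 * k = P ^ 2 * N * (2 * E ^ 3 * k)" unfolding P_def by Groebner_Basis.algebra
    finally show ?thesis by blast
  qed
  then obtain k where k: "\<And>t. X (Suc t) = X t + P * E * c2 (X t) + (P * E) ^ 2 * c3 (X t) + P ^ 2 * N * k t"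
    by metis
  define K where "K = (\<Sum>t<b. k t)"
  have "X n = I + P * E * (\<Sum>t<n. c2 (X t)) + (P * E) ^ 2 * (\<Sum>t<n. c3 (X t)) + P ^ 2 * N * (\<Sum>t<n. k t)" for n
    by (induction n) (simp_all add: k distrib_left, simp add: X_def I_def)
  then have Xb: "X b = I + P * E * (\<Sum>t<b. c2 (X t)) + (P * E) ^ 2 * (\<Sum>t<b. c3 (X t)) + P ^ 2 * N * K"
    unfolding K_def .
  have sumh: "P * (\<Sum>t<b. h t) = P * N * E ^ 2 * a + P ^ 2 * G"
  proof -
    have "S b = B * I + P * (\<Sum>t<b. h t)"
      unfolding SX X by (simp add: sum.distrib sum_distrib_left B_def)
    then show ?thesis using SB by simp
  qed
  define H where "H = (\<Sum>t<b. (h t) ^ 2)"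
  define g2 where "g2 = I * E ^ 2 * a + (2 * I - 1) * G + H"
  have "2 * (\<Sum>t<b. c2 (X t)) = (\<Sum>t<b. 2 * c2 (X t))"
    by (simp add: sum_distrib_left)
  also have "\<dots> = (\<Sum>t<b. 2 * a + (2 * I - 1) * (P * h t) + P ^ 2 * (h t) ^ 2)"
    by (rule sum.cong) (simp_all add: two_c2 X a2, Groebner_Basis.algebra)
  also have "\<dots> = B * (2 * a) + (2 * I - 1) * (P * (\<Sum>t<b. h t)) + P ^ 2 * H"
    by (simp add: sum.distrib sum_distrib_left B_def H_def)
  also have "\<dots> = 2 * (B * a - N ^ 2 * E ^ 2 * a + P * N * g2)"
    unfolding sumh g2_def unfolding P_def by Groebner_Basis.algebra
  finally have s2: "(\<Sum>t<b. c2 (X t)) = B * a - N ^ 2 * E ^ 2 * a + P * N * g2" by simp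
  define g3 where "g3 = (\<Sum>t<b. 2 * a * h t + I * (h t * (P * h t - 1)) + c3P (h t))"
  have "(\<Sum>t<b. c3 (X t)) = (\<Sum>t<b. c3 I + N * (2 * a * h t + I * (h t * (P * h t - 1)) + c3P (h t)))"
  proof (rule sum.cong)
    show "c3 (X t) = c3 I + N * (2 * a * h t + I * (h t * (P * h t - 1)) + c3P (h t))" for t
      unfolding X c3_add c2P c3P a_def[symmetric] unfolding P_def by Groebner_Basis.algebra
  qed simp
  also have "\<dots> = B * c3 I + N * g3"
    by (simp only: sum.distrib sum_distrib_left[symmetric] g3_def) (simp add: B_def)
  finally have s3: "(\<Sum>t<b. c3 (X t)) = B * c3 I + N * g3" .

  obtain g where g: "int (qnum b (b * i)) = B * I + P * E * c2 (B * I) + (P * E) ^ 2 * c3 (B * I) + P ^ 2 * N * g"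
  proof -
    obtain k where "int (qnum b (b * i)) = int (b * i) + int e * c2 (int (b * i)) + int e ^ 2 * c3 (int (b * i)) + int e ^ 3 * k"
      by (rule qnum_b_expansion)
    then show thesis by (intro that[of "2 * E ^ 3 * k"]) (simp add: B_def I_def e P_def power_mult_distrib power3_eq_cube power2_eq_square)
  qed
  have BI: "B * I = I + P * (E * I)" unfolding B by Groebner_Basis.algebra
  have e2: "c2 (B * I) = a + I * (P * (E * I)) + N * (E * I * (P * (E * I) - 1))"
    and e3: "c3 (B * I) = c3 I + a * (P * (E * I)) + I * (N * (E * I * (P * (E * I) - 1))) + N * c3P (E * I)"
    unfolding BI c2_add c3_add c2P c3P a_def by simp_all
  define A where "A = int (qnum b (b * i)) - B * X b - (U - B) + N * (B * I - S b)"
  define Y where "Y = g + E ^ 2 * (2 * a * (E * I) + I * (E * I * (P * (E * I) - 1)) + c3P (E * I))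
     - B * E * g2 - B * E ^ 2 * g3 - B * K - G1 - G - E ^ 3 * c3 I * 2 * (2 + P * E)
     + N * E ^ 4 * a + E ^ 3 * I ^ 2 - 2 * E ^ 3 * a - E ^ 3 * I"
  have "A = P ^ 2 * N * Y + P ^ 2 * E ^ 2 * I ^ 2 - P ^ 2 * E ^ 2 * (2 * a) - 2 * (P * N * E ^ 2 * I)
      + P * N ^ 2 * E ^ 2 * a * (E - 1)"
  proof -
    have "A = (B * I + P * E * c2 (B * I) + (P * E) ^ 2 * c3 (B * I) + P ^ 2 * N * g)
      - B * (I + P * E * (B * a - N ^ 2 * E ^ 2 * a + P * N * g2) + (P * E) ^ 2 * (B * c3 I + N * g3) + P ^ 2 * N * K)
      - (P * E * I * (N * E * B) + P ^ 2 * N * G1) - N * (P * N * E ^ 2 * a + P ^ 2 * G)"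
      unfolding A_def g Xb s2 s3 U c2B using SB by (simp add: algebra_simps)
    also have "\<dots> = P ^ 2 * N * Y + P ^ 2 * E ^ 2 * I ^ 2 - P ^ 2 * E ^ 2 * (2 * a) - 2 * (P * N * E ^ 2 * I)
      + P * N ^ 2 * E ^ 2 * a * (E - 1)"
      unfolding e2 e3 unfolding Y_def B unfolding P_def by Groebner_Basis.algebra
    finally show ?thesis .
  qed
  \<comment> \<open>The number u is odd, and the factor 2 gained here turns the leftover P N^2 into
    P^2 N. The other leftover terms cancel by 2 a = I^2 - I and P = 2 N.\<close>
  also have "E - 1 = 2 * f" using f by simp
  also have "P ^ 2 * N * Y + P ^ 2 * E ^ 2 * I ^ 2 - P ^ 2 * E ^ 2 * (2 * a) - 2 * (P * N * E ^ 2 * I)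
      + P * N ^ 2 * E ^ 2 * a * (2 * f) = P ^ 2 * N * (Y + E ^ 2 * a * f)"
    unfolding a2 unfolding P_def by Groebner_Basis.algebra
  finally have "P ^ 2 * N dvd A" by simp
  then show "2 ^ (3 * m - 1) dvd
      int (qnum b (b * i)) - int (b * qiter b i b) - (int (qiter_psum b i b) - int b)
      + 2 ^ (m - 1) * (int (b * i) - int (qiter_sum b i b))"
    unfolding pw by (simp add: A_def X_def U_def B_def I_def S_def)
qed

end

section \<open>The congruences required by the model: p = 3 and m = 1\<close>

context padic_base
begin

lemma dvd_3_of_2: "3 dvd x" if "3 dvd 2 * x" for x :: int using that by presburger

text \<open>The same three conditions for q = 27 and Q = 81, hence with one factor 3 more than
  \<open>model_relation_odd\<close> yields for m = 1. The extra factor comes from u = 1 modulo 3.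
  Expansions run to the coefficient of e^3, as 81 divides e^4.\<close>

lemma model_relation_three:
  assumes three: "p = 3" and m1: "m = 1" and u1: "u mod 3 = 1"
  shows "27 dvd int (qiter_sum b i b) - int (b * i)"
    and "27 dvd int (qiter_psum b i b) - int b"
    and "81 dvd int (qnum b (b * i)) - int (b * qiter b i b) - (int (qiter_psum b i b) - int b)"
proof -
  define E where "E = int u"
  have "int u mod 3 = 1" using u1 by presburger
  then obtain F where F: "E = 3 * F + 1" unfolding E_def by (metis mult_div_mod_eq)
  have e: "int e = 3 * E" unfolding e_def unfolding three m1 by (simp add: E_def)
  define s where "s = 3 * F ^ 2 + 2 * F"
  define z where "z = 3 * F ^ 3 + 3 * F ^ 2 + F"
  have E2: "E ^ 2 = 1 + 3 * s" unfolding F s_def by Groebner_Basis.algebra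
  have E3: "E ^ 3 = 1 + 9 * z" unfolding F z_def by Groebner_Basis.algebra
  define I where "I = int i"
  define a where "a = c2 I"
  define c where "c = c3 I"
  define d where "d = c4 I"
  have a2: "2 * a = I ^ 2 - I" unfolding a_def two_c2 by Groebner_Basis.algebra
  define n where "n = c3 (I + 1)"
  have n: "6 * n = I ^ 3 - I" unfolding n_def six_c3 by Groebner_Basis.algebra
  have an: "a * (I + 1) = 3 * n"
  proof -
    have "2 * (a * (I + 1)) = 2 * (3 * n)" using a2 n by Groebner_Basis.algebra
    then show ?thesis by simp
  qed
  define B where "B = int b"
  have B: "B = 1 + 3 * E" by (simp add: B_def b_def e[symmetric])
  have q: "\<exists>k. int (qnum b x) = int x + 3 * E * c2 (int x) + 9 * E ^ 2 * c3 (int x) + 27 * c4 (int x) + 81 * k" for x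
  proof -
    obtain r where "int (qnum b x) = int x + (3 * E) * c2 (int x) + (3 * E) ^ 2 * c3 (int x) + (3 * E) ^ 3 * c4 (int x) + (3 * E) ^ 4 * r"
      using qnum_expansion4[of e x] unfolding b_def e by blast
    also have "\<dots> = int x + 3 * E * c2 (int x) + 9 * E ^ 2 * c3 (int x) + 27 * c4 (int x) + 81 * (3 * z * c4 (int x) + E ^ 4 * r)"
      using E3 by Groebner_Basis.algebra
    finally show ?thesis by blast
  qed
  have pw: "\<exists>k. int (b ^ x) = 1 + 3 * E * int x + 9 * E ^ 2 * c2 (int x) + 27 * c3 (int x) + 81 * k" for x
  proof -
    obtain r where "int (b ^ x) = 1 + (3 * E) * int x + (3 * E) ^ 2 * c2 (int x) + (3 * E) ^ 3 * c3 (int x) + (3 * E) ^ 4 * r"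
      using power_expansion4[of e x] unfolding b_def e by blast
    also have "\<dots> = 1 + 3 * E * int x + 9 * E ^ 2 * c2 (int x) + 27 * c3 (int x) + 81 * (3 * z * c3 (int x) + E ^ 4 * r)"
      using E3 by Groebner_Basis.algebra
    finally show ?thesis by blast
  qed

  obtain b2 where b2: "c2 B = 3 * b2"
  proof -
    have "2 * c2 B = 3 * (E * (1 + 3 * E))" unfolding two_c2 unfolding B by Groebner_Basis.algebra
    then have "3 dvd 2 * c2 B" by (rule dvdI)
    then show thesis using that dvd_3_of_2 by blast
  qed
  have b2': "2 * b2 = E * (1 + 3 * E)"
  proof -
    have "3 * (2 * b2) = 3 * (E * (1 + 3 * E))" using two_c2[of B] unfolding b2 unfolding B by Groebner_Basis.algebra
    then show ?thesis by simp
  qed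
  define b3 where "b3 = c3 B"
  have b3': "2 * b3 = 9 * E ^ 3 - E"
  proof -
    have "3 * (2 * b3) = 3 * (9 * E ^ 3 - E)" using six_c3[of B] unfolding b3_def unfolding B by Groebner_Basis.algebra
    then show ?thesis by simp
  qed
  define b4 where "b4 = c4 B"
  have b4': "8 * b4 = (9 * E ^ 3 - E) * (3 * E - 2)"
  proof -
    have "3 * (8 * b4) = 3 * ((9 * E ^ 3 - E) * (3 * E - 2))" using c4_eq[of B] unfolding b4_def unfolding B by Groebner_Basis.algebra
    then show ?thesis by simp
  qed
  obtain f2 where f2: "b2 = 2 + 3 * f2"
  proof -
    have "2 * (b2 - 2) = 3 * (F + E ^ 2 - 1)" using b2' F by Groebner_Basis.algebra
    then have "3 dvd 2 * (b2 - 2)" by (rule dvdI)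
    then have "3 dvd b2 - 2" by (rule dvd_3_of_2)
    then show thesis using that by (rule dvd_diffE)
  qed
  obtain f3 where f3: "b3 = 1 + 3 * f3"
  proof -
    have "2 * (b3 - 1) = 3 * (3 * E ^ 3 - F - 1)" using b3' F by Groebner_Basis.algebra
    then have "3 dvd 2 * (b3 - 1)" by (rule dvdI)
    then have "3 dvd b3 - 1" by (rule dvd_3_of_2)
    then show thesis using that by (rule dvd_diffE)
  qed
  obtain f4 where f4: "b4 = 1 + 3 * f4"
  proof -
    have "8 * (b4 - 1) = 3 * (3 * E ^ 3 * (3 * E - 2) - E ^ 2 + 2 * F - 2)" using b4' F by Groebner_Basis.algebra
    then have "3 dvd 8 * (b4 - 1)" by (rule dvdI)
    then have "3 dvd b4 - 1" by presburger
    then show thesis using that by (rule dvd_diffE)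
  qed

  define X where "X t = int (qiter b i t)" for t
  define S where "S t = int (qiter_sum b i t)" for t
  define U where "U = int (qiter_psum b i b)"
  \<comment> \<open>The coefficient of 9 in the t-th iterate of i, with r collecting what is
    divisible by 27.\<close>
  define y0 where "y0 t r = c2 (int t) * a * (I + 2) + int t * c + 3 * r" for t :: nat and r
  have "\<exists>r. X t = I + 3 * (E * int t * a + 3 * y0 t r)" for t
  proof (induction t)
    case 0
    show ?case by (auto simp: X_def I_def y0_def intro: exI[of _ 0])
  next
    case (Suc t)
    then obtain r where r: "X t = I + 3 * (E * int t * a + 3 * y0 t r)" by blast
    define y where "y = y0 t r"
    define H where "H = E * int t * a + 3 * y"
    have X: "X t = I + 3 * H" unfolding r H_def y_def ..
    obtain k where k: "X (Suc t) = X t + 3 * E * c2 (X t) + 9 * E ^ 2 * c3 (X t) + 27 * c4 (X t) + 81 * k"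
      using q[of "qiter b i t"] unfolding X_def qiter_Suc by blast
    define h where "h = c2 H"
    have x2: "c2 (X t) = a + 3 * I * H + 3 * H + 9 * h"
      unfolding X c2_add c2_triple a_def h_def by Groebner_Basis.algebra
    have x3: "c3 (X t) = c + 3 * a * H + I * (3 * H + 9 * h) + H + 9 * H * h"
      unfolding X c3_add c2_triple c3_triple a_def c_def h_def by Groebner_Basis.algebra
    define r' where "r' = r + (I + 1) * (s * int t * a + E * y) + s * (c + H) + F * int t * a + y
      + E * h + E ^ 2 * (a * H + I * (H + 3 * h) + 3 * H * h) + c4 (X t) + 3 * k"
    have T: "c2 (int (Suc t)) = c2 (int t) + int t"
      using c2_add[of "int t" 1] by (simp add: add.commute)
    have "X (Suc t) = I + 3 * (E * int (Suc t) * a + 3 * y0 (Suc t) r')"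
    proof -
      have "X (Suc t) = I + 3 * H + 3 * E * a + 9 * (I + 1) * (E * H) + 9 * (E ^ 2 * (c + H))
        + 27 * (E * h + E ^ 2 * (a * H + I * (H + 3 * h) + 3 * H * h) + c4 (X t) + 3 * k)"
        unfolding k x2 x3 unfolding X by Groebner_Basis.algebra
      also have "E * H = int t * a + 3 * (s * int t * a + E * y)" unfolding H_def using E2 by Groebner_Basis.algebra
      also have "E ^ 2 * (c + H) = c + int t * a + 3 * (s * (c + H) + F * int t * a + y)"
        unfolding E2 unfolding H_def F by Groebner_Basis.algebra
      finally show ?thesis unfolding y0_def T r'_def H_def y_def unfolding of_nat_Suc by Groebner_Basis.algebra
    qed
    then show ?case by blast
  qed
  then obtain r where r: "\<And>t. X t = I + 3 * (E * int t * a + 3 * y0 t (r t))" by metis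
  define y where "y t = y0 t (r t)" for t
  define H where "H t = E * int t * a + 3 * y t" for t
  have X: "X t = I + 3 * H t" for t unfolding r H_def y_def ..
  define R where "R t = (\<Sum>s<t. r s)" for t
  define v where "v t = c3 (int t) * a * (I + 2) + c2 (int t) * c + 3 * R t" for t
  define V where "V t = E * a * c2 (int t) + 3 * v t" for t
  have SX: "S t = (\<Sum>s<t. X s)" for t by (simp add: S_def qiter_sum_def X_def)
  have sumH: "(\<Sum>s<t. H s) = V t" for t
  proof -
    have "(\<Sum>s<t. H s) = (\<Sum>s<t. E * a * int s + 3 * (a * (I + 2) * c2 (int s) + c * int s + 3 * r s))"
      unfolding H_def y_def y0_def by (rule sum.cong[OF HOL.refl]) Groebner_Basis.algebra
    also have "\<dots> = E * a * (\<Sum>s<t. int s) + 3 * (a * (I + 2) * (\<Sum>s<t. c2 (int s)) + c * (\<Sum>s<t. int s) + 3 * (\<Sum>s<t. r s))"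
      by (simp only: sum.distrib sum_distrib_left[symmetric])
    finally show ?thesis unfolding sum_c2 sum_c3 V_def v_def R_def by Groebner_Basis.algebra
  qed
  have S: "S t = int t * I + 3 * V t" for t
    unfolding SX X sumH[symmetric] by (simp add: sum.distrib sum_distrib_left)
  define g1 where "g1 = s + E ^ 3 + (3 * E ^ 3 - F) * (I + 2)"
  \<comment> \<open>Modulo 3 the two binomial coefficients of b combine to E^2 - E (I + 2), which is
    -(I + 1) because E = 1 modulo 3; and a (I + 1) = 3 n. So u = 1 modulo 3 gains a factor 3
    here.\<close>
  have "2 * V b = 9 * (- n + a * g1 + 2 * (b2 * c + R b))"
  proof -
    have "2 * V b = 3 * a * (E * (2 * b2) + 2 * b3 * (I + 2)) + 18 * (b2 * c + R b)"
      unfolding V_def v_def B_def[symmetric] b2 b3_def by Groebner_Basis.algebra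
    also have "E * (2 * b2) + 2 * b3 * (I + 2) = - (I + 1) + 3 * g1"
      unfolding b2' b3' g1_def using E2 F by Groebner_Basis.algebra
    also have "3 * a * (- (I + 1) + 3 * g1) = 9 * (- n + a * g1)" using an by Groebner_Basis.algebra
    finally show ?thesis by Groebner_Basis.algebra
  qed
  then have "9 dvd 2 * V b" by (rule dvdI)
  then have "9 dvd V b" by presburger
  then obtain G where G: "V b = 9 * G" by blast
  have "S b - B * I = 27 * G" unfolding S G B_def by simp
  then show "27 dvd int (qiter_sum b i b) - int (b * i)"
    by (simp add: S_def B_def I_def)

  have sumV: "\<exists>R'. (\<Sum>t<b. V t) = E * a * b3 + 3 * (b4 * a * (I + 2) + b3 * c) + 9 * R'"
  proof -
    have "(\<Sum>t<b. V t) = (\<Sum>t<b. E * a * c2 (int t) + 3 * (a * (I + 2) * c3 (int t) + c * c2 (int t)) + 9 * R t)"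
      unfolding V_def v_def by (rule sum.cong[OF HOL.refl]) Groebner_Basis.algebra
    also have "\<dots> = E * a * (\<Sum>t<b. c2 (int t)) + 3 * (a * (I + 2) * (\<Sum>t<b. c3 (int t)) + c * (\<Sum>t<b. c2 (int t))) + 9 * (\<Sum>t<b. R t)"
      by (simp only: sum.distrib sum_distrib_left[symmetric])
    also have "\<dots> = E * a * b3 + 3 * (b4 * a * (I + 2) + b3 * c) + 9 * (\<Sum>t<b. R t)"
      unfolding sum_c3 sum_c4 b3_def b4_def B_def by Groebner_Basis.algebra
    finally show ?thesis by blast
  qed
  then obtain R' where R': "(\<Sum>t<b. V t) = E * a * b3 + 3 * (b4 * a * (I + 2) + b3 * c) + 9 * R'" by blast
  have sumS: "(\<Sum>t<b. S t) = 3 * b2 * I + 3 * (\<Sum>t<b. V t)"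
    unfolding S by (simp add: sum.distrib sum_distrib_left[symmetric] sum_distrib_right[symmetric]
      sum_c2 b2 flip: B_def)
  have "\<exists>w. int (b ^ qiter_sum b i t) = 1 + 3 * E * S t + 9 * E ^ 2 * c2 (int t * I)
     + 27 * ((a * I + 2 * a) * c2 (int t) + int t * c + I ^ 3 * c3 (int t)) + 81 * w" for t
  proof -
    obtain k where k: "int (b ^ qiter_sum b i t) = 1 + 3 * E * S t + 9 * E ^ 2 * c2 (S t) + 27 * c3 (S t) + 81 * k"
      using pw unfolding S_def by blast
    define x where "x = c2 (V t)"
    have s2: "c2 (S t) = c2 (int t * I) + 3 * (int t * I + 1) * V t + 9 * x"
      unfolding S c2_add c2_triple x_def by Groebner_Basis.algebra
    have s3: "c3 (S t) = c3 (int t * I) + V t + 3 * (V t * c2 (int t * I) + int t * I * (V t + 3 * x) + 3 * V t * x)"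
      unfolding S c3_add c2_triple c3_triple x_def by Groebner_Basis.algebra
    define Y where "Y = F * a * c2 (int t) + v t"
    have V: "V t = a * c2 (int t) + 3 * Y" unfolding V_def Y_def F by Groebner_Basis.algebra
    have tt: "int t * c2 (int t) = 3 * c3 (int t) + 2 * c2 (int t)" by (rule times_c2)
    have "int (b ^ qiter_sum b i t) = 1 + 3 * E * S t + 9 * E ^ 2 * c2 (int t * I)
       + 27 * ((int t * I + 1) * (a * c2 (int t)) + c3 (int t * I) + a * c2 (int t))
       + 81 * (E ^ 2 * x + V t * c2 (int t * I) + int t * I * (V t + 3 * x) + 3 * V t * x + k + Y
           + (int t * I + 1) * (Y + s * V t))"
      unfolding k s2 s3 using E2 V by Groebner_Basis.algebra
    also have "(int t * I + 1) * (a * c2 (int t)) + c3 (int t * I) + a * c2 (int t)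
       = (a * I + 2 * a) * c2 (int t) + int t * c + I ^ 3 * c3 (int t) + 3 * (a * I * c2 (int t) + a * I * c3 (int t))"
      unfolding c3_mult c_def[symmetric] a_def[symmetric] using tt by Groebner_Basis.algebra
    finally have "int (b ^ qiter_sum b i t) = 1 + 3 * E * S t + 9 * E ^ 2 * c2 (int t * I)
       + 27 * ((a * I + 2 * a) * c2 (int t) + int t * c + I ^ 3 * c3 (int t))
       + 81 * (a * I * c2 (int t) + a * I * c3 (int t) + (E ^ 2 * x + V t * c2 (int t * I)
         + int t * I * (V t + 3 * x) + 3 * V t * x + k + Y + (int t * I + 1) * (Y + s * V t)))"
      by Groebner_Basis.algebra
    then show ?thesis by blast
  qed
  then obtain w where w: "\<And>t. int (b ^ qiter_sum b i t) = 1 + 3 * E * S t + 9 * E ^ 2 * c2 (int t * I)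
     + 27 * ((a * I + 2 * a) * c2 (int t) + int t * c + I ^ 3 * c3 (int t)) + 81 * w t" by metis
  define W where "W = (\<Sum>t<b. w t)"
  define kap where "kap = E * b2 + E ^ 2 * b3"
  have U: "\<exists>W. U - B = 9 * I * kap + 27 * (a * (2 * I + 1) + c + I ^ 3) + 81 * W"
  proof -
    have "U = (\<Sum>t<b. int (b ^ qiter_sum b i t))"
      by (simp add: U_def qiter_psum_def)
    also have "\<dots> = B + 3 * E * (\<Sum>t<b. S t) + 9 * E ^ 2 * (\<Sum>t<b. c2 (int t * I))
      + 27 * ((a * I + 2 * a) * b3 + 3 * b2 * c + I ^ 3 * b4) + 81 * W"
    proof -
      have "(\<Sum>t<b. int (b ^ qiter_sum b i t)) = (\<Sum>t<b. 1 + 3 * E * S t + 9 * E ^ 2 * c2 (int t * I)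
         + 27 * ((a * I + 2 * a) * c2 (int t) + c * int t + I ^ 3 * c3 (int t)) + 81 * w t)"
        unfolding w by (simp only: mult.commute[of c])
      also have "\<dots> = (\<Sum>t<b. 1) + 3 * E * (\<Sum>t<b. S t) + 9 * E ^ 2 * (\<Sum>t<b. c2 (int t * I))
         + 27 * ((a * I + 2 * a) * (\<Sum>t<b. c2 (int t)) + c * (\<Sum>t<b. int t) + I ^ 3 * (\<Sum>t<b. c3 (int t))) + 81 * W"
        by (simp only: sum.distrib sum_distrib_left[symmetric] W_def)
      also have "(\<Sum>t<b. (1::int)) = B" by (simp add: B_def)
      finally show ?thesis unfolding sum_c2 sum_c3 sum_c4 B_def[symmetric] b3_def b4_def b2 by Groebner_Basis.algebra
    qed
    also have "\<dots> = B + 9 * I * kap + 27 * (E ^ 2 * a * b3 + E * (b4 * a * (I + 2) + b3 * c) + E ^ 2 * b2 * a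
        + (a * I + 2 * a) * b3 + I ^ 3 * b4)
        + 81 * (E * R' + b2 * c + W)"
      unfolding sumS R' sum_c2_mult B_def[symmetric] b2 b3_def[symmetric] a_def[symmetric] kap_def by Groebner_Basis.algebra
    finally have U: "U - B = 9 * I * kap + 27 * (E ^ 2 * a * b3 + E * (b4 * a * (I + 2) + b3 * c) + E ^ 2 * b2 * a
        + (a * I + 2 * a) * b3 + I ^ 3 * b4) + 81 * (E * R' + b2 * c + W)" by Groebner_Basis.algebra
    have "E ^ 2 * a * b3 + E * (b4 * a * (I + 2) + b3 * c) + E ^ 2 * b2 * a + (a * I + 2 * a) * b3 + I ^ 3 * b4
      = a * (2 * I + 1) + c + I ^ 3 + 3 * (a * s * b3 + a * f3
        + F * (b4 * a * (I + 2) + b3 * c) + f4 * a * (I + 2) + f3 * c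
        + s * b2 * a + f2 * a + (a * I + 2 * a) * f3 + I ^ 3 * f4 + 2 * a)"
      unfolding E2 unfolding F using f2 f3 f4 by Groebner_Basis.algebra
    then have "U - B = 9 * I * kap + 27 * (a * (2 * I + 1) + c + I ^ 3) + 81 * (a * s * b3 + a * f3
        + F * (b4 * a * (I + 2) + b3 * c) + f4 * a * (I + 2) + f3 * c
        + s * b2 * a + f2 * a + (a * I + 2 * a) * f3 + I ^ 3 * f4 + 2 * a + (E * R' + b2 * c + W))"
      unfolding U by Groebner_Basis.algebra
    then show ?thesis by blast
  qed
  then obtain W where U: "U - B = 9 * I * kap + 27 * (a * (2 * I + 1) + c + I ^ 3) + 81 * W" by blast
  \<comment> \<open>Again E = 1 modulo 3 decides: it makes E^2 + 2 E^3 divisible by 3.\<close>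
  have kap2: "2 * kap = 3 * (s + 1) + 9 * (2 * z + E ^ 5)"
  proof -
    have "2 * kap = E * (2 * b2) + E ^ 2 * (2 * b3)" unfolding kap_def by Groebner_Basis.algebra
    also have "\<dots> = E ^ 2 + 2 * E ^ 3 + 9 * E ^ 5" unfolding b2' b3' by Groebner_Basis.algebra
    also have "\<dots> = 3 * (s + 1) + 9 * (2 * z + E ^ 5)" unfolding E2 E3 by Groebner_Basis.algebra
    finally show ?thesis .
  qed
  then have "3 dvd 2 * kap" by presburger
  then have "3 dvd kap" by (rule dvd_3_of_2)
  then obtain kk where kk: "kap = 3 * kk" by blast
  have "U - B = 27 * (I * kk + a * (2 * I + 1) + c + I ^ 3 + 3 * W)" unfolding U kk by Groebner_Basis.algebra
  then show "27 dvd int (qiter_psum b i b) - int b"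
    by (simp add: U_def B_def)

  have "\<exists>k. X (Suc t) = X t + 3 * E * c2 (X t) + 9 * E ^ 2 * c3 (X t) + 27 * c4 (X t) + 81 * k" for t
    using q[of "qiter b i t"] unfolding X_def qiter_Suc by blast
  then obtain k where k: "\<And>t. X (Suc t) = X t + 3 * E * c2 (X t) + 9 * E ^ 2 * c3 (X t) + 27 * c4 (X t) + 81 * k t"
    by metis
  have "X n = I + 3 * E * (\<Sum>t<n. c2 (X t)) + 9 * E ^ 2 * (\<Sum>t<n. c3 (X t)) + 27 * (\<Sum>t<n. c4 (X t)) + 81 * (\<Sum>t<n. k t)" for n
    by (induction n) (simp_all add: k distrib_left, simp add: X_def I_def)
  then have Xb: "X b = I + 3 * E * (\<Sum>t<b. c2 (X t)) + 9 * E ^ 2 * (\<Sum>t<b. c3 (X t)) + 27 * (\<Sum>t<b. c4 (X t)) + 81 * (\<Sum>t<b. k t)"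
    .
  have x2: "c2 (X t) = a + 3 * (I + 1) * H t + 9 * c2 (H t)" for t
    unfolding X c2_add c2_triple a_def by Groebner_Basis.algebra
  have x3: "c3 (X t) = c + (3 * a + 3 * I + 1) * H t + 9 * (I * c2 (H t) + H t * c2 (H t))" for t
    unfolding X c3_add c2_triple c3_triple a_def c_def by Groebner_Basis.algebra
  have "\<exists>l. c4 (X t) = d + I * H t + 3 * l" for t
  proof -
    obtain l where l: "c4 (3 * H t) = 3 * l" using c4_triple by blast
    have "c4 (X t) = d + I * H t + 3 * (c * H t + a * (H t + 3 * c2 (H t)) + I * (3 * H t * c2 (H t)) + l)"
      unfolding X c4_add c2_triple c3_triple a_def c_def d_def l by Groebner_Basis.algebra
    then show ?thesis by blast
  qed
  then obtain l where x4: "\<And>t. c4 (X t) = d + I * H t + 3 * l t" by metis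
  have Hb: "(\<Sum>t<b. H t) = 9 * G" unfolding sumH G ..
  have "\<exists>g. (\<Sum>t<b. c2 (H t)) = a ^ 2 + 3 * g"
  proof -
    have "2 * (\<Sum>t<b. c2 (H t)) = (\<Sum>t<b. 2 * c2 (H t))" by (simp add: sum_distrib_left)
    also have "\<dots> = (\<Sum>t<b. E ^ 2 * a ^ 2 * (int t * int t) + 3 * (2 * E * a * int t * y t + 3 * y t ^ 2) - H t)"
      unfolding two_c2 by (rule sum.cong[OF HOL.refl], unfold H_def, Groebner_Basis.algebra)
    also have "\<dots> = E ^ 2 * a ^ 2 * (\<Sum>t<b. int t * int t) + 3 * (\<Sum>t<b. 2 * E * a * int t * y t + 3 * y t ^ 2) - (\<Sum>t<b. H t)"
      by (simp only: sum.distrib sum_subtractf sum_distrib_left[symmetric])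
    also have "\<dots> = 2 * a ^ 2 + 3 * ((1 + 3 * s) * a ^ 2 * (2 * f3 + b2) + 2 * s * a ^ 2 + (\<Sum>t<b. 2 * E * a * int t * y t + 3 * y t ^ 2) - 3 * G)"
      unfolding Hb sum_squares_c B_def[symmetric] b2 b3_def[symmetric] f3 E2 by Groebner_Basis.algebra
    finally have "2 * ((\<Sum>t<b. c2 (H t)) - a ^ 2) = 3 * ((1 + 3 * s) * a ^ 2 * (2 * f3 + b2) + 2 * s * a ^ 2 + (\<Sum>t<b. 2 * E * a * int t * y t + 3 * y t ^ 2) - 3 * G)"
      by Groebner_Basis.algebra
    then have "3 dvd 2 * ((\<Sum>t<b. c2 (H t)) - a ^ 2)" by (rule dvdI)
    then have "3 dvd (\<Sum>t<b. c2 (H t)) - a ^ 2" by (rule dvd_3_of_2)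
    then show ?thesis by (rule dvd_diffE) blast
  qed
  then obtain g4 where g4: "(\<Sum>t<b. c2 (H t)) = a ^ 2 + 3 * g4" by blast
  have s2: "(\<Sum>t<b. c2 (X t)) = B * a + 9 * a ^ 2 + 27 * ((I + 1) * G + g4)"
  proof -
    have "(\<Sum>t<b. c2 (X t)) = (\<Sum>t<b. a) + 3 * (I + 1) * (\<Sum>t<b. H t) + 9 * (\<Sum>t<b. c2 (H t))"
      unfolding x2 by (simp only: sum.distrib sum_distrib_left[symmetric])
    also have "(\<Sum>t<b. a) = B * a" by (simp add: B_def)
    finally show ?thesis unfolding Hb g4 by Groebner_Basis.algebra
  qed
  obtain g6 where s3: "(\<Sum>t<b. c3 (X t)) = B * c + 9 * g6"
  proof -
    have "(\<Sum>t<b. c3 (X t)) = (\<Sum>t<b. c) + (3 * a + 3 * I + 1) * (\<Sum>t<b. H t) + 9 * (\<Sum>t<b. I * c2 (H t) + H t * c2 (H t))"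
      unfolding x3 by (simp only: sum.distrib sum_distrib_left[symmetric])
    also have "(\<Sum>t<b. c) = B * c" by (simp add: B_def)
    finally have "(\<Sum>t<b. c3 (X t)) = B * c + 9 * ((3 * a + 3 * I + 1) * G + (\<Sum>t<b. I * c2 (H t) + H t * c2 (H t)))"
      unfolding Hb by Groebner_Basis.algebra
    then show thesis by (rule that)
  qed
  obtain g7 where s4: "(\<Sum>t<b. c4 (X t)) = d + 3 * g7"
  proof -
    have "(\<Sum>t<b. c4 (X t)) = (\<Sum>t<b. d) + I * (\<Sum>t<b. H t) + 3 * (\<Sum>t<b. l t)"
      unfolding x4 by (simp only: sum.distrib sum_distrib_left[symmetric])
    also have "(\<Sum>t<b. d) = B * d" by (simp add: B_def)
    finally have "(\<Sum>t<b. c4 (X t)) = d + 3 * (E * d + 3 * I * G + (\<Sum>t<b. l t))"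
      unfolding Hb B by Groebner_Basis.algebra
    then show thesis by (rule that)
  qed
  have xb: "\<exists>K. B * X b = B * I + 3 * E * a + 18 * E ^ 2 * a + 27 * a + 27 * a ^ 2 + 9 * E ^ 2 * c + 54 * c + 27 * d + 81 * K"
  proof -
    have "B * X b = B * I + 3 * E * (1 + 6 * E + 9 * E ^ 2) * a + 27 * E * B * a ^ 2
       + 9 * E ^ 2 * (1 + 6 * E + 9 * E ^ 2) * c + 27 * B * d
       + 81 * B * (E * ((I + 1) * G + g4) + E ^ 2 * g6 + g7 + (\<Sum>t<b. k t))"
      unfolding Xb s2 s3 s4 unfolding B by Groebner_Basis.algebra
    also have "3 * E * (1 + 6 * E + 9 * E ^ 2) * a = 3 * E * a + 18 * E ^ 2 * a + 27 * a + 81 * (3 * z * a)"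
      using E3 by Groebner_Basis.algebra
    also have "9 * E ^ 2 * (1 + 6 * E + 9 * E ^ 2) * c = 9 * E ^ 2 * c + 54 * c + 81 * (6 * z * c + E ^ 4 * c)"
      using E3 by Groebner_Basis.algebra
    also have "27 * E * B * a ^ 2 = 27 * a ^ 2 + 81 * (F * a ^ 2 + E ^ 2 * a ^ 2)"
      unfolding B F by Groebner_Basis.algebra
    also have "27 * B * d = 27 * d + 81 * (E * d)" unfolding B by Groebner_Basis.algebra
    finally have "B * X b = B * I + 3 * E * a + 18 * E ^ 2 * a + 27 * a + 27 * a ^ 2 + 9 * E ^ 2 * c + 54 * c + 27 * d
      + 81 * (3 * z * a + (F * a ^ 2 + E ^ 2 * a ^ 2) + (6 * z * c + E ^ 4 * c) + E * d
        + B * (E * ((I + 1) * G + g4) + E ^ 2 * g6 + g7 + (\<Sum>t<b. k t)))"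
      by Groebner_Basis.algebra
    then show ?thesis by blast
  qed
  then obtain K where K: "B * X b = B * I + 3 * E * a + 18 * E ^ 2 * a + 27 * a + 27 * a ^ 2 + 9 * E ^ 2 * c + 54 * c + 27 * d + 81 * K"
    by blast
  obtain k' where k': "int (qnum b (b * i)) = B * I + 3 * E * c2 (B * I) + 9 * E ^ 2 * c3 (B * I) + 27 * c4 (B * I) + 81 * k'"
    using q[of "b * i"] by (auto simp: B_def I_def)
  define x where "x = E * I"
  have BI: "B * I = I + 3 * x" unfolding B x_def by Groebner_Basis.algebra
  define h where "h = c2 x"
  obtain g8 where h: "h = a + 3 * g8"
  proof -
    have "2 * (h - a) = 3 * (s * I ^ 2 - F * I)"
      unfolding right_diff_distrib a2 h_def two_c2 unfolding x_def using E2 F by Groebner_Basis.algebra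
    then have "3 dvd 2 * (h - a)" by (rule dvdI)
    then have "3 dvd h - a" by (rule dvd_3_of_2)
    then show thesis using that by (rule dvd_diffE)
  qed
  have e2: "c2 (B * I) = a + 3 * I * x + 3 * x + 9 * h"
    unfolding BI c2_add c2_triple a_def h_def by Groebner_Basis.algebra
  have e3: "c3 (B * I) = c + 3 * a * x + 3 * I * x + x + 9 * (I * h + x * h)"
    unfolding BI c3_add c2_triple c3_triple a_def c_def h_def by Groebner_Basis.algebra
  obtain l' where l': "c4 (3 * x) = 3 * l'" using c4_triple by blast
  have e4: "c4 (B * I) = d + I * x + 3 * (c * x + a * (x + 3 * h) + I * (3 * x * h) + l')"
    unfolding BI c4_add c2_triple c3_triple a_def c_def d_def h_def l' by Groebner_Basis.algebra
  have "\<exists>K. int (qnum b (b * i)) = B * I + 3 * E * a + 9 * E ^ 2 * I ^ 2 + 9 * E ^ 2 * I + 27 * a + 9 * E ^ 2 * c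
      + 27 * a * I + 54 * I ^ 2 + 9 * I + 27 * d + 81 * K"
  proof -
    have "int (qnum b (b * i)) = B * I + 3 * E * a + 9 * E ^ 2 * I ^ 2 + 9 * E ^ 2 * I + 27 * (E * a) + 9 * E ^ 2 * c
      + 27 * (E ^ 3 * a * I) + 27 * (E ^ 3 * I ^ 2) + 9 * (E ^ 3 * I) + 27 * d + 27 * (E * I ^ 2)
      + 81 * (E * g8 + E ^ 2 * (I * h + x * h) + c * x + a * (x + 3 * h) + I * (3 * x * h) + l' + k')"
      unfolding k' e2 e3 e4 unfolding h unfolding x_def by Groebner_Basis.algebra
    also have "E * a = a + 3 * (F * a)" unfolding F by Groebner_Basis.algebra
    also have "E * I ^ 2 = I ^ 2 + 3 * (F * I ^ 2)" unfolding F by Groebner_Basis.algebra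
    also have "E ^ 3 * a * I = a * I + 3 * (3 * z * a * I)" unfolding E3 by Groebner_Basis.algebra
    also have "E ^ 3 * I ^ 2 = I ^ 2 + 3 * (3 * z * I ^ 2)" unfolding E3 by Groebner_Basis.algebra
    also have "E ^ 3 * I = I + 9 * (z * I)" unfolding E3 by Groebner_Basis.algebra
    finally have "int (qnum b (b * i)) = B * I + 3 * E * a + 9 * E ^ 2 * I ^ 2 + 9 * E ^ 2 * I + 27 * a + 9 * E ^ 2 * c
      + 27 * a * I + 54 * I ^ 2 + 9 * I + 27 * d + 81 * (F * a + F * I ^ 2 + 3 * z * a * I + 3 * z * I ^ 2 + z * I
      + (E * g8 + E ^ 2 * (I * h + x * h) + c * x + a * (x + 3 * h) + I * (3 * x * h) + l' + k'))"
      by Groebner_Basis.algebra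
    then show ?thesis by blast
  qed
  then obtain K' where K': "int (qnum b (b * i)) = B * I + 3 * E * a + 9 * E ^ 2 * I ^ 2 + 9 * E ^ 2 * I + 27 * a + 9 * E ^ 2 * c
      + 27 * a * I + 54 * I ^ 2 + 9 * I + 27 * d + 81 * K'" by blast
  define A where "A = int (qnum b (b * i)) - B * X b - (U - B)"
  have A: "A = 9 * E ^ 2 * (I ^ 2 + I - 2 * a) - 27 * a * I + 54 * I ^ 2 + 9 * I - 27 * a - 27 * a ^ 2
     - 9 * I * kap - 27 * I ^ 3 + 81 * (K' - K - W - c)"
    unfolding A_def K' K U by Groebner_Basis.algebra
  have "2 * A = 36 * E ^ 2 * I - 54 * a * I + 108 * I ^ 2 + 18 * I - 54 * a - 54 * a ^ 2
     - 9 * I * (2 * kap) - 54 * I ^ 3 + 162 * (K' - K - W - c)"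
    unfolding A a2 by Groebner_Basis.algebra
  also have "\<dots> = 27 * (I - 2 * a * I + 4 * I ^ 2 - 2 * a - 2 * a ^ 2 - 2 * I ^ 3)
     + 81 * (I * s - I * (2 * z + E ^ 5) + 2 * (K' - K - W - c))"
    unfolding kap2 E2 by Groebner_Basis.algebra
  finally have "2 * (2 * A) = 27 * (2 * I - 2 * (2 * a) * I + 8 * I ^ 2 - 2 * (2 * a) - (2 * a) ^ 2 - 4 * I ^ 3)
     + 81 * (2 * (I * s - I * (2 * z + E ^ 5) + 2 * (K' - K - W - c)))"
    by Groebner_Basis.algebra
  \<comment> \<open>A was multiplied by 4, a unit modulo 81, to replace a by (I^2 - I) / 2
    throughout. The resulting polynomial is a multiple of 3 by I^3 - I = 6 n.\<close>
  also have "2 * I - 2 * (2 * a) * I + 8 * I ^ 2 - 2 * (2 * a) - (2 * a) ^ 2 - 4 * I ^ 3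
     = 3 * (2 * I ^ 2 + I - I ^ 3 - 2 * (I + 1) * n)"
    unfolding a2 using n by Groebner_Basis.algebra
  finally have "2 * (2 * A) = 81 * (2 * I ^ 2 + I - I ^ 3 - 2 * (I + 1) * n
     + 2 * (I * s - I * (2 * z + E ^ 5) + 2 * (K' - K - W - c)))"
    by Groebner_Basis.algebra
  then have "81 dvd 4 * A" by simp
  then have "81 dvd A" by presburger
  then show "81 dvd int (qnum b (b * i)) - int (b * qiter b i b) - (int (qiter_psum b i b) - int b)"
    by (simp add: A_def X_def U_def B_def)
qed

end

section \<open>Relations in the Macdonald group\<close>

context group
begin

lemma pow_eq_of_cong:
  assumes "x \<in> carrier G" "x [^] (n::nat) = \<one>" "[i = j] (mod n)"
  shows "x [^] i = x [^] (j::nat)"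
proof -
  have aux: "x [^] (i mod n) = x [^] i" for i
  proof -
    have "x [^] i = x [^] (n * (i div n) + i mod n)" by simp
    also have "\<dots> = x [^] (n * (i div n)) \<otimes> x [^] (i mod n)" using assms(1) by (simp add: nat_pow_mult)
    also have "x [^] (n * (i div n)) = \<one>" using assms by (simp flip: nat_pow_pow)
    finally show ?thesis using assms(1) by simp
  qed
  show ?thesis using assms(3) aux[of i] aux[of j] by (simp add: cong_def)
qed

lemma pow_mult_one: "x \<in> carrier G \<Longrightarrow> x [^] (n::nat) = \<one> \<Longrightarrow> x [^] (n * k) = \<one>"
  by (metis nat_pow_one nat_pow_pow)

lemma pow_complement:
  assumes "x \<in> carrier G" "x [^] (n::nat) = \<one>" "n > 0"
  shows "x [^] ((n - 1) * k) \<otimes> x [^] k = \<one>" "x [^] k \<otimes> x [^] ((n - 1) * k) = \<one>"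
proof -
  have "(n - 1) * k + k = n * k" using assms(3) by (cases n) auto
  then show "x [^] ((n - 1) * k) \<otimes> x [^] k = \<one>" "x [^] k \<otimes> x [^] ((n - 1) * k) = \<one>"
    using assms by (simp_all add: nat_pow_mult pow_mult_one add.commute)
qed

lemma commutes_pow:
  assumes "x \<in> carrier G" "y \<in> carrier G" "x \<otimes> y = y \<otimes> x"
  shows "x [^] (i::nat) \<otimes> y [^] (j::nat) = y [^] j \<otimes> x [^] i"
proof -
  have 1: "x \<otimes> y [^] j = y [^] j \<otimes> x" if "x \<in> carrier G" "x \<otimes> y = y \<otimes> x" for x
  proof (induction j)
    case (Suc j)
    have "x \<otimes> y [^] Suc j = (x \<otimes> y [^] j) \<otimes> y" using that assms by (simp add: m_assoc)
    also have "\<dots> = y [^] j \<otimes> (x \<otimes> y)" using that assms Suc by (simp add: m_assoc)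
    also have "\<dots> = y [^] Suc j \<otimes> x" using that assms by (simp add: m_assoc)
    finally show ?case .
  qed (use that in simp)
  show ?thesis
  proof (induction i)
    case (Suc i)
    have "x [^] Suc i \<otimes> y [^] j = x [^] i \<otimes> (x \<otimes> y [^] j)" using assms by (simp add: m_assoc)
    also have "\<dots> = (x [^] i \<otimes> y [^] j) \<otimes> x" using 1[of x] assms by (simp add: m_assoc)
    also have "\<dots> = y [^] j \<otimes> x [^] Suc i" using Suc assms by (simp add: m_assoc)
    finally show ?case .
  qed (use assms in simp)
qed

text \<open>Meant for a set N of normal forms, which is visibly stable under left multiplication by
  generators and their inverses but not visibly closed under products.\<close>

lemma generate_induct_left:
  assumes "H \<subseteq> carrier G" "g \<in> generate G H" "x \<in> N" "N \<subseteq> carrier G"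
    and "\<And>h x. h \<in> H \<Longrightarrow> x \<in> N \<Longrightarrow> h \<otimes> x \<in> N"
    and "\<And>h x. h \<in> H \<Longrightarrow> x \<in> N \<Longrightarrow> inv h \<otimes> x \<in> N"
  shows "g \<otimes> x \<in> N"
  using assms(2,3)
proof (induction arbitrary: x rule: generate.induct)
  case (eng h1 h2)
  then have "h1 \<in> carrier G" "h2 \<in> carrier G"
    using generate_in_carrier[OF assms(1)] by auto
  moreover have "x \<in> carrier G" using eng.prems assms(4) by auto
  ultimately have "h1 \<otimes> h2 \<otimes> x = h1 \<otimes> (h2 \<otimes> x)" by (simp add: m_assoc)
  then show ?case using eng by simp
qed (use assms in auto)

end

text \<open>C is a parameter tied to A and B only by \<open>AB\<close>, so that the locale also fits
  the permutation model, where C comes with a formula of its own.\<close>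

locale macdonald = group G for G (structure) +
  fixes A B C :: 'a and b :: nat
  assumes A: "A \<in> carrier G" and B: "B \<in> carrier G" and C: "C \<in> carrier G"
    and CA: "C \<otimes> A = A [^] b \<otimes> C"
    and BC: "B \<otimes> C = C \<otimes> B [^] b"
    and AB: "A \<otimes> B = B \<otimes> A \<otimes> C"
begin

lemma closed [simp]: "A \<in> carrier G" "B \<in> carrier G" "C \<in> carrier G"
  by (rule A B C)+

lemma C_A_pow: "C \<otimes> A [^] i = A [^] (b * i) \<otimes> C"
proof (induction i)
  case (Suc i)
  have "C \<otimes> A [^] Suc i = (C \<otimes> A [^] i) \<otimes> A" by (simp add: m_assoc)
  also have "\<dots> = A [^] (b * i) \<otimes> (C \<otimes> A)" by (simp add: Suc m_assoc)
  also have "\<dots> = A [^] (b * i) \<otimes> A [^] b \<otimes> C" by (simp add: CA m_assoc)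
  also have "\<dots> = A [^] (b * Suc i) \<otimes> C" by (simp add: nat_pow_mult add.commute)
  finally show ?case .
qed simp

lemma C_pow_A_pow: "C [^] k \<otimes> A [^] i = A [^] (b ^ k * i) \<otimes> C [^] k"
proof (induction k arbitrary: i)
  case (Suc k)
  have "C [^] Suc k \<otimes> A [^] i = C [^] k \<otimes> (C \<otimes> A [^] i)" by (simp add: m_assoc)
  also have "\<dots> = (C [^] k \<otimes> A [^] (b * i)) \<otimes> C" by (simp add: C_A_pow m_assoc)
  also have "\<dots> = A [^] (b ^ Suc k * i) \<otimes> C [^] Suc k" by (simp add: Suc m_assoc mult_ac)
  finally show ?case .
qed simp

lemma B_pow_C: "B [^] j \<otimes> C = C \<otimes> B [^] (b * j)"
proof (induction j)
  case (Suc j)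
  have "B [^] Suc j \<otimes> C = B [^] j \<otimes> (B \<otimes> C)" by (simp add: m_assoc)
  also have "\<dots> = (B [^] j \<otimes> C) \<otimes> B [^] b" by (simp add: BC m_assoc)
  also have "\<dots> = C \<otimes> B [^] (b * Suc j)" by (simp add: Suc m_assoc nat_pow_mult add.commute)
  finally show ?case .
qed simp

lemma B_pow_C_pow: "B [^] j \<otimes> C [^] k = C [^] k \<otimes> B [^] (b ^ k * j)"
proof (induction k arbitrary: j)
  case (Suc k)
  have "B [^] j \<otimes> C [^] Suc k = (B [^] j \<otimes> C [^] k) \<otimes> C" by (simp add: m_assoc)
  also have "\<dots> = C [^] k \<otimes> (B [^] (b ^ k * j) \<otimes> C)" by (simp add: Suc m_assoc)
  also have "\<dots> = C [^] Suc k \<otimes> B [^] (b ^ Suc k * j)" by (simp add: B_pow_C m_assoc mult_ac)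
  finally show ?case .
qed simp

text \<open>Every further A put on the left produces a C, which multiplies by b the exponent of A
  that it passes. This is the recursion [i + 1] = 1 + b [i].\<close>

lemma A_pow_B: "A [^] i \<otimes> B = B \<otimes> A [^] qnum b i \<otimes> C [^] i"
proof (induction i)
  case (Suc i)
  have "A [^] Suc i \<otimes> B = A \<otimes> (A [^] i \<otimes> B)" unfolding nat_pow_Suc2[OF A] by (simp add: m_assoc)
  also have "\<dots> = (A \<otimes> B) \<otimes> A [^] qnum b i \<otimes> C [^] i" by (simp add: Suc m_assoc)
  also have "\<dots> = B \<otimes> A \<otimes> (C \<otimes> A [^] qnum b i) \<otimes> C [^] i" by (simp add: AB m_assoc)
  also have "\<dots> = B \<otimes> (A \<otimes> A [^] (b * qnum b i)) \<otimes> (C \<otimes> C [^] i)" by (simp add: C_A_pow m_assoc)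
  also have "\<dots> = B \<otimes> A [^] Suc (b * qnum b i) \<otimes> C [^] Suc i"
    unfolding nat_pow_Suc2[OF A] nat_pow_Suc2[OF C] by (simp add: m_assoc)
  also have "Suc (b * qnum b i) = qnum b (Suc i)" by (simp add: qnum_Suc')
  finally show ?case .
qed simp

lemma A_B_pow: "A \<otimes> B [^] qnum b j = B [^] j \<otimes> A \<otimes> C [^] j"
proof (induction j)
  case (Suc j)
  have "A \<otimes> B [^] qnum b (Suc j) = (A \<otimes> B [^] qnum b j) \<otimes> B [^] (b ^ j)"
    by (simp add: qnum_Suc m_assoc flip: nat_pow_mult)
  also have "\<dots> = B [^] j \<otimes> A \<otimes> (C [^] j \<otimes> B [^] (b ^ j))" by (simp add: Suc m_assoc)
  also have "C [^] j \<otimes> B [^] (b ^ j) = B \<otimes> C [^] j" using B_pow_C_pow[of 1 j] by simp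
  also have "B [^] j \<otimes> A \<otimes> (B \<otimes> C [^] j) = B [^] j \<otimes> (A \<otimes> B) \<otimes> C [^] j" by (simp add: m_assoc)
  also have "\<dots> = B [^] Suc j \<otimes> A \<otimes> C [^] Suc j"
  proof -
    show ?thesis unfolding nat_pow_Suc2[OF C] by (simp add: AB m_assoc)
  qed
  finally show ?case .
qed simp

text \<open>Obtained by evaluating \<open>C^n A B^[b^n]\<close> in two ways.\<close>

lemma key_relation:
  assumes "qnum b (b ^ n) = b ^ n + y"
  shows "A [^] y \<otimes> C [^] (n + b ^ n) \<otimes> B [^] y = C [^] (n + b ^ n)"
proof -
  define x where "x = b ^ n"
  have q: "qnum b x = x + y" using assms by (simp add: x_def)
  have 1: "A [^] x \<otimes> C [^] n = C [^] n \<otimes> A" using C_pow_A_pow[of n 1] by (simp add: x_def)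
  have 2: "B \<otimes> C [^] n = C [^] n \<otimes> B [^] x" using B_pow_C_pow[of 1 n] by (simp add: x_def)
  have "C [^] n \<otimes> A \<otimes> B [^] x = A [^] x \<otimes> (C [^] n \<otimes> B [^] x)" by (simp add: m_assoc flip: 1)
  also have "\<dots> = (A [^] x \<otimes> B) \<otimes> C [^] n" by (simp add: m_assoc flip: 2)
  also have "\<dots> = B \<otimes> A [^] qnum b x \<otimes> C [^] (n + x)"
    by (simp add: A_pow_B m_assoc nat_pow_mult add.commute)
  finally have 3: "C [^] n \<otimes> A \<otimes> B [^] x = B \<otimes> A [^] qnum b x \<otimes> C [^] (n + x)" .
  have "B \<otimes> (A [^] x \<otimes> (A [^] y \<otimes> C [^] (n + x) \<otimes> B [^] y)) = B \<otimes> A [^] qnum b x \<otimes> C [^] (n + x) \<otimes> B [^] y"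
    by (simp add: q m_assoc flip: nat_pow_mult)
  also have "\<dots> = C [^] n \<otimes> (A \<otimes> B [^] qnum b x)"
    unfolding 3[symmetric] by (simp add: q m_assoc nat_pow_mult)
  also have "\<dots> = (C [^] n \<otimes> B [^] x) \<otimes> A \<otimes> C [^] x" by (simp add: A_B_pow m_assoc)
  also have "\<dots> = B \<otimes> (C [^] n \<otimes> A) \<otimes> C [^] x" by (simp add: m_assoc flip: 2)
  also have "\<dots> = B \<otimes> (A [^] x \<otimes> C [^] (n + x))" by (simp add: m_assoc flip: 1 nat_pow_mult)
  finally show ?thesis by (simp add: x_def)
qed

lemma commutes_C:
  assumes z: "z \<in> carrier G" and A: "z \<otimes> A = A \<otimes> z" and B: "z \<otimes> B = B \<otimes> z"
  shows "z \<otimes> C = C \<otimes> z"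
proof -
  have "(B \<otimes> A) \<otimes> (z \<otimes> C) = B \<otimes> (A \<otimes> z) \<otimes> C" using z by (simp add: m_assoc)
  also have "\<dots> = (B \<otimes> z) \<otimes> A \<otimes> C" using z by (simp add: m_assoc flip: A)
  also have "\<dots> = z \<otimes> (A \<otimes> B)" using z by (simp add: AB m_assoc flip: B)
  also have "\<dots> = (A \<otimes> z) \<otimes> B" using z by (simp add: m_assoc flip: A)
  also have "\<dots> = (A \<otimes> B) \<otimes> z" using z by (simp add: m_assoc B)
  also have "\<dots> = (B \<otimes> A) \<otimes> (C \<otimes> z)" using z by (simp add: AB m_assoc)
  finally show ?thesis using z by simp
qed

lemma inv_B_A_pow: "inv B \<otimes> A [^] i = A [^] qnum b i \<otimes> C [^] i \<otimes> inv B"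
proof -
  have "B \<otimes> (A [^] qnum b i \<otimes> C [^] i \<otimes> inv B) = (A [^] i \<otimes> B) \<otimes> inv B"
    by (simp add: A_pow_B m_assoc)
  also have "\<dots> = B \<otimes> (inv B \<otimes> A [^] i)" by (simp add: m_assoc flip: m_assoc[of B "inv B"])
  finally show ?thesis by simp
qed

lemma inv_B_C_pow: "inv B \<otimes> C [^] k = C [^] k \<otimes> inv (B [^] (b ^ k))"
proof -
  have "B \<otimes> (C [^] k \<otimes> inv (B [^] (b ^ k))) = C [^] k \<otimes> B [^] (b ^ k) \<otimes> inv (B [^] (b ^ k))"
    using B_pow_C_pow[of 1 k] by (simp flip: m_assoc)
  also have "\<dots> = B \<otimes> (inv B \<otimes> C [^] k)" by (simp add: m_assoc flip: m_assoc[of B "inv B"])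
  finally show ?thesis by simp
qed

end

text \<open>The canonical representative of \<open>(i, k, j)\<close>, which stands for \<open>A^i C^k B^j\<close>, when
  \<open>A^Q = 1\<close>, \<open>B^q = A^(-q)\<close> and \<open>C^q = A^(\<sigma>q)\<close>.\<close>

fun nf :: "nat \<Rightarrow> nat \<Rightarrow> nat \<Rightarrow> nat \<times> nat \<times> nat \<Rightarrow> nat \<times> nat \<times> nat" where
  "nf q Q \<sigma> (i, k, j) =
    ((i + \<sigma> * (q * (k div q)) + (Q - 1) * (q * (j div q))) mod Q, k mod q, j mod q)"

lemma nf_eq_iff:
  assumes "Q > 0"
  shows "nf q Q \<sigma> (i, k, j) = nf q Q \<sigma> (i', k', j') \<longleftrightarrow>
    int q dvd int k - int k' \<and> int q dvd int j - int j' \<and>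
    int Q dvd (int i - int i') - (int j - int j') + int \<sigma> * (int k - int k')"
proof (cases "int q dvd int k - int k' \<and> int q dvd int j - int j'")
  case True
  have 1: "k mod q = k' mod q" "j mod q = j' mod q"
    using True by (metis cong_def cong_iff_dvd_diff cong_int_iff)+
  have d: "int q * (int x div int q) = int x - int (x mod q)" for x
    by (simp add: minus_mod_eq_mult_div zmod_int)
  have Q: "int (Q - 1) = int Q - 1" using assms by (simp add: of_nat_diff)
  have "nf q Q \<sigma> (i, k, j) = nf q Q \<sigma> (i', k', j') \<longleftrightarrow>
    [i + \<sigma> * (q * (k div q)) + (Q - 1) * (q * (j div q)) = i' + \<sigma> * (q * (k' div q)) + (Q - 1) * (q * (j' div q))] (mod Q)"
    using 1 by (simp add: cong_def)
  also have "\<dots> \<longleftrightarrow> int Q dvd int (i + \<sigma> * (q * (k div q)) + (Q - 1) * (q * (j div q)))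
      - int (i' + \<sigma> * (q * (k' div q)) + (Q - 1) * (q * (j' div q)))"
    by (simp only: cong_iff_dvd_diff flip: cong_int_iff)
  also have "int (i + \<sigma> * (q * (k div q)) + (Q - 1) * (q * (j div q)))
      - int (i' + \<sigma> * (q * (k' div q)) + (Q - 1) * (q * (j' div q)))
    = ((int i - int i') - (int j - int j') + int \<sigma> * (int k - int k')) + int Q * (int j - int j')"
    unfolding of_nat_add of_nat_mult zdiv_int Q d using 1 by (simp add: algebra_simps)
  also have "int Q dvd \<dots> \<longleftrightarrow> int Q dvd (int i - int i') - (int j - int j') + int \<sigma> * (int k - int k')"
    by (rule dvd_add_times_triv_right_iff[of "int Q" _ "int j - int j'", unfolded mult.commute[of "int j - int j'"]])
  finally show ?thesis using True by simp
next
  case False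
  then have "\<not> (k mod q = k' mod q \<and> j mod q = j' mod q)"
    by (metis cong_def cong_iff_dvd_diff cong_int_iff)
  then show ?thesis using False by auto
qed

text \<open>The exponent \<open>v\<close> will be \<open>2m\<close>, \<open>2m - 1\<close>, \<open>3\<close> in Cases 1, 2, 3; \<open>\<sigma>\<close> is \<open>0\<close> for odd
  \<open>p\<close> and \<open>2^(m - 1)\<close> for \<open>p = 2\<close>.\<close>

locale macdonald_p = padic_base p m u + macdonald G A B C "padic_base.b p m u"
  for p m u and G (structure) and A B C +
  fixes K v \<sigma> :: nat
  assumes A_pow_K: "A [^] (p ^ K) = \<one>" and B_pow_K: "B [^] (p ^ K) = \<one>"
    and key: "\<exists>n c. qnum b (b ^ n) = b ^ n + p ^ v * c \<and> \<not> p dvd c"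
    and qnum_q: "p ^ v dvd n \<Longrightarrow> int p ^ (v + m) dvd int (qnum b n) - int n + int \<sigma> * int n"
begin

definition q :: nat where "q = p ^ v"

definition Q :: nat where "Q = p ^ (v + m)"

lemma Q_pos: "Q > 0" and q_pos: "q > 0"
  using p_pos by (simp_all add: Q_def q_def)

text \<open>Moving C^M past B^y in \<open>key_relation\<close> gives A^y = B^j for some j, so A^y
  commutes with A and B, hence with C. Centrality turns the relation into A^y B^y = 1, and C A^y =
  A^(b y) C into A^(e y) = 1. As y = q c and e y = Q u c with c and u prime to p, inverses modulo
  p^K carry these facts over to q and Q.\<close>

lemma w_relations:
  shows A_pow_q_B: "A [^] q \<otimes> B = B \<otimes> A [^] q" and A_q_B_q: "A [^] q \<otimes> B [^] q = \<one>"
    and A_pow_Q: "A [^] Q = \<one>"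
proof -
  obtain n c where n: "qnum b (b ^ n) = b ^ n + p ^ v * c" and c: "\<not> p dvd c" using key by blast
  define y where "y = p ^ v * c"
  define M where "M = n + b ^ n"
  have k: "A [^] y \<otimes> C [^] M \<otimes> B [^] y = C [^] M"
    unfolding M_def by (rule key_relation) (simp add: n y_def)
  have co: "coprime (b ^ M) (p ^ K)" using coprime_b by simp
  have "\<exists>j. [b ^ M * j = (p ^ K - 1) * y] (mod p ^ K)"
    using cong_solve_coprime_nat[OF co] by (metis cong_scalar_right mult.assoc mult.left_neutral One_nat_def)
  then obtain j where j: "[b ^ M * j = (p ^ K - 1) * y] (mod p ^ K)" by blast
  have B1: "B [^] ((p ^ K - 1) * y) \<otimes> B [^] y = \<one>"
    by (rule pow_complement[OF _ B_pow_K]) (use p_pos in auto)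
  have "B [^] j \<otimes> C [^] M \<otimes> B [^] y = C [^] M \<otimes> (B [^] (b ^ M * j) \<otimes> B [^] y)"
    by (simp add: B_pow_C_pow m_assoc)
  also have "B [^] (b ^ M * j) = B [^] ((p ^ K - 1) * y)"
    by (rule pow_eq_of_cong[OF _ B_pow_K j]) simp
  finally have "B [^] j \<otimes> C [^] M \<otimes> B [^] y = A [^] y \<otimes> C [^] M \<otimes> B [^] y"
    using B1 k by simp
  then have AB: "A [^] y = B [^] j" by simp
  have yB: "A [^] y \<otimes> B = B \<otimes> A [^] y"
    using commutes_pow[of B B j 1] by (simp add: AB)
  have yA: "A [^] y \<otimes> A = A \<otimes> A [^] y" using commutes_pow[of A A y 1] by simp
  have yC: "A [^] y \<otimes> C = C \<otimes> A [^] y" using commutes_C[OF _ yA yB] by simp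
  have "A [^] y \<otimes> C [^] M = C [^] M \<otimes> A [^] y"
    using commutes_pow[OF _ _ yC, of 1 M] by simp
  then have "C [^] M \<otimes> (A [^] y \<otimes> B [^] y) = C [^] M \<otimes> \<one>" using k by (simp add: m_assoc)
  then have AyBy: "A [^] y \<otimes> B [^] y = \<one>" by simp
  have "A [^] (b * y) \<otimes> C = A [^] y \<otimes> C" using C_A_pow[of y] yC by simp
  then have "A [^] (b * y) = A [^] y" by simp
  then have "A [^] y \<otimes> A [^] (e * y) = A [^] y \<otimes> \<one>" by (simp add: b_def nat_pow_mult)
  then have Aey: "A [^] (e * y) = \<one>" by simp
  have "coprime c (p ^ K)" using c p by (metis coprime_commute coprime_power_right_iff prime_imp_coprime)
  then obtain c' where "[c * c' = 1] (mod p ^ K)" using cong_solve_coprime_nat by (metis One_nat_def)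
  then have c': "[p ^ v * (c * c') = p ^ v * 1] (mod p ^ K)" by (rule cong_scalar_left)
  have Aq: "A [^] q = (A [^] y) [^] c'"
  proof -
    have "A [^] (p ^ v * 1) = A [^] (p ^ v * (c * c'))"
      by (rule pow_eq_of_cong[OF _ A_pow_K cong_sym[OF c']]) simp
    then show ?thesis by (simp add: q_def y_def nat_pow_pow mult.assoc)
  qed
  have Bq: "B [^] q = (B [^] y) [^] c'"
  proof -
    have "B [^] (p ^ v * 1) = B [^] (p ^ v * (c * c'))"
      by (rule pow_eq_of_cong[OF _ B_pow_K cong_sym[OF c']]) simp
    then show ?thesis by (simp add: q_def y_def nat_pow_pow mult.assoc)
  qed
  show "A [^] q \<otimes> B = B \<otimes> A [^] q"
    unfolding Aq using commutes_pow[OF _ _ yB, of c' 1] by simp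
  have "A [^] y \<otimes> B [^] y = B [^] y \<otimes> A [^] y"
    using commutes_pow[OF _ _ yB, of 1 y] by simp
  then have "(A [^] y \<otimes> B [^] y) [^] c' = (A [^] y) [^] c' \<otimes> (B [^] y) [^] c'"
    by (rule pow_mult_distrib) auto
  then show "A [^] q \<otimes> B [^] q = \<one>" unfolding Aq Bq AyBy by simp
  have cu: "coprime (u * c) (p ^ K)"
    using c u p by (metis coprime_commute coprime_power_right_iff prime_dvd_mult_iff prime_imp_coprime)
  then obtain d where "[(u * c) * d = 1] (mod p ^ K)" using cong_solve_coprime_nat by (metis One_nat_def)
  then have d: "[p ^ (v + m) * ((u * c) * d) = p ^ (v + m) * 1] (mod p ^ K)" by (rule cong_scalar_left)
  have "A [^] (p ^ (v + m) * 1) = A [^] (p ^ (v + m) * ((u * c) * d))"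
    by (rule pow_eq_of_cong[OF _ A_pow_K cong_sym[OF d]]) simp
  also have "\<dots> = (A [^] (e * y)) [^] d"
    by (simp add: nat_pow_pow e_def y_def power_add mult_ac)
  finally show "A [^] Q = \<one>" by (simp add: Aey Q_def)
qed

lemma A_pow_q_C: "A [^] q \<otimes> C = C \<otimes> A [^] q"
  using commutes_C[OF _ _ A_pow_q_B] commutes_pow[of A A q 1] by simp

lemma B_q: "B [^] q = A [^] ((Q - 1) * q)"
proof -
  have "A [^] q \<otimes> A [^] ((Q - 1) * q) = \<one>"
    by (rule pow_complement[OF _ A_pow_Q Q_pos]) simp
  then have "A [^] q \<otimes> A [^] ((Q - 1) * q) = A [^] q \<otimes> B [^] q" by (simp add: A_q_B_q)
  then show ?thesis by simp
qed

lemma B_pow_Q: "B [^] Q = \<one>"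
proof -
  have "Q = q * p ^ m" by (simp add: Q_def q_def power_add)
  then have "B [^] Q = (B [^] q) [^] (p ^ m)" by (simp add: nat_pow_pow)
  also have "\<dots> = A [^] (Q * (Q - 1))"
    unfolding B_q \<open>Q = q * p ^ m\<close> by (simp add: nat_pow_pow mult_ac)
  finally show ?thesis by (simp add: pow_mult_one A_pow_Q)
qed

lemma qnum_q_cong: "q dvd n \<Longrightarrow> [qnum b n + \<sigma> * n = n] (mod Q)"
  using qnum_q[of n] unfolding q_def Q_def
  by (simp add: cong_iff_dvd_diff algebra_simps flip: cong_int_iff)

text \<open>Since B^q is central, A B^[q] = B^q A C^q says C^q = B^([q] - q). The exponent is
  -\<sigma> q modulo Q by \<open>qnum_q\<close>, and B^q is inverse to A^q.\<close>

lemma C_q: "C [^] q = A [^] (\<sigma> * q)"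
proof -
  have BA: "B [^] q \<otimes> A = A \<otimes> B [^] q"
    unfolding B_q using commutes_pow[of A A "(Q - 1) * q" 1] by simp
  have "A \<otimes> B [^] qnum b q = A \<otimes> (B [^] q \<otimes> C [^] q)"
    unfolding A_B_pow BA by (simp add: m_assoc)
  then have 1: "B [^] qnum b q = B [^] q \<otimes> C [^] q" by simp
  have CB: "C [^] q \<otimes> B [^] (\<sigma> * q) = \<one>"
  proof -
    have "B [^] q \<otimes> (C [^] q \<otimes> B [^] (\<sigma> * q)) = B [^] (qnum b q + \<sigma> * q)"
      by (simp add: 1 m_assoc flip: nat_pow_mult)
    also have "\<dots> = B [^] q \<otimes> \<one>"
      using pow_eq_of_cong[OF _ B_pow_Q qnum_q_cong[of q]] by simp
    finally show ?thesis by simp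
  qed
  have "A [^] (\<sigma> * q) \<otimes> B [^] (\<sigma> * q) = (A [^] q \<otimes> B [^] q) [^] \<sigma>"
  proof -
    have "A [^] q \<otimes> B [^] q = B [^] q \<otimes> A [^] q"
      using commutes_pow[OF _ _ A_pow_q_B, of 1 q] by simp
    from pow_mult_distrib[OF this, of \<sigma>] show ?thesis by (simp add: nat_pow_pow mult.commute)
  qed
  then have "C [^] q \<otimes> B [^] (\<sigma> * q) = A [^] (\<sigma> * q) \<otimes> B [^] (\<sigma> * q)"
    by (simp add: CB A_q_B_q)
  then show ?thesis by simp
qed

lemma A_pow_q_central:
  assumes "q dvd n" "g \<in> {A, B, C}"
  shows "g [^] (j::nat) \<otimes> A [^] n = A [^] n \<otimes> g [^] j"
proof -
  obtain k where k: "n = q * k" using assms(1) by blast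
  have "A [^] q \<otimes> g = g \<otimes> A [^] q"
    using assms(2) A_pow_q_B A_pow_q_C commutes_pow[of A A q 1] by auto
  then have "g \<otimes> A [^] q = A [^] q \<otimes> g" by simp
  from commutes_pow[OF _ _ this, of j k] show ?thesis using assms(2)
    by (auto simp: nat_pow_pow k)
qed

definition elt :: "nat \<times> nat \<times> nat \<Rightarrow> 'a" where
  "elt x = (case x of (i, k, j) \<Rightarrow> A [^] i \<otimes> C [^] k \<otimes> B [^] j)"

lemma elt_eq: "elt (i, k, j) = A [^] i \<otimes> C [^] k \<otimes> B [^] j"
  by (simp add: elt_def)

lemma elt_closed [simp]: "elt x \<in> carrier G"
  by (simp add: elt_def split: prod.split)

lemma elt_nf: "elt (nf q Q \<sigma> x) = elt x"
proof -
  obtain i k j where x: "x = (i, k, j)" by (cases x) auto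
  define k' where "k' = q * (k div q)"
  define j' where "j' = q * (j div q)"
  have Ck: "C [^] k = A [^] (\<sigma> * k') \<otimes> C [^] (k mod q)"
  proof -
    have "C [^] k = C [^] k' \<otimes> C [^] (k mod q)" by (simp add: nat_pow_mult k'_def)
    also have "C [^] k' = A [^] (\<sigma> * k')"
      by (simp add: k'_def C_q nat_pow_pow mult.assoc flip: nat_pow_pow[of C q])
    finally show ?thesis .
  qed
  have Bj: "B [^] j = A [^] ((Q - 1) * j') \<otimes> B [^] (j mod q)"
  proof -
    have "B [^] j = B [^] j' \<otimes> B [^] (j mod q)" by (simp add: nat_pow_mult j'_def)
    also have "B [^] j' = A [^] ((Q - 1) * j')"
      by (simp add: j'_def B_q nat_pow_pow mult.assoc flip: nat_pow_pow[of B q])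
    finally show ?thesis .
  qed
  have c: "C [^] (k mod q) \<otimes> A [^] ((Q - 1) * j') = A [^] ((Q - 1) * j') \<otimes> C [^] (k mod q)"
    by (rule A_pow_q_central) (auto simp: j'_def)
  have "elt x = A [^] i \<otimes> A [^] (\<sigma> * k') \<otimes> (C [^] (k mod q) \<otimes> A [^] ((Q - 1) * j')) \<otimes> B [^] (j mod q)"
    by (simp add: x elt_eq Ck Bj m_assoc)
  also have "\<dots> = A [^] (i + \<sigma> * k' + (Q - 1) * j') \<otimes> C [^] (k mod q) \<otimes> B [^] (j mod q)"
    unfolding c by (simp add: m_assoc flip: nat_pow_mult)
  also have "A [^] (i + \<sigma> * k' + (Q - 1) * j') = A [^] ((i + \<sigma> * k' + (Q - 1) * j') mod Q)"
    by (rule pow_eq_of_cong[OF _ A_pow_Q]) (simp_all add: cong_def)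
  finally show ?thesis by (simp add: x elt_eq k'_def j'_def)
qed

lemma A_elt: "A \<otimes> elt (i, k, j) = elt (Suc i, k, j)"
  unfolding elt_eq nat_pow_Suc2[OF A] by (simp add: m_assoc)

lemma inv_A_elt: "inv A \<otimes> elt (i, k, j) = elt (i + (Q - 1), k, j)"
proof -
  have "A [^] Suc (Q - 1) = \<one>" using Q_pos A_pow_Q by simp
  then have "A [^] (Q - 1) \<otimes> A = \<one>" by simp
  then have "inv A = A [^] (Q - 1)" by (simp add: inv_equality)
  then show ?thesis by (simp add: elt_eq m_assoc add.commute[of i] flip: nat_pow_mult)
qed

lemma inv_B_pow: "inv (B [^] n) = B [^] ((Q - 1) * n)"
proof -
  have "B [^] ((Q - 1) * n) \<otimes> B [^] n = \<one>"
    by (rule pow_complement[OF _ B_pow_Q Q_pos]) simp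
  then show ?thesis by (simp add: inv_equality)
qed

lemma inv_B_elt: "inv B \<otimes> elt (i, k, j) = elt (qnum b i, k + i, j + (Q - 1) * b ^ k)"
proof -
  have "inv B \<otimes> elt (i, k, j) = (inv B \<otimes> A [^] i) \<otimes> C [^] k \<otimes> B [^] j"
    by (simp add: elt_eq m_assoc)
  also have "\<dots> = A [^] qnum b i \<otimes> C [^] i \<otimes> (inv B \<otimes> C [^] k) \<otimes> B [^] j"
    by (simp add: inv_B_A_pow m_assoc)
  also have "\<dots> = A [^] qnum b i \<otimes> (C [^] i \<otimes> C [^] k) \<otimes> (B [^] ((Q - 1) * b ^ k) \<otimes> B [^] j)"
    by (simp add: inv_B_C_pow inv_B_pow m_assoc)
  also have "\<dots> = elt (qnum b i, k + i, j + (Q - 1) * b ^ k)"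
    by (simp add: elt_eq nat_pow_mult add.commute)
  finally show ?thesis .
qed

text \<open>A formula is at hand only for left multiplication by the inverse of B; B itself is the
  (Q - 1)-st power of that inverse.\<close>

lemma B_elt: "\<exists>y. B \<otimes> elt x = elt y"
proof -
  have *: "\<exists>y. (inv B) [^] n \<otimes> elt x = elt y" for n :: nat
  proof (induction n arbitrary: x)
    case (Suc n)
    obtain i k j where x: "x = (i, k, j)" by (cases x) auto
    have "(inv B) [^] Suc n \<otimes> elt x = (inv B) [^] n \<otimes> (inv B \<otimes> elt x)" by (simp add: m_assoc)
    then show ?case using Suc unfolding x inv_B_elt by simp
  qed auto
  have "Suc (Q - 1) = Q" using Q_pos by simp
  have "(inv B) [^] Suc (Q - 1) = \<one>" unfolding \<open>Suc (Q - 1) = Q\<close> by (simp add: nat_pow_inv B_pow_Q)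
  then have "(inv B) [^] (Q - 1) \<otimes> inv B = \<one>" by simp
  then have "(inv B) [^] (Q - 1) = B" using inv_equality[of "(inv B) [^] (Q - 1)" "inv B"] by simp
  then show ?thesis using *[of "Q - 1"] by simp
qed

lemma generate_AB: "g \<in> generate G {A, B} \<longleftrightarrow> (\<exists>x. g = elt x)"
proof
  assume g: "g \<in> generate G {A, B}"
  have "g \<otimes> elt (0, 0, 0) \<in> range elt"
  proof (rule generate_induct_left[OF _ g])
    show "h \<otimes> x \<in> range elt" "inv h \<otimes> x \<in> range elt" if h: "h \<in> {A, B}" and "x \<in> range elt" for h x
    proof -
      obtain i k j where x: "x = elt (i, k, j)" using \<open>x \<in> range elt\<close> by (metis rangeE surj_pair)
      show "h \<otimes> x \<in> range elt" using h unfolding x by (metis insertE singletonD A_elt B_elt rangeI)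
      show "inv h \<otimes> x \<in> range elt" using h unfolding x by (metis insertE singletonD inv_A_elt inv_B_elt rangeI)
    qed
  qed auto
  moreover have "g \<otimes> elt (0, 0, 0) = g"
    using generate_in_carrier[OF _ g] by (simp add: elt_eq)
  ultimately show "\<exists>x. g = elt x" by auto
next
  have Ag: "A \<in> generate G {A, B}" and Bg: "B \<in> generate G {A, B}" by (auto intro: generate.incl)
  have sub: "subgroup (generate G {A, B}) G" by (rule generate_is_subgroup) simp
  have "C = inv (B \<otimes> A) \<otimes> (A \<otimes> B)"
    unfolding AB by (subst m_assoc[symmetric]) (auto simp: l_inv)
  then have Cg: "C \<in> generate G {A, B}"
    using Ag Bg sub by (simp add: subgroup.m_closed subgroup.m_inv_closed)
  have pw: "x [^] n \<in> generate G {A, B}" if "x \<in> generate G {A, B}" for x and n :: nat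
    using that by (induction n) (auto simp: subgroup.one_closed[OF sub] subgroup.m_closed[OF sub])
  show "\<exists>x. g = elt x \<Longrightarrow> g \<in> generate G {A, B}"
    using pw[OF Ag] pw[OF Bg] pw[OF Cg] by (auto simp: elt_def subgroup.m_closed[OF sub])
qed

end

section \<open>A permutation model\<close>

text \<open>N picks representatives for the relation N x = N y. Maps are composed and iterated on
  all of the underlying type, where their formulas stay free of reductions, and are passed to
  representatives only at the end by \<open>hat\<close>.\<close>

locale canonical_reps =
  fixes N :: "'x \<Rightarrow> 'x"
  assumes idem [simp]: "N (N x) = N x"
begin

definition respectful :: "('x \<Rightarrow> 'x) \<Rightarrow> bool" where
  "respectful f \<longleftrightarrow> (\<forall>x y. N x = N y \<longrightarrow> N (f x) = N (f y))"

text \<open>\<open>Bij\<close> consists of functions extensional on the set, hence the restricted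
  abstraction.\<close>

definition hat :: "('x \<Rightarrow> 'x) \<Rightarrow> 'x \<Rightarrow> 'x" where
  "hat f = (\<lambda>x \<in> range N. N (f x))"

lemma respectful_comp: "respectful f \<Longrightarrow> respectful g \<Longrightarrow> respectful (f \<circ> g)"
  unfolding respectful_def comp_apply by blast

lemma respectful_funpow: "respectful f \<Longrightarrow> respectful (f ^^ n)"
proof (induction n)
  case (Suc n)
  then show ?case unfolding funpow.simps by (intro respectful_comp)
qed (simp add: respectful_def)

lemma respectfulD: "respectful f \<Longrightarrow> N (f (N x)) = N (f x)"
  unfolding respectful_def using idem by blast

lemma hat_apply:
  assumes "respectful f"
  shows "hat f (N x) = N (f x)"
  unfolding hat_def using respectfulD[OF assms, of x] by simp

lemma compose_hat:
  assumes "respectful f"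
  shows "compose (range N) (hat f) (hat g) = hat (f \<circ> g)"
proof
  fix x
  show "compose (range N) (hat f) (hat g) x = hat (f \<circ> g) x"
    using hat_apply[OF assms, of "g x"] by (simp add: compose_def hat_def)
qed

lemma hat_eq_iff: "respectful f \<Longrightarrow> respectful g \<Longrightarrow> hat f = hat g \<longleftrightarrow> (\<forall>x. N (f x) = N (g x))"
proof
  assume f: "respectful f" and g: "respectful g" and eq: "hat f = hat g"
  show "\<forall>x. N (f x) = N (g x)" unfolding hat_apply[OF f, symmetric] hat_apply[OF g, symmetric] eq by simp
qed (auto simp: hat_def)

lemma hat_id: "hat id = (\<lambda>x \<in> range N. x)"
  by (auto simp: hat_def fun_eq_iff restrict_def)

text \<open>Some positive iterate of f is the identity up to N, so the iterate before it represents
  the inverse.\<close>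

lemma hat_Bij:
  assumes f: "respectful f" and n: "n > 0" and id: "\<And>x. N ((f ^^ n) x) = N x"
  shows "hat f \<in> Bij (range N)"
proof -
  obtain n' where n': "n = Suc n'" using n by (cases n) auto
  define g where "g = f ^^ n'"
  have g: "respectful g" unfolding g_def using f by (rule respectful_funpow)
  have fg: "N (f (g x)) = N x" for x
    using id[of x] unfolding n' g_def funpow.simps comp_apply .
  have gf: "N (g (f x)) = N x" for x
    using id[of x] unfolding n' g_def funpow_Suc_right comp_apply .
  have "bij_betw (hat f) (range N) (range N)"
    by (rule bij_betwI[where g = "hat g"]) (auto simp: hat_def respectfulD[OF f] respectfulD[OF g] fg gf)
  then show ?thesis by (simp add: Bij_def hat_def)
qed

lemma hat_mult:
  assumes "respectful f" "respectful g" "hat f \<in> Bij (range N)" "hat g \<in> Bij (range N)"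
  shows "hat f \<otimes>\<^bsub>BijGroup (range N)\<^esub> hat g = hat (f \<circ> g)"
  using assms by (simp add: BijGroup_def compose_hat)

lemma hat_one: "\<one>\<^bsub>BijGroup (range N)\<^esub> = hat id"
  by (simp add: BijGroup_def hat_id)

lemma hat_carrier: "hat f \<in> carrier (BijGroup (range N)) \<longleftrightarrow> hat f \<in> Bij (range N)"
  by (simp add: BijGroup_def)

lemma hat_comp_Bij:
  assumes "respectful f" "hat f \<in> Bij (range N)" "hat g \<in> Bij (range N)"
  shows "hat (f \<circ> g) \<in> Bij (range N)"
  using compose_Bij[OF assms(2,3)] by (simp add: compose_hat assms(1))

lemma hat_pow:
  assumes "respectful f" "hat f \<in> Bij (range N)"
  shows "hat f [^]\<^bsub>BijGroup (range N)\<^esub> (n::nat) = hat (f ^^ n) \<and> hat (f ^^ n) \<in> Bij (range N)"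
proof (induction n)
  case 0
  have "hat id \<in> Bij (range N)" unfolding hat_id by (rule id_Bij)
  then show ?case
    by (simp add: hat_one monoid.nat_pow_0[OF group.is_monoid[OF group_BijGroup]] flip: id_def)
next
  case (Suc n)
  interpret group "BijGroup (range N)" by (rule group_BijGroup)
  have "hat f [^]\<^bsub>BijGroup (range N)\<^esub> Suc n = hat (f ^^ n) \<otimes>\<^bsub>BijGroup (range N)\<^esub> hat f"
    using Suc assms by (simp add: hat_carrier)
  also have "\<dots> = hat (f ^^ n \<circ> f)"
    using Suc assms by (intro hat_mult respectful_funpow) auto
  finally have "hat f [^]\<^bsub>BijGroup (range N)\<^esub> Suc n = hat (f ^^ n \<circ> f)" .
  moreover have "hat (f ^^ n \<circ> f) \<in> Bij (range N)"
    using Suc assms by (intro hat_comp_Bij respectful_funpow) auto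
  ultimately show ?case unfolding funpow_Suc_right by (rule conjI)
qed

end

text \<open>\<open>rel1\<close>, \<open>rel2\<close> and \<open>rel3\<close> compare the exponents
  of C, B and A in the two sides of D C = C D^b applied to a triple, D being the inverse of B.
  \<open>key\<close> and \<open>qnum_q\<close> are the assumptions of \<open>macdonald_p\<close>,
  which the model will have to satisfy itself.\<close>

locale macdonald_model = padic_base p m u for p m u +
  fixes v \<sigma> :: nat
  assumes key: "\<exists>n c. qnum b (b ^ n) = b ^ n + p ^ v * c \<and> \<not> p dvd c"
    and qnum_q: "p ^ v dvd n \<Longrightarrow> int p ^ (v + m) dvd int (qnum b n) - int n + int \<sigma> * int n"
    and rel1: "int p ^ v dvd int (qiter_sum b i b) - int (b * i)"
    and rel2: "int p ^ v dvd int (qiter_psum b i b) - int b"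
    and rel3: "int p ^ (v + m) dvd int (qnum b (b * i)) - int (b * qiter b i b)
      - (int (qiter_psum b i b) - int b) + int \<sigma> * (int (b * i) - int (qiter_sum b i b))"
begin

definition q :: nat where "q = p ^ v"

definition Q :: nat where "Q = p ^ (v + m)"

lemma Q_pos: "Q > 0" and q_pos: "q > 0"
  using p_pos by (simp_all add: Q_def q_def)

lemma q_dvd_Q: "q dvd Q" by (simp add: q_def Q_def le_imp_power_dvd)

lemma int_q_dvd_Q: "int q dvd int Q" using q_dvd_Q by simp

lemma Q_eq: "Q = q * p ^ m" by (simp add: q_def Q_def power_add)

abbreviation N where "N \<equiv> nf q Q \<sigma>"

lemma N_idem: "N (N x) = N x"
  by (cases x) (simp add: nf.simps Q_pos)

declare nf.simps [simp del]

sublocale canonical_reps N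
  by unfold_locales (rule N_idem)

lemma N_eq_iff: "N (i, k, j) = N (i', k', j') \<longleftrightarrow>
    int q dvd int k - int k' \<and> int q dvd int j - int j' \<and>
    int Q dvd (int i - int i') - (int j - int j') + int \<sigma> * (int k - int k')"
  by (rule nf_eq_iff[OF Q_pos])

lemma N_eq_imp_dvd:
  assumes "N (i, k, j) = N (i', k', j')"
  shows "int q dvd int i - int i'"
proof -
  have 1: "int q dvd (int i - int i') - (int j - int j') + int \<sigma> * (int k - int k')"
    using assms int_q_dvd_Q dvd_trans unfolding N_eq_iff by blast
  have 2: "int q dvd int j - int j'" and 3: "int q dvd int \<sigma> * (int k - int k')"
    using assms unfolding N_eq_iff by auto
  have "int q dvd ((int i - int i') - (int j - int j') + int \<sigma> * (int k - int k'))
      - int \<sigma> * (int k - int k') + (int j - int j')"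
    by (rule dvd_add[OF dvd_diff[OF 1 3] 2])
  also have "((int i - int i') - (int j - int j') + int \<sigma> * (int k - int k'))
      - int \<sigma> * (int k - int k') + (int j - int j') = int i - int i'" by simp
  finally show ?thesis .
qed

lemma Q_dvd_e_times: "int q dvd x \<Longrightarrow> int Q dvd int e * x"
  by (auto simp: Q_eq e_def dvd_def)

text \<open>[i' + n] - [i'] = b^i' [n]. For q dividing n the number b^i' may be replaced by 1, as e
  n is a multiple of Q, and \<open>qnum_q\<close> evaluates [n].\<close>

lemma qnum_diff:
  assumes "int q dvd int i - int i'"
  shows "int Q dvd (int (qnum b i) - int (qnum b i')) - (int i - int i') + int \<sigma> * (int i - int i')"
proof -
  have *: "int Q dvd (int (qnum b i) - int (qnum b i')) - (int i - int i') + int \<sigma> * (int i - int i')"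
    if "int q dvd int i - int i'" "i' \<le> i" for i i'
  proof -
    define n where "n = i - i'"
    have i: "i = i' + n" using that(2) by (simp add: n_def)
    have qn: "q dvd n" using that(1) by (simp add: i)
    then obtain s where "int (qnum b n) - int n + int \<sigma> * int n = int Q * s"
      using qnum_q[of n] unfolding q_def Q_def by (auto simp: dvd_def)
    then have s: "int (qnum b n) = int n - int \<sigma> * int n + int Q * s" by simp
    have bi: "int (b ^ i') = 1 + int e * int (qnum b i')"
      unfolding b_def power_eq_qnum by simp
    have "(int (qnum b i) - int (qnum b i')) - (int i - int i') + int \<sigma> * (int i - int i')
      = int (b ^ i') * int Q * s + int e * (int n * (int (qnum b i') * (1 - int \<sigma>)))"
      unfolding i qnum_add of_nat_add of_nat_mult[of "b ^ i'"] s bi by (simp add: algebra_simps)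
    also have "int Q dvd \<dots>"
      using qn by (intro dvd_add Q_dvd_e_times) auto
    finally show ?thesis .
  qed
  show ?thesis
  proof (cases "i' \<le> i")
    case True
    then show ?thesis using * assms by blast
  next
    case False
    have "int Q dvd (int (qnum b i') - int (qnum b i)) - (int i' - int i) + int \<sigma> * (int i' - int i)"
      using * False assms by (simp add: dvd_diff_commute)
    then have "int Q dvd - ((int (qnum b i') - int (qnum b i)) - (int i' - int i) + int \<sigma> * (int i' - int i))"
      by (simp only: dvd_minus_iff)
    then show ?thesis by (simp add: algebra_simps)
  qed
qed

lemma power_diff_dvd:
  assumes "int q dvd int k - int k'"
  shows "int Q dvd int (b ^ k) - int (b ^ k')"
proof -
  have *: "int Q dvd int (b ^ k) - int (b ^ k')" if "int q dvd int k - int k'" "k' \<le> k" for k k'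
  proof -
    define n where "n = k - k'"
    have k: "k = k' + n" using that(2) by (simp add: n_def)
    have "q dvd n" using that(1) by (simp add: k)
    then have "Q dvd b ^ n - 1" using dvd_power_iff[of v n] by (simp add: q_def Q_def add.commute)
    moreover have "b ^ n \<ge> 1" by (simp add: b_def)
    ultimately have "int Q dvd int (b ^ n) - 1" by (metis int_dvd_int_iff of_nat_1 of_nat_diff)
    moreover have "int (b ^ k) - int (b ^ k') = int (b ^ k') * (int (b ^ n) - 1)"
      by (simp add: k power_add algebra_simps)
    ultimately show ?thesis by simp
  qed
  show ?thesis
    using *[of k k'] *[of k' k] assms by (metis dvd_diff_commute nat_le_linear)
qed

section \<open>Left multiplications on triples of exponents\<close>

definition mA :: "nat \<times> nat \<times> nat \<Rightarrow> nat \<times> nat \<times> nat" where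
  "mA = (\<lambda>(i, k, j). (Suc i, k, j))"

definition mC :: "nat \<times> nat \<times> nat \<Rightarrow> nat \<times> nat \<times> nat" where
  "mC = (\<lambda>(i, k, j). (b * i, Suc k, j))"

text \<open>Left multiplication by the inverse of \<open>B\<close>; exponents of \<open>B\<close> are kept nonnegative by
  writing \<open>Q - 1\<close> for \<open>-1\<close>.\<close>

definition mD :: "nat \<times> nat \<times> nat \<Rightarrow> nat \<times> nat \<times> nat" where
  "mD = (\<lambda>(i, k, j). (qnum b i, k + i, j + (Q - 1) * b ^ k))"

lemma int_Q1: "int (Q - 1) = int Q - 1"
  using Q_pos by (simp add: of_nat_diff)

lemma respectful_mA: "respectful mA"
  unfolding respectful_def mA_def by (auto simp: N_eq_iff)

lemma respectful_mC: "respectful mC"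
  unfolding respectful_def
proof (intro allI impI)
  fix x y
  assume xy: "N x = N y"
  obtain i k j i' k' j' where x: "x = (i, k, j)" and y: "y = (i', k', j')" by (metis surj_pair)
  have "int Q dvd int e * (int i - int i')"
    by (rule Q_dvd_e_times[OF N_eq_imp_dvd[OF xy[unfolded x y]]])
  moreover have "int Q dvd (int i - int i') - (int j - int j') + int \<sigma> * (int k - int k')"
    using xy[unfolded x y] unfolding N_eq_iff by blast
  ultimately have "int Q dvd int e * (int i - int i') + ((int i - int i') - (int j - int j') + int \<sigma> * (int k - int k'))"
    by (rule dvd_add)
  moreover have "int e * (int i - int i') + ((int i - int i') - (int j - int j') + int \<sigma> * (int k - int k'))
    = (int (b * i) - int (b * i')) - (int j - int j') + int \<sigma> * (int (Suc k) - int (Suc k'))"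
    by (simp add: b_def algebra_simps)
  ultimately show "N (mC x) = N (mC y)"
    using xy[unfolded x y] unfolding x y mC_def prod.case N_eq_iff by simp
qed

text \<open>Changing i by a multiple of q changes [i] by only 1 - \<sigma> times that amount; but i
  is also added to the exponent of C, whose weight \<sigma> in \<open>N_eq_iff\<close> makes up for
  it.\<close>

lemma respectful_mD: "respectful mD"
  unfolding respectful_def
proof (intro allI impI)
  fix x y
  assume xy: "N x = N y"
  obtain i k j i' k' j' where x: "x = (i, k, j)" and y: "y = (i', k', j')" by (metis surj_pair)
  note xy = xy[unfolded x y]
  have 1: "int q dvd int i - int i'" by (rule N_eq_imp_dvd[OF xy])
  have 2: "int q dvd int k - int k'" "int q dvd int j - int j'"
    and 3: "int Q dvd (int i - int i') - (int j - int j') + int \<sigma> * (int k - int k')"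
    using xy unfolding N_eq_iff by blast+
  have 4: "int Q dvd int (b ^ k) - int (b ^ k')" by (rule power_diff_dvd[OF 2(1)])
  have 5: "int Q dvd (int (qnum b i) - int (qnum b i')) - (int i - int i') + int \<sigma> * (int i - int i')"
    by (rule qnum_diff[OF 1])
  have "int q dvd (int k - int k') + (int i - int i')" using 1 2 by simp
  moreover have "int q dvd (int j - int j') + int (Q - 1) * (int (b ^ k) - int (b ^ k'))"
    using 2(2) dvd_trans[OF int_q_dvd_Q 4] by simp
  moreover have "int Q dvd ((int i - int i') - (int j - int j') + int \<sigma> * (int k - int k'))
    + ((int (qnum b i) - int (qnum b i')) - (int i - int i') + int \<sigma> * (int i - int i'))
    - int (Q - 1) * (int (b ^ k) - int (b ^ k'))"
    by (rule dvd_diff[OF dvd_add[OF 3 5] dvd_mult[OF 4]])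
  moreover have "int (k + i) - int (k' + i') = (int k - int k') + (int i - int i')" by simp
  moreover have "int (j + (Q - 1) * b ^ k) - int (j' + (Q - 1) * b ^ k')
      = (int j - int j') + int (Q - 1) * (int (b ^ k) - int (b ^ k'))"
    unfolding of_nat_add of_nat_mult right_diff_distrib by (simp only: diff_diff_eq diff_diff_eq2 add_diff_eq diff_add_eq add_ac)
  moreover have "((int i - int i') - (int j - int j') + int \<sigma> * (int k - int k'))
    + ((int (qnum b i) - int (qnum b i')) - (int i - int i') + int \<sigma> * (int i - int i'))
    - int (Q - 1) * (int (b ^ k) - int (b ^ k'))
    = (int (qnum b i) - int (qnum b i')) - ((int j - int j') + int (Q - 1) * (int (b ^ k) - int (b ^ k')))
      + int \<sigma> * ((int k - int k') + (int i - int i'))"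
  proof -
    have "x - y + s + (t - x + s') - z = t - (y + z) + (s + s')" for x y z s s' t :: int by simp
    then show ?thesis unfolding distrib_left[of "int \<sigma>"] by blast
  qed
  ultimately show "N (mD x) = N (mD y)"
    unfolding x y mD_def prod.case N_eq_iff by (simp only: simp_thms)
qed

lemma mA_pow: "(mA ^^ n) (i, k, j) = (i + n, k, j)"
  by (induction n) (simp_all add: mA_def)

lemma mC_pow: "(mC ^^ n) (i, k, j) = (b ^ n * i, k + n, j)"
  by (induction n) (simp_all add: mC_def)

lemma qiter_add: "qiter b i (s + t) = qiter b (qiter b i s) t"
  by (simp add: qiter_def add.commute[of s] funpow_add)

lemma qiter_sum_Suc: "qiter_sum b i (Suc t) = qiter_sum b i t + qiter b i t"
  by (simp add: qiter_sum_def)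

lemma qiter_psum_Suc: "qiter_psum b i (Suc t) = qiter_psum b i t + b ^ qiter_sum b i t"
  by (simp add: qiter_psum_def)

lemma qiter_sum_0 [simp]: "qiter_sum b i 0 = 0" and qiter_psum_0 [simp]: "qiter_psum b i 0 = 0"
  by (simp_all add: qiter_sum_def qiter_psum_def)

lemma qiter_sum_add: "qiter_sum b i (s + t) = qiter_sum b i s + qiter_sum b (qiter b i s) t"
  by (induction t) (simp_all add: qiter_sum_Suc qiter_add)

lemma qiter_psum_add:
  "qiter_psum b i (s + t) = qiter_psum b i s + b ^ qiter_sum b i s * qiter_psum b (qiter b i s) t"
  by (induction t) (simp_all add: qiter_psum_Suc qiter_sum_add[of i s] power_add distrib_left mult.assoc)

lemma mD_pow: "(mD ^^ n) (i, k, j) = (qiter b i n, k + qiter_sum b i n, j + (Q - 1) * (b ^ k * qiter_psum b i n))"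
  by (induction n) (simp_all add: mD_def qiter_Suc qiter_sum_Suc qiter_psum_Suc power_add algebra_simps)

text \<open>[y + n] - [y] = b^y [n], where b^y = 1 modulo p and [n] = n modulo p^(a+1): the map x ->
  [x] has slope 1 modulo p.\<close>

lemma qnum_cong_step:
  assumes "[x = y] (mod p ^ a)"
  shows "int p ^ Suc a dvd (int (qnum b x) - int (qnum b y)) - (int x - int y)"
proof -
  have *: "int p ^ Suc a dvd (int (qnum b x) - int (qnum b y)) - (int x - int y)"
    if "[x = y] (mod p ^ a)" "y \<le> x" for x y
  proof -
    define n where "n = x - y"
    have x: "x = y + n" using that(2) by (simp add: n_def)
    have n: "p ^ a dvd n" using that(1) unfolding n_def by (simp add: cong_altdef_nat that(2))
    obtain s where s: "int (qnum b n) = int n + int p ^ Suc a * s"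
      using qnum_weak[OF n] by (rule dvd_diffE)
    have "(p::nat) dvd e" using m by (simp add: e_def dvd_power)
    then have "p * p ^ a dvd e * n" using n by (rule mult_dvd_mono)
    then have "int p ^ Suc a dvd int e * int n" by (metis of_nat_dvd_iff of_nat_mult of_nat_power power_Suc)
    moreover have "(int (qnum b x) - int (qnum b y)) - (int x - int y)
        = int (b ^ y) * int p ^ Suc a * s + int e * int n * int (qnum b y)"
    proof -
      have pow_y: "int (b ^ y) = 1 + int e * int (qnum b y)"
        unfolding b_def power_eq_qnum by simp
      show ?thesis unfolding x qnum_add of_nat_add of_nat_mult[of "b ^ y"] s pow_y
        by (simp only: distrib_left distrib_right diff_add_eq add_diff_cancel_left' mult_1_left mult_ac add_ac)
    qed
    ultimately show ?thesis by simp
  qed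
  show ?thesis
  proof (cases "y \<le> x")
    case False
    have "int p ^ Suc a dvd (int (qnum b y) - int (qnum b x)) - (int y - int x)"
      using * False cong_sym[OF assms] by simp
    then have "int p ^ Suc a dvd - ((int (qnum b y) - int (qnum b x)) - (int y - int x))"
      by (simp only: dvd_minus_iff)
    then show ?thesis by (simp add: algebra_simps)
  qed (use * assms in blast)
qed

lemma qiter_cong_step:
  assumes "[x = y] (mod p ^ a)"
  shows "int p ^ Suc a dvd (int (qiter b x t) - int (qiter b y t)) - (int x - int y)"
proof (induction t)
  case (Suc t)
  have "int p ^ a dvd (int (qiter b x t) - int (qiter b y t)) - (int x - int y)"
    using Suc by (rule dvd_trans[rotated]) simp
  moreover have "int p ^ a dvd int x - int y"
    using assms by (simp add: cong_iff_dvd_diff flip: cong_int_iff)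
  ultimately have "int p ^ a dvd int (qiter b x t) - int (qiter b y t)"
    by (metis dvd_diff_left_iff)
  then have "[qiter b x t = qiter b y t] (mod p ^ a)"
    by (simp add: cong_iff_dvd_diff flip: cong_int_iff)
  show ?case
  proof -
    have eq: "x - y + (y - z) = x - z" for x y z :: int by simp
    show ?thesis
      using dvd_add[OF qnum_cong_step[OF \<open>[qiter b x t = qiter b y t] (mod p ^ a)\<close>] Suc]
      unfolding qiter_Suc eq .
  qed
qed simp

text \<open>Modulo p the map x -> [x] is the identity. If p^a iterations move x by d, a multiple of
  p^(a+1), then by \<open>qiter_cong_step\<close> each further block of p^a iterations moves it by d
  again modulo p^(a+2); p blocks move it by p d, which is 0 there.\<close>

lemma qiter_ppow: "[qiter b x (p ^ a) = x] (mod p ^ Suc a)"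
proof (induction a arbitrary: x)
  case 0
  have "int p ^ Suc 0 dvd (int (qnum b x) - int (qnum b 0)) - (int x - int 0)"
    by (rule qnum_cong_step) simp
  then show ?case by (simp add: qiter_Suc cong_iff_dvd_diff flip: cong_int_iff)
next
  case (Suc a)
  define n where "n = p ^ a"
  define d where "d = int (qiter b x n) - int x"
  have IH: "[qiter b x n = x] (mod p ^ Suc a)" for x using Suc by (simp add: n_def)
  have "int p ^ Suc (Suc a) dvd int (qiter b x (s * n)) - int x - int s * d \<and> [qiter b x (s * n) = x] (mod p ^ Suc a)" for s
  proof (induction s)
    case (Suc s)
    have g: "qiter b x (Suc s * n) = qiter b (qiter b x (s * n)) n"
      by (simp add: add.commute flip: qiter_add)
    have "int p ^ Suc (Suc a) dvd (int (qiter b (qiter b x (s * n)) n) - int (qiter b x n)) - (int (qiter b x (s * n)) - int x)"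
      by (rule qiter_cong_step) (use Suc in blast)
    then have "int p ^ Suc (Suc a) dvd ((int (qiter b (qiter b x (s * n)) n) - int (qiter b x n)) - (int (qiter b x (s * n)) - int x))
       + (int (qiter b x (s * n)) - int x - int s * d)"
      using Suc by (intro dvd_add) blast+
    then have 1: "int p ^ Suc (Suc a) dvd int (qiter b x (Suc s * n)) - int x - int (Suc s) * d"
      unfolding g d_def by (simp add: algebra_simps)
    have "[qiter b x (Suc s * n) = x] (mod p ^ Suc a)"
      unfolding g using IH[of "qiter b x (s * n)"] Suc cong_trans by blast
    with 1 show ?case by blast
  qed simp
  from this[of p] have 1: "int p ^ Suc (Suc a) dvd int (qiter b x (p * n)) - int x - int p * d" by blast
  have "int p ^ Suc a dvd d" using IH[of x] by (simp add: d_def cong_iff_dvd_diff flip: cong_int_iff)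
  then have "int p ^ Suc (Suc a) dvd int p * d" by simp
  with 1 have "int p ^ Suc (Suc a) dvd int (qiter b x (p * n)) - int x"
    by (metis dvd_diff_left_iff)
  then show ?case by (simp add: n_def cong_iff_dvd_diff flip: cong_int_iff)
qed

lemma power_cong_exp: "[x = y] (mod Q) \<Longrightarrow> [b ^ x = b ^ y] (mod Q)"
  using power_diff_dvd[of x y] dvd_trans[OF int_q_dvd_Q]
  by (simp add: cong_iff_dvd_diff flip: cong_int_iff)

lemma qiter_cong: "[x = y] (mod Q) \<Longrightarrow> [qiter b x t = qiter b y t] (mod Q)"
  using dvd_trans[OF _ qiter_cong_step[of x y "v + m" t], of "int Q"] unfolding Q_def
  by (simp add: cong_iff_dvd_diff flip: cong_int_iff) (metis dvd_diff_left_iff dvd_triv_right)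

lemma qiter_sum_cong: "[x = y] (mod Q) \<Longrightarrow> [qiter_sum b x t = qiter_sum b y t] (mod Q)"
  unfolding qiter_sum_def by (intro cong_sum qiter_cong)

lemma qiter_psum_cong: "[x = y] (mod Q) \<Longrightarrow> [qiter_psum b x t = qiter_psum b y t] (mod Q)"
  unfolding qiter_psum_def by (intro cong_sum power_cong_exp qiter_sum_cong)

text \<open>n iterations fix the exponent of A modulo Q. From then on blocks of n add equal amounts
  to the exponent of C, so Q blocks add 0, and in the same way Q of these larger blocks add 0 to the
  exponent of B. That the resulting period is a power of p is what makes \<open>macdonald_p\<close>
  applicable to the model.\<close>

lemma mD_order: "\<exists>L. \<forall>x. N ((mD ^^ (p ^ L)) x) = N x"
proof -
  define n where "n = p ^ (v + m)"
  have i: "[qiter b x n = x] (mod Q)" for x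
    unfolding n_def Q_def using qiter_ppow[of x "v + m"] cong_dvd_modulus_nat[of _ _ "p ^ Suc (v + m)"] by simp
  have ni: "[qiter b x (r * n) = x] (mod Q)" for r x
  proof (induction r)
    case (Suc r)
    have "qiter b x (Suc r * n) = qiter b (qiter b x (r * n)) n"
      by (simp add: add.commute flip: qiter_add)
    then show ?case using i[of "qiter b x (r * n)"] Suc cong_trans by metis
  qed simp
  have s: "[qiter_sum b x (r * n) = r * qiter_sum b x n] (mod Q)" for r x
  proof (induction r)
    case (Suc r)
    have "[qiter_sum b x n + qiter_sum b (qiter b x n) (r * n) = qiter_sum b x n + qiter_sum b x (r * n)] (mod Q)"
      by (intro cong_add qiter_sum_cong i) simp
    also have "[qiter_sum b x n + qiter_sum b x (r * n) = qiter_sum b x n + r * qiter_sum b x n] (mod Q)"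
      by (intro cong_add cong_refl Suc)
    finally show ?case by (simp add: qiter_sum_add)
  qed simp
  have s0: "[qiter_sum b x (Q * n) = 0] (mod Q)" for x
    using s[of x Q] by (simp add: cong_def)
  have ps: "[qiter_psum b x (r * (Q * n)) = r * qiter_psum b x (Q * n)] (mod Q)" for r x
  proof (induction r)
    case (Suc r)
    have "[b ^ qiter_sum b x (Q * n) = b ^ 0] (mod Q)" by (intro power_cong_exp s0)
    then have "[qiter_psum b x (Q * n) + b ^ qiter_sum b x (Q * n) * qiter_psum b (qiter b x (Q * n)) (r * (Q * n))
        = qiter_psum b x (Q * n) + b ^ 0 * qiter_psum b x (r * (Q * n))] (mod Q)"
      by (intro cong_add cong_mult qiter_psum_cong ni) simp
    also have "[qiter_psum b x (Q * n) + b ^ 0 * qiter_psum b x (r * (Q * n))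
        = qiter_psum b x (Q * n) + b ^ 0 * (r * qiter_psum b x (Q * n))] (mod Q)"
      by (intro cong_add cong_mult cong_refl Suc)
    finally show ?case by (simp add: qiter_psum_add)
  qed simp
  define M where "M = Q * (Q * n)"
  have "N ((mD ^^ M) x) = N x" for x
  proof -
    obtain i k j where x: "x = (i, k, j)" by (metis surj_pair)
    have 1: "int Q dvd int (qiter b i M) - int i"
      using ni[of i "Q * Q"] by (simp add: M_def mult.assoc cong_iff_dvd_diff flip: cong_int_iff)
    have 2: "int Q dvd int (qiter_sum b i M)"
      using s[of i "Q * Q"] by (simp add: M_def mult.assoc cong_def mod_eq_0_iff_dvd)
    have 3: "int Q dvd int (qiter_psum b i M)"
      using ps[of i Q] by (simp add: M_def cong_def mod_eq_0_iff_dvd)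
    show ?thesis unfolding x mD_pow N_eq_iff
      using 1 2 3 dvd_trans[OF int_q_dvd_Q 2] dvd_trans[OF int_q_dvd_Q 3] by (auto intro!: dvd_add dvd_diff)
  qed
  moreover have "M = p ^ ((v + m) + (v + m) + (v + m))"
    by (simp add: M_def Q_def n_def power_add)
  ultimately show ?thesis by metis
qed

text \<open>Of the three relations this is the one that need not hold on triples and is true only
  after reduction by \<open>N\<close>; \<open>mDA\<close> and \<open>mCA\<close> below are
  identities of formulas.\<close>

lemma model_relation: "N ((mD \<circ> mC) x) = N ((mC \<circ> mD ^^ b) x)"
proof -
  obtain i k j where x: "x = (i, k, j)" by (metis surj_pair)
  define U where "U = int (qiter_psum b i b) - int b"
  have U: "int q dvd U" using rel2 by (simp add: U_def q_def)
  have S: "int q dvd int (b * i) - int (qiter_sum b i b)"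
    using rel1 by (simp add: q_def dvd_diff_commute)
  have bk: "int (b ^ k) = 1 + int e * int (qnum b k)"
    unfolding b_def power_eq_qnum by simp
  have eU: "int Q dvd int e * U" by (rule Q_dvd_e_times[OF U])
  have r: "int Q dvd int (qnum b (b * i)) - int (b * qiter b i b) - U + int \<sigma> * (int (b * i) - int (qiter_sum b i b))"
    using rel3 by (simp add: Q_def U_def)
  have "int Q dvd (int (qnum b (b * i)) - int (b * qiter b i b) - U + int \<sigma> * (int (b * i) - int (qiter_sum b i b)))
     - int e * U * int (qnum b k) + int Q * (int (b ^ k) * U)"
    by (rule dvd_add[OF dvd_diff[OF r dvd_mult2[OF eU]] dvd_triv_left])
  then have 3: "int Q dvd int (qnum b (b * i)) - int (b * qiter b i b) + (int Q - 1) * (int (b ^ k) * U)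
     + int \<sigma> * (int (b * i) - int (qiter_sum b i b))"
    unfolding bk by (simp add: algebra_simps)
  have j: "int (j + (Q - 1) * b ^ Suc k) - int (j + (Q - 1) * (b ^ k * qiter_psum b i b)) = - ((int Q - 1) * (int (b ^ k) * U))"
    unfolding of_nat_add of_nat_mult int_Q1 power_Suc U_def by (simp add: algebra_simps)
  have l: "(mD \<circ> mC) x = (qnum b (b * i), Suc k + b * i, j + (Q - 1) * b ^ Suc k)"
    unfolding x comp_apply mC_def mD_def by simp
  have r: "(mC \<circ> mD ^^ b) x = (b * qiter b i b, Suc (k + qiter_sum b i b), j + (Q - 1) * (b ^ k * qiter_psum b i b))"
    unfolding x comp_apply mD_pow mC_def by simp
  have k: "int (Suc k + b * i) - int (Suc (k + qiter_sum b i b)) = int (b * i) - int (qiter_sum b i b)"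
    by simp
  have "int q dvd - ((int Q - 1) * (int (b ^ k) * U))"
    using U by (simp only: dvd_minus_iff dvd_mult)
  moreover have "int (qnum b (b * i)) - int (b * qiter b i b) - - ((int Q - 1) * (int (b ^ k) * U)) =
    int (qnum b (b * i)) - int (b * qiter b i b) + (int Q - 1) * (int (b ^ k) * U)" by simp
  ultimately show ?thesis unfolding l r N_eq_iff j k using S 3 by (simp only: simp_thms)
qed

lemma mDA: "mD \<circ> mA = mA \<circ> mC \<circ> mD"
  by (rule ext) (auto simp: mD_def mA_def mC_def qnum_Suc')

lemma mCA: "mC \<circ> mA = mA ^^ b \<circ> mC"
proof (rule ext)
  fix x :: "nat \<times> nat \<times> nat"
  obtain i k j where x: "x = (i, k, j)" by (metis surj_pair)
  have "(mC \<circ> mA) x = (b * Suc i, Suc k, j)" by (simp add: x mA_def mC_def)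
  moreover have "(mA ^^ b \<circ> mC) x = (b * i + b, Suc k, j)"
    unfolding x comp_apply mC_def by (simp add: mA_pow)
  ultimately show "(mC \<circ> mA) x = (mA ^^ b \<circ> mC) x" by simp
qed

end

section \<open>The group generated by the induced permutations\<close>

lemma BijGroup_apply:
  assumes "g \<in> carrier (BijGroup S)" "h \<in> carrier (BijGroup S)" "x \<in> S"
  shows "(g \<otimes>\<^bsub>BijGroup S\<^esub> h) x = g (h x)"
  using assms by (simp add: BijGroup_def compose_def)

context macdonald_model
begin

definition M :: "(nat \<times> nat \<times> nat \<Rightarrow> nat \<times> nat \<times> nat) monoid" where
  "M = BijGroup (range N)"

lemma group_M: "group M"
  unfolding M_def by (rule group_BijGroup)

sublocale M: group M by (rule group_M)

lemma mA_order: "N ((mA ^^ Q) x) = N x"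
proof -
  obtain i k j where x: "x = (i, k, j)" by (metis surj_pair)
  show ?thesis unfolding x mA_pow N_eq_iff by simp
qed

lemma mC_order: "N ((mC ^^ Q) x) = N x"
proof -
  obtain i k j where x: "x = (i, k, j)" by (metis surj_pair)
  have "int Q dvd int (b ^ Q) - int (b ^ 0)" by (rule power_diff_dvd) (simp add: q_dvd_Q)
  then have "int Q dvd (int (b ^ Q) - int (b ^ 0)) * int i + int Q * int \<sigma>" by (intro dvd_add) auto
  also have "(int (b ^ Q) - int (b ^ 0)) * int i + int Q * int \<sigma>
      = (int (b ^ Q * i) - int i) - (int j - int j) + int \<sigma> * (int (k + Q) - int k)"
    by (simp add: algebra_simps)
  finally show ?thesis unfolding x mC_pow N_eq_iff using q_dvd_Q by simp
qed

definition a where "a = hat mA"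

definition c where "c = hat mC"

definition d where "d = hat mD"

lemma hat_in_Bij: "hat mA \<in> Bij (range N)" "hat mC \<in> Bij (range N)" "hat mD \<in> Bij (range N)"
proof -
  show "hat mA \<in> Bij (range N)" by (rule hat_Bij[OF respectful_mA Q_pos mA_order])
  show "hat mC \<in> Bij (range N)" by (rule hat_Bij[OF respectful_mC Q_pos mC_order])
  obtain L where "N ((mD ^^ (p ^ L)) x) = N x" for x using mD_order by blast
  then show "hat mD \<in> Bij (range N)"
    using p_pos by (intro hat_Bij[OF respectful_mD, where n = "p ^ L"]) simp_all
qed

lemma acd_closed [simp]: "a \<in> carrier M" "c \<in> carrier M" "d \<in> carrier M"
  using hat_in_Bij by (simp_all add: a_def c_def d_def M_def hat_carrier)

lemma acd_pow:
  "a [^]\<^bsub>M\<^esub> (n::nat) = hat (mA ^^ n)" "c [^]\<^bsub>M\<^esub> n = hat (mC ^^ n)" "d [^]\<^bsub>M\<^esub> n = hat (mD ^^ n)"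
  unfolding a_def c_def d_def M_def
  using hat_pow[OF respectful_mA hat_in_Bij(1)] hat_pow[OF respectful_mC hat_in_Bij(2)]
    hat_pow[OF respectful_mD hat_in_Bij(3)] by blast+

lemma hat_eq_oneI: "respectful f \<Longrightarrow> (\<And>x. N (f x) = N x) \<Longrightarrow> hat f = \<one>\<^bsub>M\<^esub>"
  unfolding M_def hat_one by (subst hat_eq_iff) (auto simp: respectful_def)

lemma a_Q: "a [^]\<^bsub>M\<^esub> Q = \<one>\<^bsub>M\<^esub>"
  unfolding acd_pow by (intro hat_eq_oneI respectful_funpow respectful_mA mA_order)

lemma d_order: "\<exists>L. d [^]\<^bsub>M\<^esub> (p ^ L) = \<one>\<^bsub>M\<^esub>"
proof -
  obtain L where L: "N ((mD ^^ (p ^ L)) x) = N x" for x using mD_order by blast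
  have "d [^]\<^bsub>M\<^esub> (p ^ L) = \<one>\<^bsub>M\<^esub>"
    unfolding acd_pow by (intro hat_eq_oneI respectful_funpow respectful_mD L)
  then show ?thesis by blast
qed

lemma hat_mult_M:
  assumes "respectful f" "respectful g" "hat f \<in> carrier M" "hat g \<in> carrier M"
  shows "hat f \<otimes>\<^bsub>M\<^esub> hat g = hat (f \<circ> g)"
  using assms unfolding M_def by (intro hat_mult) (simp_all add: hat_carrier)

lemma hat_pow_closed: "hat (mA ^^ n) \<in> carrier M" "hat (mD ^^ n) \<in> carrier M"
  using M.nat_pow_closed[OF acd_closed(1), of n] M.nat_pow_closed[OF acd_closed(3), of n]
  by (simp_all add: acd_pow)

lemma relation_ca: "c \<otimes>\<^bsub>M\<^esub> a = a [^]\<^bsub>M\<^esub> b \<otimes>\<^bsub>M\<^esub> c"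
proof -
  have "c \<otimes>\<^bsub>M\<^esub> a = hat (mC \<circ> mA)"
    using acd_closed unfolding a_def c_def by (intro hat_mult_M respectful_mA respectful_mC)
  also have "\<dots> = hat (mA ^^ b) \<otimes>\<^bsub>M\<^esub> hat mC"
    unfolding mCA using acd_closed hat_pow_closed unfolding c_def
    by (intro hat_mult_M[symmetric] respectful_funpow respectful_mA respectful_mC)
  finally show ?thesis by (simp add: acd_pow c_def)
qed

lemma relation_da: "d \<otimes>\<^bsub>M\<^esub> a = a \<otimes>\<^bsub>M\<^esub> c \<otimes>\<^bsub>M\<^esub> d"
proof -
  have ac: "a \<otimes>\<^bsub>M\<^esub> c = hat (mA \<circ> mC)"
    using acd_closed unfolding a_def c_def by (intro hat_mult_M respectful_mA respectful_mC)
  have ac': "hat (mA \<circ> mC) \<in> carrier M" using M.m_closed[OF acd_closed(1,2)] by (simp add: ac)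
  have "d \<otimes>\<^bsub>M\<^esub> a = hat (mD \<circ> mA)"
    using acd_closed unfolding a_def d_def by (intro hat_mult_M respectful_mA respectful_mD)
  also have "\<dots> = hat (mA \<circ> mC) \<otimes>\<^bsub>M\<^esub> hat mD"
    unfolding mDA using acd_closed ac' unfolding d_def
    by (intro hat_mult_M[symmetric] respectful_comp respectful_mA respectful_mC respectful_mD)
  finally show ?thesis by (simp add: ac d_def)
qed

lemma relation_dc: "d \<otimes>\<^bsub>M\<^esub> c = c \<otimes>\<^bsub>M\<^esub> d [^]\<^bsub>M\<^esub> b"
proof -
  have "d \<otimes>\<^bsub>M\<^esub> c = hat (mD \<circ> mC)"
    using acd_closed unfolding c_def d_def by (intro hat_mult_M respectful_mD respectful_mC)
  also have "\<dots> = hat (mC \<circ> mD ^^ b)"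
    using model_relation
    by (subst hat_eq_iff) (intro respectful_comp respectful_funpow respectful_mC respectful_mD | blast)+
  also have "\<dots> = hat mC \<otimes>\<^bsub>M\<^esub> hat (mD ^^ b)"
    using acd_closed hat_pow_closed unfolding c_def
    by (intro hat_mult_M[symmetric] respectful_funpow respectful_mC respectful_mD)
  finally show ?thesis by (simp add: acd_pow c_def)
qed

lemma model_macdonald: "macdonald M a (inv\<^bsub>M\<^esub> d) c b"
proof
  show "a \<in> carrier M" "inv\<^bsub>M\<^esub> d \<in> carrier M" "c \<in> carrier M" by simp_all
  show "c \<otimes>\<^bsub>M\<^esub> a = a [^]\<^bsub>M\<^esub> b \<otimes>\<^bsub>M\<^esub> c" by (rule relation_ca)
  have "d \<otimes>\<^bsub>M\<^esub> (inv\<^bsub>M\<^esub> d \<otimes>\<^bsub>M\<^esub> c) = d \<otimes>\<^bsub>M\<^esub> c \<otimes>\<^bsub>M\<^esub> inv\<^bsub>M\<^esub> (d [^]\<^bsub>M\<^esub> b)"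
    by (simp add: relation_dc M.m_assoc flip: M.m_assoc[of d "inv\<^bsub>M\<^esub> d" c])
  then have "d \<otimes>\<^bsub>M\<^esub> (inv\<^bsub>M\<^esub> d \<otimes>\<^bsub>M\<^esub> c) = d \<otimes>\<^bsub>M\<^esub> (c \<otimes>\<^bsub>M\<^esub> inv\<^bsub>M\<^esub> (d [^]\<^bsub>M\<^esub> b))"
    by (simp add: M.m_assoc)
  then show "inv\<^bsub>M\<^esub> d \<otimes>\<^bsub>M\<^esub> c = c \<otimes>\<^bsub>M\<^esub> inv\<^bsub>M\<^esub> d [^]\<^bsub>M\<^esub> b"
    by (simp add: M.nat_pow_inv)
  have "d \<otimes>\<^bsub>M\<^esub> (a \<otimes>\<^bsub>M\<^esub> inv\<^bsub>M\<^esub> d) = a \<otimes>\<^bsub>M\<^esub> c"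
    by (simp add: relation_da M.m_assoc flip: M.m_assoc[of d a])
  also have "\<dots> = d \<otimes>\<^bsub>M\<^esub> (inv\<^bsub>M\<^esub> d \<otimes>\<^bsub>M\<^esub> (a \<otimes>\<^bsub>M\<^esub> c))"
    by (simp flip: M.m_assoc[of d "inv\<^bsub>M\<^esub> d"])
  finally show "a \<otimes>\<^bsub>M\<^esub> inv\<^bsub>M\<^esub> d = inv\<^bsub>M\<^esub> d \<otimes>\<^bsub>M\<^esub> a \<otimes>\<^bsub>M\<^esub> c"
    by (simp add: M.m_assoc)
qed

text \<open>The model becomes an instance of the abstract situation, so \<open>generate_AB\<close>
  and \<open>elt_nf\<close> bound from above the subgroup generated by its A and B.\<close>

lemma model_macdonald_p: "\<exists>K. macdonald_p p m u M a (inv\<^bsub>M\<^esub> d) c K v \<sigma>"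
proof -
  obtain L where L: "d [^]\<^bsub>M\<^esub> (p ^ L) = \<one>\<^bsub>M\<^esub>" using d_order by blast
  have "a [^]\<^bsub>M\<^esub> (p ^ (v + m + L)) = \<one>\<^bsub>M\<^esub>"
    using M.pow_mult_one[OF acd_closed(1) a_Q, of "p ^ L"] by (simp add: Q_def power_add)
  moreover have "inv\<^bsub>M\<^esub> d [^]\<^bsub>M\<^esub> (p ^ (v + m + L)) = \<one>\<^bsub>M\<^esub>"
    using M.pow_mult_one[OF acd_closed(3) L, of "p ^ (v + m)"]
    by (simp add: M.nat_pow_inv power_add mult.commute)
  ultimately have "macdonald_p p m u M a (inv\<^bsub>M\<^esub> d) c (v + m + L) v \<sigma>"
    by (intro macdonald_p.intro macdonald_p_axioms.intro model_macdonald padic_base_axioms key qnum_q)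
  then show ?thesis by blast
qed

lemma apply_M: "g \<in> carrier M \<Longrightarrow> h \<in> carrier M \<Longrightarrow> (g \<otimes>\<^bsub>M\<^esub> h) (N x) = g (h (N x))"
  unfolding M_def by (rule BijGroup_apply) auto

text \<open>The triple (0, 0, 0) stands for the identity, so evaluation there recovers the exponents
  up to \<open>N\<close>. All uniqueness of normal forms comes from this.\<close>

lemma elt_apply:
  "(a [^]\<^bsub>M\<^esub> (i::nat) \<otimes>\<^bsub>M\<^esub> c [^]\<^bsub>M\<^esub> (k::nat) \<otimes>\<^bsub>M\<^esub> inv\<^bsub>M\<^esub> d [^]\<^bsub>M\<^esub> (j::nat)) (N (0, 0, 0)) = N (i, k, j)"
proof -
  have it: "qiter b 0 t = 0" for t by (induction t) (simp_all add: qiter_Suc)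
  have its: "qiter_sum b 0 t = 0" for t by (simp add: qiter_sum_def it)
  have ips: "qiter_psum b 0 t = t" for t by (simp add: qiter_psum_def its)
  \<comment> \<open>The inverse of d^j is found by naming a preimage: d^j sends the triple (0, 0, j)
    to the base point, because 0 is fixed by x -> [x].\<close>
  have "(d [^]\<^bsub>M\<^esub> j) (N (0, 0, j)) = N ((mD ^^ j) (0, 0, j))"
    unfolding acd_pow by (intro hat_apply respectful_funpow respectful_mD)
  also have "\<dots> = N (0, 0, 0)"
  proof -
    have "j + (Q - 1) * j = Q * j" using Q_pos by (cases Q) auto
    then show ?thesis unfolding mD_pow it its ips N_eq_iff using int_q_dvd_Q by (simp add: q_dvd_Q)
  qed
  finally have d: "(d [^]\<^bsub>M\<^esub> j) (N (0, 0, j)) = N (0, 0, 0)" .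
  have "(inv\<^bsub>M\<^esub> d [^]\<^bsub>M\<^esub> j) (N (0, 0, 0)) = (inv\<^bsub>M\<^esub> d [^]\<^bsub>M\<^esub> j \<otimes>\<^bsub>M\<^esub> d [^]\<^bsub>M\<^esub> j) (N (0, 0, j))"
    unfolding apply_M[OF M.nat_pow_closed[OF M.inv_closed[OF acd_closed(3)]] M.nat_pow_closed[OF acd_closed(3)]] d ..
  also have "inv\<^bsub>M\<^esub> d [^]\<^bsub>M\<^esub> j \<otimes>\<^bsub>M\<^esub> d [^]\<^bsub>M\<^esub> j = hat id"
    by (simp add: M.nat_pow_inv) (simp add: M_def hat_one)
  also have "hat id (N (0, 0, j)) = N (0, 0, j)"
    by (simp add: hat_id)
  finally have B: "(inv\<^bsub>M\<^esub> d [^]\<^bsub>M\<^esub> j) (N (0, 0, 0)) = N (0, 0, j)" .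
  have C: "(c [^]\<^bsub>M\<^esub> k) (N (0, 0, j)) = N (0, k, j)"
    unfolding acd_pow hat_apply[OF respectful_funpow[OF respectful_mC]] mC_pow by simp
  have A: "(a [^]\<^bsub>M\<^esub> i) (N (0, k, j)) = N (i, k, j)"
    unfolding acd_pow hat_apply[OF respectful_funpow[OF respectful_mA]] mA_pow by simp
  show ?thesis
    unfolding apply_M[OF M.m_closed[OF M.nat_pow_closed M.nat_pow_closed] M.nat_pow_closed, OF acd_closed(1,2) M.inv_closed[OF acd_closed(3)]]
      B apply_M[OF M.nat_pow_closed M.nat_pow_closed, OF acd_closed(1,2)] C A ..
qed

lemma card_range_N: "card (range N) = Q * (q * q)"
proof -
  have "range N = {..<Q} \<times> {..<q} \<times> {..<q}"
  proof (intro equalityI subsetI)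
    fix x assume "x \<in> {..<Q} \<times> {..<q} \<times> {..<q}"
    then have "x = N x" by (auto simp: nf.simps)
    then show "x \<in> range N" by (rule range_eqI)
  next
    fix x assume "x \<in> range N"
    then show "x \<in> {..<Q} \<times> {..<q} \<times> {..<q}" using Q_pos q_pos by (auto simp: nf.simps)
  qed
  then show ?thesis by (simp add: card_cartesian_product)
qed

text \<open>Normal forms exhaust the generated subgroup and are separated by the base point, so it
  has Q q^2 = p^(3v+m) elements. Being a finite p-group, it can be the target of a homomorphism from
  the Sylow subgroup J.\<close>

theorem model_exists:
  "macdonald M a (inv\<^bsub>M\<^esub> d) c b \<and> a [^]\<^bsub>M\<^esub> Q = \<one>\<^bsub>M\<^esub> \<and> inv\<^bsub>M\<^esub> d [^]\<^bsub>M\<^esub> Q = \<one>\<^bsub>M\<^esub> \<and>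
   (\<exists>L. \<forall>g \<in> generate M {a, inv\<^bsub>M\<^esub> d}. g [^]\<^bsub>M\<^esub> (p ^ L) = \<one>\<^bsub>M\<^esub>) \<and>
   (\<forall>i k j i' k' j'. a [^]\<^bsub>M\<^esub> (i::nat) \<otimes>\<^bsub>M\<^esub> c [^]\<^bsub>M\<^esub> (k::nat) \<otimes>\<^bsub>M\<^esub> inv\<^bsub>M\<^esub> d [^]\<^bsub>M\<^esub> (j::nat) =
     a [^]\<^bsub>M\<^esub> (i'::nat) \<otimes>\<^bsub>M\<^esub> c [^]\<^bsub>M\<^esub> (k'::nat) \<otimes>\<^bsub>M\<^esub> inv\<^bsub>M\<^esub> d [^]\<^bsub>M\<^esub> (j'::nat) \<longrightarrow> N (i, k, j) = N (i', k', j'))"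
proof -
  obtain K where "macdonald_p p m u M a (inv\<^bsub>M\<^esub> d) c K v \<sigma>" using model_macdonald_p by blast
  then interpret P: macdonald_p p m u M a "inv\<^bsub>M\<^esub> d" c K v \<sigma> .
  have qQ: "P.q = q" "P.Q = Q" by (simp_all add: P.q_def P.Q_def q_def Q_def)
  have faithful: "N (i, k, j) = N (i', k', j')"
    if "P.elt (i, k, j) = P.elt (i', k', j')" for i k j i' k' j'
    using that elt_apply[of i k j] elt_apply[of i' k' j'] by (simp only: P.elt_eq)
  define H where "H = generate M {a, inv\<^bsub>M\<^esub> d}"
  have "bij_betw P.elt (range N) H"
  proof (rule bij_betw_imageI)
    show "inj_on P.elt (range N)"
    proof (rule inj_onI)
      fix x y assume "x \<in> range N" "y \<in> range N" and e: "P.elt x = P.elt y"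
      then have xy: "N x = x" "N y = y" using N_idem by auto
      have "N x = N y" 
        using faithful[of "fst x" "fst (snd x)" "snd (snd x)" "fst y" "fst (snd y)" "snd (snd y)"] e
        unfolding prod.collapse by blast
      then show "x = y" unfolding xy .
    qed
    show "P.elt ` range N = H"
    proof (intro equalityI subsetI)
      fix g assume "g \<in> H"
      then obtain x where "g = P.elt x" unfolding H_def P.generate_AB by blast
      then have "g = P.elt (N x)" using P.elt_nf[of x] unfolding qQ by simp
      then show "g \<in> P.elt ` range N" by blast
    qed (auto simp: H_def P.generate_AB)
  qed
  then have "card H = Q * (q * q)" using card_range_N bij_betw_same_card by metis
  then have card: "card H = p ^ (3 * v + m)"
    by (simp add: Q_def q_def power_add numeral_3_eq_3 mult_ac)
  have sub: "subgroup H M" unfolding H_def by (rule M.generate_is_subgroup) simp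
  have "g [^]\<^bsub>M\<^esub> (p ^ (3 * v + m)) = \<one>\<^bsub>M\<^esub>" if "g \<in> H" for g
  proof -
    interpret H: group "M\<lparr>carrier := H\<rparr>" by (rule M.subgroup_imp_group[OF sub])
    have "g [^]\<^bsub>M\<lparr>carrier := H\<rparr>\<^esub> order (M\<lparr>carrier := H\<rparr>) = \<one>\<^bsub>M\<lparr>carrier := H\<rparr>\<^esub>"
      by (rule H.pow_order_eq_1) (simp add: that)
    then show ?thesis by (simp add: order_def card flip: M.nat_pow_consistent)
  qed
  then have "\<exists>L. \<forall>g \<in> generate M {a, inv\<^bsub>M\<^esub> d}. g [^]\<^bsub>M\<^esub> (p ^ L) = \<one>\<^bsub>M\<^esub>" unfolding H_def by blast
  moreover have "inv\<^bsub>M\<^esub> d [^]\<^bsub>M\<^esub> Q = \<one>\<^bsub>M\<^esub>" using P.B_pow_Q unfolding qQ .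
  ultimately show ?thesis
    using model_macdonald a_Q faithful unfolding P.elt_eq by blast
qed

end

section \<open>Homomorphisms out of presented groups\<close>

primrec word_eval :: "('a, 'b) monoid_scheme \<Rightarrow> ('g \<Rightarrow> 'a) \<Rightarrow> 'g word \<Rightarrow> 'a" where
  "word_eval P f [] = \<one>\<^bsub>P\<^esub>"
| "word_eval P f (c # w) = (if snd c then f (fst c) else inv\<^bsub>P\<^esub> f (fst c)) \<otimes>\<^bsub>P\<^esub> word_eval P f w"

text \<open>Word evaluation is constant on each class, so the image is a singleton and
  \<open>the_elem\<close> extracts the common value; see \<open>free_lift_class\<close>.\<close>

definition free_lift :: "('a, 'b) monoid_scheme \<Rightarrow> ('g \<Rightarrow> 'a) \<Rightarrow> 'g word set \<Rightarrow> 'a" where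
  "free_lift P f X = the_elem (word_eval P f ` X)"

context
  fixes P :: "('a, 'b) monoid_scheme" and f :: "'g \<Rightarrow> 'a"
  assumes P: "group P" and f: "\<And>x. f x \<in> carrier P"
begin

interpretation P: group P by (rule P)

lemma word_eval_closed: "word_eval P f w \<in> carrier P"
  by (induction w) (simp_all add: f)

lemma word_eval_append: "word_eval P f (u @ v) = word_eval P f u \<otimes>\<^bsub>P\<^esub> word_eval P f v"
  by (induction u) (simp_all add: f word_eval_closed P.m_assoc)

lemma word_eval_free_eq: "free_eq u v \<Longrightarrow> word_eval P f u = word_eval P f v"
proof (induction rule: free_eq.induct)
  case (cancel u x b v)
  have "word_eval P f [(x, b), (x, \<not> b)] = \<one>\<^bsub>P\<^esub>"
    by (simp add: f)
  then show ?case unfolding word_eval_append by (simp add: word_eval_closed)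
qed simp_all

lemma free_lift_class: "free_lift P f (free_class u) = word_eval P f u"
proof -
  have "word_eval P f ` free_class u = {word_eval P f u}"
    unfolding free_class_def using word_eval_free_eq by (auto intro: free_eq.refl)
  then show ?thesis by (simp add: free_lift_def)
qed

lemma group_hom_free_lift: "group_hom free_group P (free_lift P f)"
  by (intro group_hom.intro group_free_group P group_hom_axioms.intro homI)
    (auto simp: free_lift_class word_eval_closed word_eval_append)

lemma free_lift_gen: "free_lift P f (free_gen x) = f x"
  by (simp add: free_gen_def free_lift_class f)

end

lemma (in group_hom) hom_commutator:
  "x \<in> carrier G \<Longrightarrow> y \<in> carrier G \<Longrightarrow> h (commutator G x y) = commutator H (h x) (h y)"
  by (simp add: commutator_def)

lemma (in group_hom) hom_conjugate:
  "x \<in> carrier G \<Longrightarrow> y \<in> carrier G \<Longrightarrow> h (conjugate G x y) = conjugate H (h x) (h y)"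
  by (simp add: conjugate_def)

lemma (in group) commutator_closed [simp]:
  "x \<in> carrier G \<Longrightarrow> y \<in> carrier G \<Longrightarrow> commutator G x y \<in> carrier G"
  by (simp add: commutator_def)

lemma (in group) conjugate_closed [simp]:
  "x \<in> carrier G \<Longrightarrow> y \<in> carrier G \<Longrightarrow> conjugate G x y \<in> carrier G"
  by (simp add: conjugate_def)

theorem von_dyck:
  fixes R :: "'g word set set" and P :: "('a, 'b) monoid_scheme"
  assumes P: "group P" and f: "\<And>x. f x \<in> carrier P"
    and R: "R \<subseteq> carrier free_group" and rel: "\<And>r. r \<in> R \<Longrightarrow> free_lift P f r = \<one>\<^bsub>P\<^esub>"
  shows "\<exists>\<rho> \<in> hom (presented_group R) P. \<forall>x. \<rho> (presented_gen R x) = f x"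
proof -
  let ?F = "free_group :: 'g word set monoid"
  interpret F: group ?F by (rule group_free_group)
  interpret P: group P by (rule P)
  interpret L: group_hom ?F P "free_lift P f" by (rule group_hom_free_lift[OF P f])
  define K where "K = normal_closure ?F R"
  interpret K: normal K ?F unfolding K_def by (rule F.normal_normal_closure[OF R])
  have "K \<subseteq> kernel ?F P (free_lift P f)"
    unfolding K_def normal_closure_def
  proof (rule F.generate_subgroup_incl[OF _ L.subgroup_kernel])
    show "{conjugate ?F s g |s g. s \<in> R \<and> g \<in> carrier ?F} \<subseteq> kernel ?F P (free_lift P f)"
    proof safe
      fix s g assume s: "s \<in> R" and g: "g \<in> carrier ?F"
      have sc: "s \<in> carrier ?F" using s R by blast
      have "free_lift P f (conjugate ?F s g) = \<one>\<^bsub>P\<^esub>"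
        unfolding L.hom_conjugate[OF sc g] rel[OF s] using L.hom_closed[OF g]
        by (simp add: conjugate_def)
      then show "conjugate ?F s g \<in> kernel ?F P (free_lift P f)"
        using F.conjugate_closed[OF sc g] by (simp add: kernel_def)
    qed
  qed
  then have ker: "k \<in> carrier ?F" "free_lift P f k = \<one>\<^bsub>P\<^esub>" if "k \<in> K" for k
    using that by (auto simp: kernel_def)
  define \<rho> where "\<rho> X = the_elem (free_lift P f ` X)" for X
  have coset: "\<rho> (K #>\<^bsub>?F\<^esub> x) = free_lift P f x" if x: "x \<in> carrier ?F" for x
  proof -
    have eq: "free_lift P f (k \<otimes>\<^bsub>?F\<^esub> x) = free_lift P f x" if "k \<in> K" for k
      using ker[OF that] x L.hom_closed[OF x] by (simp del: free_group_simps)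
    have "free_lift P f ` (K #>\<^bsub>?F\<^esub> x) = (\<lambda>k. free_lift P f (k \<otimes>\<^bsub>?F\<^esub> x)) ` K"
      unfolding r_coset_def by (auto simp del: free_group_simps)
    also have "\<dots> = (\<lambda>k. free_lift P f x) ` K" using eq by (intro image_cong HOL.refl)
    also have "\<dots> = {free_lift P f x}" using K.one_closed by (intro image_constant)
    finally have "free_lift P f ` (K #>\<^bsub>?F\<^esub> x) = {free_lift P f x}" .
    then show ?thesis by (simp add: \<rho>_def)
  qed
  have "\<rho> \<in> hom (?F Mod K) P"
  proof (rule homI)
    fix X assume "X \<in> carrier (?F Mod K)"
    then obtain x where "x \<in> carrier ?F" "X = K #>\<^bsub>?F\<^esub> x"
      unfolding FactGroup_def RCOSETS_def by (auto simp del: free_group_simps)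
    then show "\<rho> X \<in> carrier P" using coset L.hom_closed by metis
  next
    fix X Y assume "X \<in> carrier (?F Mod K)" "Y \<in> carrier (?F Mod K)"
    then obtain x y where x: "x \<in> carrier ?F" "X = K #>\<^bsub>?F\<^esub> x" and y: "y \<in> carrier ?F" "Y = K #>\<^bsub>?F\<^esub> y"
      unfolding FactGroup_def RCOSETS_def by (auto simp del: free_group_simps)
    have XY: "X \<otimes>\<^bsub>?F Mod K\<^esub> Y = K #>\<^bsub>?F\<^esub> (x \<otimes>\<^bsub>?F\<^esub> y)"
      unfolding FactGroup_def x y using K.rcos_sum[OF x(1) y(1)] by simp
    show "\<rho> (X \<otimes>\<^bsub>?F Mod K\<^esub> Y) = \<rho> X \<otimes>\<^bsub>P\<^esub> \<rho> Y"
      unfolding XY coset[OF F.m_closed[OF x(1) y(1)]] L.hom_mult[OF x(1) y(1)]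
      unfolding x(2) y(2) coset[OF x(1)] coset[OF y(1)] by (rule HOL.refl)
  qed
  moreover have "\<rho> (presented_gen R x) = f x" for x
  proof -
    have g: "free_gen x \<in> carrier ?F" by (simp add: free_gen_def)
    show ?thesis
      unfolding presented_gen_def K_def[symmetric] coset[OF g] by (rule free_lift_gen[OF P f])
  qed
  ultimately show ?thesis unfolding presented_group_def K_def[symmetric] by blast
qed

lemma free_class_generate: "free_class u \<in> generate free_group (range free_gen)"
proof (induction u)
  case Nil
  then show ?case using generate.one[of free_group] by simp
next
  case (Cons c u)
  interpret F: group "free_group :: 'a word set monoid" by (rule group_free_group)
  obtain x s where c: "c = (x, s)" by fastforce
  have g: "free_class [(x, True)] \<in> generate free_group (range free_gen)"
    by (rule generate.incl) (auto simp: free_gen_def)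
  have "free_class [(x, False)] \<otimes>\<^bsub>free_group\<^esub> free_class [(x, True)] = \<one>\<^bsub>free_group\<^esub>"
    using free_eq.cancel[of "[]" x False "[]"] by (simp add: free_class_eq_iff)
  then have "inv\<^bsub>free_group\<^esub> free_class [(x, True)] = free_class [(x, False)]"
    by (intro F.inv_equality) auto
  moreover have "inv\<^bsub>free_group\<^esub> free_gen x \<in> generate free_group (range free_gen)"
    by (rule generate.inv) auto
  ultimately have "free_class [(x, False)] \<in> generate free_group (range free_gen)"
    by (simp add: free_gen_def)
  then have "free_class [(x, s)] \<in> generate free_group (range free_gen)"
    using g by (cases s) auto
  from generate.eng[OF this Cons] show ?case by (simp add: c)
qed

lemma presented_group_generate:
  assumes R: "R \<subseteq> carrier free_group"
  shows "generate (presented_group R) (range (presented_gen R)) = carrier (presented_group R)"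
proof -
  let ?F = "free_group :: 'a word set monoid"
  interpret F: group ?F by (rule group_free_group)
  interpret K: normal "normal_closure ?F R" ?F by (rule F.normal_normal_closure[OF R])
  let ?h = "\<lambda>x. normal_closure ?F R #>\<^bsub>?F\<^esub> x"
  interpret h: group_hom ?F "presented_group R" ?h
    unfolding presented_group_def
    by (intro group_hom.intro group_free_group K.factorgroup_is_group group_hom_axioms.intro K.r_coset_hom_Mod)
  have g: "range free_gen \<subseteq> carrier ?F" by (auto simp: free_gen_def)
  have "generate ?F (range free_gen) = carrier ?F"
    using free_class_generate F.generate_incl[OF g] by auto
  then have "generate (presented_group R) (?h ` range free_gen) = ?h ` carrier ?F"
    using h.generate_img[OF g] by metis
  also have "?h ` carrier ?F = carrier (presented_group R)"
    unfolding presented_group_def FactGroup_def RCOSETS_def by (auto simp del: free_group_simps)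
  finally show ?thesis by (simp add: image_image presented_gen_def[abs_def])
qed

section \<open>The Macdonald group and its Sylow subgroups\<close>

definition macdonald_relations :: "('a, 'b) monoid_scheme \<Rightarrow> int \<Rightarrow> 'a \<Rightarrow> 'a \<Rightarrow> bool" where
  "macdonald_relations P \<alpha> a b \<longleftrightarrow>
    conjugate P a (commutator P a b) = a [^]\<^bsub>P\<^esub> \<alpha> \<and> conjugate P b (commutator P b a) = b [^]\<^bsub>P\<^esub> \<alpha>"

lemma (in group_hom) macdonald_relations_hom:
  assumes "a \<in> carrier G" "b \<in> carrier G" "macdonald_relations G \<alpha> a b"
  shows "macdonald_relations H \<alpha> (h a) (h b)"
proof -
  have "h (conjugate G a (commutator G a b)) = h (a [^] \<alpha>)" "h (conjugate G b (commutator G b a)) = h (b [^] \<alpha>)"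
    using assms(3) by (simp_all add: macdonald_relations_def)
  then show ?thesis
    using assms(1,2) by (simp add: macdonald_relations_def hom_conjugate hom_commutator hom_int_pow)
qed

lemma macdonald_von_dyck:
  assumes P: "group P" and a: "a \<in> carrier P" and b: "b \<in> carrier P"
    and rel: "macdonald_relations P \<alpha> a b"
  shows "\<exists>\<rho> \<in> hom (macdonald_group \<alpha>) P. \<rho> (macdonald_gen \<alpha> GenA) = a \<and> \<rho> (macdonald_gen \<alpha> GenB) = b"
proof -
  define f where "f x = (case x of GenA \<Rightarrow> a | GenB \<Rightarrow> b)" for x
  have f: "f x \<in> carrier P" for x using a b by (cases x) (auto simp: f_def)
  interpret P: group P by (rule P)
  let ?F = "free_group :: gen word set monoid"
  interpret F: group ?F by (rule group_free_group)
  interpret L: group_hom ?F P "free_lift P f" by (rule group_hom_free_lift[OF P f])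
  have g: "free_gen x \<in> carrier ?F" for x by (simp add: free_gen_def)
  have l: "free_lift P f (free_gen GenA) = a" "free_lift P f (free_gen GenB) = b"
    by (simp_all add: free_lift_gen[OF P f] f_def)
  have "free_lift P f r = \<one>\<^bsub>P\<^esub>" if "r \<in> macdonald_relators \<alpha>" for r
  proof -
    from that consider
      "r = conjugate ?F (free_gen GenA) (commutator ?F (free_gen GenA) (free_gen GenB)) \<otimes>\<^bsub>?F\<^esub> inv\<^bsub>?F\<^esub> (free_gen GenA [^]\<^bsub>?F\<^esub> \<alpha>)"
      | "r = conjugate ?F (free_gen GenB) (commutator ?F (free_gen GenB) (free_gen GenA)) \<otimes>\<^bsub>?F\<^esub> inv\<^bsub>?F\<^esub> (free_gen GenB [^]\<^bsub>?F\<^esub> \<alpha>)"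
      by (auto simp: macdonald_relators_def Let_def)
    then show ?thesis
    proof cases
      case 1
      then have "free_lift P f r = conjugate P a (commutator P a b) \<otimes>\<^bsub>P\<^esub> inv\<^bsub>P\<^esub> (a [^]\<^bsub>P\<^esub> \<alpha>)"
        using g by (simp add: L.hom_conjugate L.hom_commutator L.hom_int_pow l del: free_group_simps)
      then show ?thesis using rel a b by (simp add: macdonald_relations_def P.r_inv)
    next
      case 2
      then have "free_lift P f r = conjugate P b (commutator P b a) \<otimes>\<^bsub>P\<^esub> inv\<^bsub>P\<^esub> (b [^]\<^bsub>P\<^esub> \<alpha>)"
        using g by (simp add: L.hom_conjugate L.hom_commutator L.hom_int_pow l del: free_group_simps)
      then show ?thesis using rel a b by (simp add: macdonald_relations_def P.r_inv)
    qed
  qed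
  from von_dyck[of P f, OF P f macdonald_relators_subset[of \<alpha>] this] obtain \<rho> where
    "\<rho> \<in> hom (presented_group (macdonald_relators \<alpha>)) P"
    "\<rho> (presented_gen (macdonald_relators \<alpha>) x) = f x" for x by blast
  then show ?thesis unfolding macdonald_group_def macdonald_gen_def
    by (intro bexI[of _ \<rho>]) (simp_all add: f_def)
qed

lemma macdonald_group_facts:
  shows "macdonald_gen \<alpha> x \<in> carrier (macdonald_group \<alpha>)"
    and "macdonald_relations (macdonald_group \<alpha>) \<alpha> (macdonald_gen \<alpha> GenA) (macdonald_gen \<alpha> GenB)"
    and "generate (macdonald_group \<alpha>) {macdonald_gen \<alpha> GenA, macdonald_gen \<alpha> GenB} = carrier (macdonald_group \<alpha>)"
proof -
  let ?F = "free_group :: gen word set monoid"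
  define R where "R = macdonald_relators \<alpha>"
  have R: "R \<subseteq> carrier ?F" unfolding R_def by (rule macdonald_relators_subset)
  interpret F: group ?F by (rule group_free_group)
  define K where "K = normal_closure ?F R"
  interpret K: normal K ?F unfolding K_def by (rule F.normal_normal_closure[OF R])
  have Gdef: "macdonald_group \<alpha> = ?F Mod K"
    by (simp add: macdonald_group_def presented_group_def K_def R_def)
  interpret h: group_hom ?F "macdonald_group \<alpha>" "\<lambda>x. K #>\<^bsub>?F\<^esub> x"
    unfolding Gdef
    by (intro group_hom.intro group_free_group K.factorgroup_is_group group_hom_axioms.intro K.r_coset_hom_Mod)
  have g: "free_gen x \<in> carrier ?F" for x by (simp add: free_gen_def)
  have gen: "macdonald_gen \<alpha> x = K #>\<^bsub>?F\<^esub> free_gen x" for x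
    by (simp add: macdonald_gen_def presented_gen_def K_def R_def)
  show gc: "macdonald_gen \<alpha> x \<in> carrier (macdonald_group \<alpha>)" for x
    unfolding gen by (rule h.hom_closed[OF g])
  have eq: "K #>\<^bsub>?F\<^esub> x = K #>\<^bsub>?F\<^esub> y" if "x \<otimes>\<^bsub>?F\<^esub> inv\<^bsub>?F\<^esub> y \<in> R" "x \<in> carrier ?F" "y \<in> carrier ?F" for x y
  proof -
    have "conjugate ?F (x \<otimes>\<^bsub>?F\<^esub> inv\<^bsub>?F\<^esub> y) \<one>\<^bsub>?F\<^esub> = x \<otimes>\<^bsub>?F\<^esub> inv\<^bsub>?F\<^esub> y"
      using that(2,3) by (simp add: conjugate_def del: free_group_simps)
    then have "x \<otimes>\<^bsub>?F\<^esub> inv\<^bsub>?F\<^esub> y \<in> K"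
      using that(1) F.one_closed unfolding K_def normal_closure_def
      by (intro generate.incl) (metis (mono_tags, lifting) mem_Collect_eq)
    then have "K #>\<^bsub>?F\<^esub> (x \<otimes>\<^bsub>?F\<^esub> inv\<^bsub>?F\<^esub> y) = K"
      by (rule F.coset_join2[OF F.m_closed[OF that(2) F.inv_closed[OF that(3)]] K.is_subgroup])
    then have "(K #>\<^bsub>?F\<^esub> x) \<otimes>\<^bsub>macdonald_group \<alpha>\<^esub> inv\<^bsub>macdonald_group \<alpha>\<^esub> (K #>\<^bsub>?F\<^esub> y) = \<one>\<^bsub>macdonald_group \<alpha>\<^esub>"
      using that(2,3) h.hom_mult[of x "inv\<^bsub>?F\<^esub> y"] h.hom_inv[of y] h.hom_one
      by (simp add: Gdef FactGroup_def del: free_group_simps)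
    then show ?thesis using that(2,3) h.hom_closed h.H.inv_equality h.H.inv_inv h.H.inv_closed by metis
  qed
  let ?a = "free_gen GenA :: gen word set" and ?b = "free_gen GenB :: gen word set"
  have "K #>\<^bsub>?F\<^esub> conjugate ?F ?a (commutator ?F ?a ?b) = K #>\<^bsub>?F\<^esub> (?a [^]\<^bsub>?F\<^esub> \<alpha>)"
    by (rule eq) (use g in \<open>auto simp: R_def macdonald_relators_def Let_def simp del: free_group_simps\<close>)
  moreover have "K #>\<^bsub>?F\<^esub> conjugate ?F ?b (commutator ?F ?b ?a) = K #>\<^bsub>?F\<^esub> (?b [^]\<^bsub>?F\<^esub> \<alpha>)"
    by (rule eq) (use g in \<open>auto simp: R_def macdonald_relators_def Let_def simp del: free_group_simps\<close>)
  ultimately show "macdonald_relations (macdonald_group \<alpha>) \<alpha> (macdonald_gen \<alpha> GenA) (macdonald_gen \<alpha> GenB)"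
    using g by (simp add: macdonald_relations_def gen h.hom_conjugate h.hom_commutator h.hom_int_pow
        flip: h.hom_conjugate h.hom_commutator h.hom_int_pow del: free_group_simps)
  have UNIV_gen: "(UNIV :: gen set) = {GenA, GenB}" using gen.exhaust by blast
  have "range (macdonald_gen \<alpha>) = {macdonald_gen \<alpha> GenA, macdonald_gen \<alpha> GenB}"
    unfolding UNIV_gen by (simp only: image_insert image_empty)
  then show "generate (macdonald_group \<alpha>) {macdonald_gen \<alpha> GenA, macdonald_gen \<alpha> GenB} = carrier (macdonald_group \<alpha>)"
    using presented_group_generate[OF R] by (simp add: macdonald_group_def macdonald_gen_def[abs_def] R_def)
qed

lemma (in group) eq_one_of_coprime_pow:
  assumes "x \<in> carrier G" "x [^] (n::nat) = \<one>" "x [^] (k::nat) = \<one>" "coprime n k"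
  shows "x = \<one>"
proof -
  have "ord x dvd n" "ord x dvd k" using assms by (simp_all add: pow_eq_id)
  then have "ord x = 1" using assms(4) by (metis coprime_def nat_dvd_1_iff_1)
  then show ?thesis using pow_ord_eq_1[OF assms(1)] assms(1) by simp
qed

text \<open>The Sylow subgroup is the largest quotient in which every element has \<open>p\<close>-power order.
  The order of an infinite group being \<open>0\<close>, a set \<open>Q\<close> with \<open>sylow_subgroup G q Q\<close> is finite in
  any case, so its elements have order a power of \<open>q\<close>.\<close>

lemma macdonald_sylow_facts:
  fixes \<alpha> :: int and \<pi> :: "gen word set set \<Rightarrow> gen word set set" and J :: "gen word set set set"
  defines "G \<equiv> macdonald_group \<alpha>"
  defines "T \<equiv> G\<lparr>carrier := J\<rparr>" and "A \<equiv> \<pi> (macdonald_gen \<alpha> GenA)" and "B \<equiv> \<pi> (macdonald_gen \<alpha> GenB)"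
  assumes p: "prime p" and J: "sylow_subgroup G p J" and \<pi>: "sylow_projection G p J \<pi>"
  shows "group T" and "A \<in> carrier T" and "B \<in> carrier T" and "generate T {A, B} = carrier T"
    and "macdonald_relations T \<alpha> A B" and "\<exists>n. order T = p ^ n"
    and "\<And>P :: ('a, 'b) monoid_scheme. \<And>a b L. group P \<Longrightarrow> a \<in> carrier P \<Longrightarrow> b \<in> carrier P \<Longrightarrow> macdonald_relations P \<alpha> a b \<Longrightarrow>
      (\<And>g. g \<in> generate P {a, b} \<Longrightarrow> g [^]\<^bsub>P\<^esub> (p ^ L) = \<one>\<^bsub>P\<^esub>) \<Longrightarrow> \<exists>\<phi> \<in> hom T P. \<phi> A = a \<and> \<phi> B = b"
proof -
  interpret G: group G unfolding G_def by (rule group_macdonald_group)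
  have sub: "subgroup J G" using J by (simp add: sylow_subgroup_def)
  interpret T: group T unfolding T_def by (rule G.subgroup_imp_group[OF sub])
  show "group T" ..
  have hom: "\<pi> \<in> hom G T" and fixed: "x \<in> J \<Longrightarrow> \<pi> x = x"
    and ker: "kernel G T \<pi> = generate G (\<Union>{Q. \<exists>q. prime q \<and> q \<noteq> p \<and> sylow_subgroup G q Q})" for x
    using \<pi> by (auto simp: sylow_projection_def T_def)
  interpret \<pi>: group_hom G T \<pi> by (intro group_hom.intro G.is_group T.is_group group_hom_axioms.intro hom)
  define A' where "A' = macdonald_gen \<alpha> GenA"
  define B' where "B' = macdonald_gen \<alpha> GenB"
  have AB': "A' \<in> carrier G" "B' \<in> carrier G"
    unfolding A'_def B'_def G_def by (rule macdonald_group_facts)+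
  have A: "A = \<pi> A'" and B: "B = \<pi> B'" by (simp_all add: A_def B_def A'_def B'_def)
  show AT: "A \<in> carrier T" "B \<in> carrier T" using AB' by (simp_all add: A B)
  have gen: "generate G {A', B'} = carrier G"
    unfolding A'_def B'_def G_def by (rule macdonald_group_facts)
  have JG: "J \<subseteq> carrier G" using sub by (rule subgroup.subset)
  have "\<pi> ` carrier G = carrier T"
  proof
    show "carrier T \<subseteq> \<pi> ` carrier G" using fixed JG by (force simp: T_def)
  qed auto
  then show "generate T {A, B} = carrier T"
    using \<pi>.generate_img[of "{A', B'}"] AB' gen by (simp add: A B)
  show "macdonald_relations T \<alpha> A B"
    unfolding A B using AB' by (rule \<pi>.macdonald_relations_hom) (simp add: A'_def B'_def G_def macdonald_group_facts)
  show "\<exists>n. order T = p ^ n" using J by (auto simp: sylow_subgroup_def T_def order_def)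
  fix P :: "('a, 'b) monoid_scheme" and a b L
  assume P: "group P" and ab: "a \<in> carrier P" "b \<in> carrier P" and rel: "macdonald_relations P \<alpha> a b"
    and tor: "\<And>g. g \<in> generate P {a, b} \<Longrightarrow> g [^]\<^bsub>P\<^esub> (p ^ L) = \<one>\<^bsub>P\<^esub>"
  interpret P: group P by (rule P)
  obtain \<rho> where \<rho>: "\<rho> \<in> hom G P" "\<rho> A' = a" "\<rho> B' = b"
    using macdonald_von_dyck[OF P ab rel] unfolding G_def A'_def B'_def by blast
  interpret \<rho>: group_hom G P \<rho> by (intro group_hom.intro G.is_group P group_hom_axioms.intro \<rho>)
  have img: "\<rho> x \<in> generate P {a, b}" if "x \<in> carrier G" for x
    using \<rho>.generate_img[of "{A', B'}"] AB' gen that by (auto simp: \<rho>)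
  \<comment> \<open>The image of an element of another Sylow subgroup has order dividing a power of
    q and a power of p, hence is trivial.\<close>
  have "kernel G T \<pi> \<subseteq> kernel G P \<rho>"
    unfolding ker
  proof (rule G.generate_subgroup_incl[OF _ \<rho>.subgroup_kernel], safe)
    fix Q q x
    assume q: "prime q" "q \<noteq> p" and Q: "sylow_subgroup G q Q" and x: "x \<in> Q"
    have sQ: "subgroup Q G" and cQ: "card Q = q ^ multiplicity q (order G)"
      using Q by (auto simp: sylow_subgroup_def)
    interpret Q: group "G\<lparr>carrier := Q\<rparr>" by (rule G.subgroup_imp_group[OF sQ])
    have xG: "x \<in> carrier G" using subgroup.subset[OF sQ] x by blast
    have "x [^]\<^bsub>G\<lparr>carrier := Q\<rparr>\<^esub> order (G\<lparr>carrier := Q\<rparr>) = \<one>\<^bsub>G\<lparr>carrier := Q\<rparr>\<^esub>"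
      by (rule Q.pow_order_eq_1) (simp add: x)
    then have "x [^]\<^bsub>G\<^esub> (q ^ multiplicity q (order G)) = \<one>\<^bsub>G\<^esub>"
      by (simp add: order_def cQ flip: G.nat_pow_consistent)
    then have 1: "\<rho> x [^]\<^bsub>P\<^esub> (q ^ multiplicity q (order G)) = \<one>\<^bsub>P\<^esub>"
      unfolding \<rho>.hom_nat_pow[OF xG, symmetric] by simp
    have 2: "\<rho> x [^]\<^bsub>P\<^esub> (p ^ L) = \<one>\<^bsub>P\<^esub>" by (rule tor[OF img[OF xG]])
    have 3: "coprime (q ^ multiplicity q (order G)) (p ^ L)"
      using q p by (simp add: primes_coprime)
    have "\<rho> x = \<one>\<^bsub>P\<^esub>" by (rule P.eq_one_of_coprime_pow[OF \<rho>.hom_closed[OF xG] 1 2 3])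
    then show "x \<in> kernel G P \<rho>" using xG by (simp add: kernel_def)
  qed
  \<comment> \<open>As \<pi> fixes J, the quotient of x by \<pi> x lies in the kernel of \<pi>,
    which \<rho> kills. So \<rho> factors through \<pi>, and its restriction to J is the
    homomorphism sought.\<close>
  then have kk: "\<rho> (\<pi> x) = \<rho> x" if x: "x \<in> carrier G" for x
  proof -
    have px: "\<pi> x \<in> carrier G" "\<pi> x \<in> J" using \<pi>.hom_closed[OF x] JG by (auto simp: T_def)
    have ix: "inv\<^bsub>G\<^esub> (\<pi> x) \<in> J" using sub px(2) by (simp add: subgroup.m_inv_closed)
    have "\<pi> (inv\<^bsub>G\<^esub> (\<pi> x) \<otimes>\<^bsub>G\<^esub> x) = inv\<^bsub>G\<^esub> (\<pi> x) \<otimes>\<^bsub>T\<^esub> \<pi> x"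
      using \<pi>.hom_mult[of "inv\<^bsub>G\<^esub> (\<pi> x)" x] px x fixed[OF ix] by simp
    also have "\<dots> = \<one>\<^bsub>T\<^esub>" using px by (simp add: T_def)
    finally have "inv\<^bsub>G\<^esub> (\<pi> x) \<otimes>\<^bsub>G\<^esub> x \<in> kernel G T \<pi>" using px x by (simp add: kernel_def)
    then have "\<rho> (inv\<^bsub>G\<^esub> (\<pi> x) \<otimes>\<^bsub>G\<^esub> x) = \<one>\<^bsub>P\<^esub>" using \<open>kernel G T \<pi> \<subseteq> kernel G P \<rho>\<close> by (auto simp: kernel_def)
    then have "inv\<^bsub>P\<^esub> (\<rho> (\<pi> x)) \<otimes>\<^bsub>P\<^esub> \<rho> x = \<one>\<^bsub>P\<^esub>" using px x by simp
    then have "\<rho> x = \<rho> (\<pi> x) \<otimes>\<^bsub>P\<^esub> \<one>\<^bsub>P\<^esub>"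
      using px x by (subst P.inv_solve_left'[symmetric]) auto
    then show ?thesis using px by simp
  qed
  have "\<rho> \<in> hom T P" unfolding T_def using JG by (intro homI) (auto simp: subset_iff)
  moreover have "\<rho> A = a" "\<rho> B = b" using kk AB' \<rho> by (simp_all add: A B)
  ultimately show "\<exists>\<phi> \<in> hom T P. \<phi> A = a \<and> \<phi> B = b" by blast
qed

section \<open>Central series\<close>

lemma (in group) normal_center: "center G \<lhd> G"
proof (intro normal_invI subgroupI)
  show "center G \<noteq> {}" using one_closed by (auto simp: center_def)
next
  fix x assume x: "x \<in> center G"
  have "inv x \<otimes> y = y \<otimes> inv x" if y: "y \<in> carrier G" for y
  proof -
    have "x \<otimes> inv y = inv y \<otimes> x" "x \<in> carrier G" using x y by (auto simp: center_def)
    then have "inv (x \<otimes> inv y) = inv (inv y \<otimes> x)" by simp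
    then show ?thesis using y \<open>x \<in> carrier G\<close> by (simp add: inv_mult_group)
  qed
  then show "inv x \<in> center G" using x by (simp add: center_def)
next
  fix x y assume x: "x \<in> center G" and y: "y \<in> center G"
  have c: "x \<in> carrier G" "y \<in> carrier G" using x y by (auto simp: center_def)
  have "x \<otimes> y \<otimes> z = z \<otimes> (x \<otimes> y)" if z: "z \<in> carrier G" for z
  proof -
    have xz: "x \<otimes> z = z \<otimes> x" and yz: "y \<otimes> z = z \<otimes> y" using x y z by (auto simp: center_def)
    have "x \<otimes> y \<otimes> z = (x \<otimes> z) \<otimes> y" using c z yz by (simp add: m_assoc)
    also have "\<dots> = z \<otimes> (x \<otimes> y)" unfolding xz using c z by (simp add: m_assoc)
    finally show ?thesis .
  qed
  then show "x \<otimes> y \<in> center G" using c by (simp add: center_def)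
next
  fix x h assume x: "x \<in> carrier G" and h: "h \<in> center G"
  then have "x \<otimes> h \<otimes> inv x = h" by (auto simp: center_def m_assoc) (metis inv_closed m_assoc r_inv r_one)
  then show "x \<otimes> h \<otimes> inv x \<in> center G" using h by simp
qed (auto simp: center_def)

lemma (in group) commutes_inv:
  assumes x: "x \<in> carrier G" and y: "y \<in> carrier G" and xy: "x \<otimes> y = y \<otimes> x"
  shows "x \<otimes> inv y = inv y \<otimes> x"
proof -
  have "inv y \<otimes> x = inv y \<otimes> ((x \<otimes> y) \<otimes> inv y)" using x y by (simp add: m_assoc)
  also have "\<dots> = x \<otimes> inv y" unfolding xy using x y by (simp flip: m_assoc)
  finally show ?thesis by simp
qed

lemma (in group_hom) normal_preimage:
  assumes "N \<lhd> H"
  shows "{x \<in> carrier G. h x \<in> N} \<lhd> G"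
proof -
  interpret N: normal N H by (rule assms)
  show ?thesis
    by (intro G.normal_invI G.subgroupI) (auto simp: N.m_closed N.m_inv_closed N.inv_op_closed2 intro: exI[of _ "\<one>\<^bsub>G\<^esub>"])
qed

context normal
begin

lemma group_hom_Mod: "group_hom G (G Mod H) (\<lambda>x. H #> x)"
  by (intro group_hom.intro is_group factorgroup_is_group group_hom_axioms.intro r_coset_hom_Mod)

sublocale Mod: group_hom G "G Mod H" "\<lambda>x. H #> x" by (rule group_hom_Mod)

lemma Mod_eq_one_iff: "x \<in> carrier G \<Longrightarrow> H #> x = \<one>\<^bsub>G Mod H\<^esub> \<longleftrightarrow> x \<in> H"
  using coset_join1 coset_join2 is_subgroup subset by (metis one_FactGroup rcos_const rcos_self)

lemma commutator_mem_iff: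
  assumes x: "x \<in> carrier G" and y: "y \<in> carrier G"
  shows "commutator G x y \<in> H \<longleftrightarrow> (H #> x) \<otimes>\<^bsub>G Mod H\<^esub> (H #> y) = (H #> y) \<otimes>\<^bsub>G Mod H\<^esub> (H #> x)"
proof -
  have "commutator G x y = inv (y \<otimes> x) \<otimes> (x \<otimes> y)"
    using x y by (simp add: commutator_def inv_mult_group m_assoc)
  then have "commutator G x y \<in> H \<longleftrightarrow> H #> (inv (y \<otimes> x) \<otimes> (x \<otimes> y)) = \<one>\<^bsub>G Mod H\<^esub>"
    using x y by (metis Mod_eq_one_iff inv_closed m_closed)
  also have "\<dots> \<longleftrightarrow> inv\<^bsub>G Mod H\<^esub> (H #> (y \<otimes> x)) \<otimes>\<^bsub>G Mod H\<^esub> (H #> (x \<otimes> y)) = \<one>\<^bsub>G Mod H\<^esub>"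
  proof -
    have c: "inv (y \<otimes> x) \<in> carrier G" "x \<otimes> y \<in> carrier G" "y \<otimes> x \<in> carrier G" using x y by auto
    show ?thesis unfolding Mod.hom_mult[OF c(1,2)] Mod.hom_inv[OF c(3)] by (rule HOL.refl)
  qed
  also have "\<dots> \<longleftrightarrow> H #> (x \<otimes> y) = H #> (y \<otimes> x)"
    using Mod.H.inv_solve_left'[of "H #> (y \<otimes> x)" "\<one>\<^bsub>G Mod H\<^esub>" "H #> (x \<otimes> y)"]
      Mod.hom_closed[of "x \<otimes> y"] Mod.hom_closed[of "y \<otimes> x"] x y
    by (metis Mod.H.inv_closed Mod.H.inv_equality Mod.H.inv_inv Mod.H.l_inv m_closed)
  finally show ?thesis using x y Mod.hom_mult by metis
qed

lemma commutator_mem_sym: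
  assumes "x \<in> carrier G" "y \<in> carrier G"
  shows "commutator G x y \<in> H \<longleftrightarrow> commutator G y x \<in> H"
  using commutator_mem_iff assms by metis

text \<open>Argued in the quotient by H, where the condition becomes commuting with a fixed element
  and is therefore closed under products and inverses.\<close>

lemma commutator_mem_generate:
  assumes x: "x \<in> carrier G" and S: "S \<subseteq> carrier G" and y: "y \<in> generate G S"
    and c: "\<And>s. s \<in> S \<Longrightarrow> commutator G x s \<in> H"
  shows "commutator G x y \<in> H"
proof -
  define X where "X = H #> x"
  have X: "X \<in> carrier (G Mod H)" unfolding X_def using x by simp
  have "X \<otimes>\<^bsub>G Mod H\<^esub> (H #> y) = (H #> y) \<otimes>\<^bsub>G Mod H\<^esub> X"
    using y
  proof (induction rule: generate.induct)
    case one
    show ?case unfolding Mod.hom_one using X Mod.H.r_one Mod.H.l_one by metis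
  next
    case (incl s)
    then show ?case using c commutator_mem_iff x S unfolding X_def by blast
  next
    case (inv s)
    have s: "s \<in> carrier G" "H #> s \<in> carrier (G Mod H)" using inv S by auto
    have eq: "X \<otimes>\<^bsub>G Mod H\<^esub> (H #> s) = (H #> s) \<otimes>\<^bsub>G Mod H\<^esub> X"
      using inv c commutator_mem_iff x S unfolding X_def by blast
    show ?case unfolding Mod.hom_inv[OF s(1)] using Mod.H.commutes_inv[OF X s(2) eq] .
  next
    case (eng h1 h2)
    have h: "h1 \<in> carrier G" "h2 \<in> carrier G" using eng generate_in_carrier[OF S] by auto
    then have hc: "H #> h1 \<in> carrier (G Mod H)" "H #> h2 \<in> carrier (G Mod H)" by auto
    have "X \<otimes>\<^bsub>G Mod H\<^esub> ((H #> h1) \<otimes>\<^bsub>G Mod H\<^esub> (H #> h2)) = ((H #> h1) \<otimes>\<^bsub>G Mod H\<^esub> (H #> h2)) \<otimes>\<^bsub>G Mod H\<^esub> X"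
      using eng.IH X hc by (metis Mod.H.m_assoc)
    then show ?case using Mod.hom_mult[OF h] by simp
  qed
  then show ?thesis
    unfolding X_def using commutator_mem_iff[OF x] generate_in_carrier[OF S y] by blast
qed

end

context group
begin

lemma upper_central_normal: "upper_central G i \<lhd> G"
proof (induction i)
  case 0
  then show ?case by (simp add: one_is_normal)
next
  case (Suc i)
  interpret Z: normal "upper_central G i" G by (rule Suc)
  show ?case
    unfolding upper_central.simps by (rule Z.Mod.normal_preimage[OF Z.Mod.H.normal_center])
qed

text \<open>With this description the upper central series is handled through commutators alone,
  without the quotients of its definition.\<close>

lemma upper_central_Suc_iff:
  "x \<in> upper_central G (Suc i) \<longleftrightarrow>
    x \<in> carrier G \<and> (\<forall>y \<in> carrier G. commutator G x y \<in> upper_central G i)"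
proof -
  interpret Z: normal "upper_central G i" G by (rule upper_central_normal)
  have "carrier (G Mod upper_central G i) = (\<lambda>y. upper_central G i #> y) ` carrier G"
    by (auto simp: FactGroup_def RCOSETS_def)
  then show ?thesis using Z.commutator_mem_iff by (auto simp: center_def)
qed

lemma upper_central_Suc_generate_iff:
  assumes S: "S \<subseteq> carrier G" and gen: "generate G S = carrier G"
  shows "x \<in> upper_central G (Suc i) \<longleftrightarrow> x \<in> carrier G \<and> (\<forall>s \<in> S. commutator G x s \<in> upper_central G i)"
proof -
  interpret Z: normal "upper_central G i" G by (rule upper_central_normal)
  show ?thesis
    unfolding upper_central_Suc_iff using S gen Z.commutator_mem_generate[OF _ S] by blast
qed

lemma lower_central_subgroup: "subgroup (lower_central G (Suc i)) G"
proof (induction i)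
  case (Suc i)
  have "{commutator G x y |x y. x \<in> carrier G \<and> y \<in> lower_central G (Suc i)} \<subseteq> carrier G"
    using subgroup.subset[OF Suc] by auto
  then show ?case unfolding lower_central.simps by (rule generate_is_subgroup)
qed (simp add: subgroup_self)

lemma inv_commutator:
  "x \<in> carrier G \<Longrightarrow> y \<in> carrier G \<Longrightarrow> inv (commutator G x y) = commutator G y x"
  by (simp add: commutator_def inv_mult_group m_assoc)

lemma commutator_in_lower_central:
  assumes "x \<in> carrier G" "y \<in> lower_central G (Suc i)"
  shows "commutator G x y \<in> lower_central G (Suc (Suc i))" "commutator G y x \<in> lower_central G (Suc (Suc i))"
proof -
  show 1: "commutator G x y \<in> lower_central G (Suc (Suc i))"
    unfolding lower_central.simps using assms by (intro generate.incl) blast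
  have "y \<in> carrier G" using assms(2) subgroup.subset[OF lower_central_subgroup] by blast
  then show "commutator G y x \<in> lower_central G (Suc (Suc i))"
    using 1 assms(1) subgroup.m_inv_closed[OF lower_central_subgroup 1] by (simp add: inv_commutator)
qed

text \<open>N being normal, it suffices to test generators in both arguments: if the images of U and
  S commute in the quotient by N, so do the subgroups they generate.\<close>

lemma lower_central_Suc_le:
  assumes N: "N \<lhd> G" and S: "S \<subseteq> carrier G" and gen: "generate G S = carrier G"
    and U: "U \<subseteq> carrier G" and low: "lower_central G (Suc i) \<subseteq> generate G U"
    and c: "\<And>w s. w \<in> U \<Longrightarrow> s \<in> S \<Longrightarrow> commutator G w s \<in> N"
  shows "lower_central G (Suc (Suc i)) \<subseteq> N"
proof -
  interpret N: normal N G by (rule N)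
  have 1: "commutator G x w \<in> N" if "w \<in> U" "x \<in> carrier G" for w x
    using N.commutator_mem_generate[of w S x] that U S gen c N.commutator_mem_sym by blast
  have "commutator G x y \<in> N" if "x \<in> carrier G" "y \<in> lower_central G (Suc i)" for x y
    using N.commutator_mem_generate[of x U y] that U low 1 by blast
  then show ?thesis
    unfolding lower_central.simps by (intro generate_subgroup_incl N.is_subgroup) auto
qed

lemma lower_central_le_upper_central:
  assumes "lower_central G (Suc i) \<subseteq> upper_central G (Suc s)"
  shows "lower_central G (Suc (Suc i)) \<subseteq> upper_central G s"
proof -
  interpret Z: normal "upper_central G s" G by (rule upper_central_normal)
  have "commutator G x y \<in> upper_central G s" if "x \<in> carrier G" "y \<in> lower_central G (Suc i)" for x y
  proof -
    have "y \<in> upper_central G (Suc s)" using assms that by blast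
    then have "y \<in> carrier G" "commutator G y x \<in> upper_central G s"
      using that(1) unfolding upper_central_Suc_iff by blast+
    then show ?thesis using Z.commutator_mem_sym that(1) by blast
  qed
  then show ?thesis
    unfolding lower_central.simps by (intro generate_subgroup_incl Z.is_subgroup) auto
qed

text \<open>Conjugating w by s gives w [w, s], so conjugation by S maps the subgroup into itself.
  Conjugation by the inverse of s is an iterate of conjugation by s thanks to
  \<open>fin\<close>.\<close>

lemma normal_generate_commutators:
  assumes S: "S \<subseteq> carrier G" and gen: "generate G S = carrier G"
    and fin: "\<And>s. s \<in> S \<Longrightarrow> \<exists>n::nat. inv s = s [^] n"
    and U: "U \<subseteq> carrier G" and c: "\<And>w s. w \<in> U \<Longrightarrow> s \<in> S \<Longrightarrow> commutator G w s \<in> generate G U"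
  shows "generate G U \<lhd> G"
proof -
  have sub: "subgroup (generate G U) G" by (rule generate_is_subgroup[OF U])
  note gc = generate_in_carrier[OF U]
  have conj: "inv s \<otimes> h \<otimes> s \<in> generate G U" if s: "s \<in> S" and h: "h \<in> generate G U" for s h
    using h
  proof (induction rule: generate.induct)
    case one
    then show ?case using s S generate.one[of G U] by (auto simp: subset_iff)
  next
    case (incl w)
    have "inv s \<otimes> w \<otimes> s = w \<otimes> commutator G w s"
      using incl s S U by (auto simp: commutator_def subset_iff m_assoc[symmetric])
    then show ?case using subgroup.m_closed[OF sub generate.incl[OF incl] c[OF incl s]] by simp
  next
    case (inv w)
    have w: "w \<in> carrier G" and sc: "s \<in> carrier G" using inv s S U by auto
    have "inv s \<otimes> inv w \<otimes> s = inv (w \<otimes> commutator G w s)"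
      using w sc by (simp add: commutator_def inv_mult_group m_assoc)
    then show ?case
      using subgroup.m_inv_closed[OF sub subgroup.m_closed[OF sub generate.incl[OF inv] c[OF inv s]]] by simp
  next
    case (eng h1 h2)
    have "h1 \<in> carrier G" "h2 \<in> carrier G" "s \<in> carrier G" using eng gc s S by auto
    then have "inv s \<otimes> (h1 \<otimes> h2) \<otimes> s = (inv s \<otimes> h1 \<otimes> s) \<otimes> (inv s \<otimes> h2 \<otimes> s)"
      by (simp add: m_assoc flip: m_assoc[of s "inv s"])
    then show ?case using subgroup.m_closed[OF sub eng.IH] by simp
  qed
  have conjn: "inv (s [^] n) \<otimes> h \<otimes> s [^] n \<in> generate G U"
    if s: "s \<in> S" and h: "h \<in> generate G U" for s h and n :: nat
  proof (induction n)
    case 0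
    then show ?case using h gc by simp
  next
    case (Suc n)
    have "s \<in> carrier G" "h \<in> carrier G" using s h S gc by auto
    then have "inv (s [^] Suc n) \<otimes> h \<otimes> s [^] Suc n = inv s \<otimes> (inv (s [^] n) \<otimes> h \<otimes> s [^] n) \<otimes> s"
      by (simp add: inv_mult_group m_assoc)
    then show ?case using conj[OF s Suc] by simp
  qed
  have all: "g \<otimes> h \<otimes> inv g \<in> generate G U" if g: "g \<in> generate G S" and h: "h \<in> generate G U" for g h
    using g h
  proof (induction arbitrary: h rule: generate.induct)
    case one
    then show ?case using gc by simp
  next
    case (incl s)
    obtain n :: nat where n: "inv s = s [^] n" using fin incl by blast
    have sc: "s \<in> carrier G" using incl S by auto
    have "inv (s [^] n) = s" unfolding n[symmetric] using sc by simp
    then show ?case using conjn[OF incl(1) incl(2), of n] n by simp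
  next
    case (inv s)
    then show ?case using conj[OF inv(1,2)] S by (auto simp: subset_iff)
  next
    case (eng h1 h2)
    have "h1 \<in> carrier G" "h2 \<in> carrier G" "h \<in> carrier G"
      using eng generate_in_carrier[OF S] gc by auto
    then have "h1 \<otimes> h2 \<otimes> h \<otimes> inv (h1 \<otimes> h2) = h1 \<otimes> (h2 \<otimes> h \<otimes> inv h2) \<otimes> inv h1"
      by (simp add: inv_mult_group m_assoc)
    then show ?case using eng by simp
  qed
  show ?thesis using all gen by (intro normal_invI sub) auto
qed

end

section \<open>Central series in terms of normal forms\<close>

lemma (in normal) conj_mem_iff:
  assumes "x \<in> carrier G" "h \<in> carrier G"
  shows "inv h \<otimes> x \<otimes> h \<in> H \<longleftrightarrow> x \<in> H"
proof
  assume "inv h \<otimes> x \<otimes> h \<in> H"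
  then have "h \<otimes> (inv h \<otimes> x \<otimes> h) \<otimes> inv h \<in> H" using assms(2) by (rule inv_op_closed2[rotated])
  also have "h \<otimes> (inv h \<otimes> x \<otimes> h) \<otimes> inv h = x"
    using assms by (simp add: m_assoc) (simp flip: m_assoc)
  finally show "x \<in> H" .
next
  assume "x \<in> H"
  then show "inv h \<otimes> x \<otimes> h \<in> H" using assms by (intro inv_op_closed1)
qed

lemma (in group) inv_mult_cancel_left:
  "x \<in> carrier G \<Longrightarrow> y \<in> carrier G \<Longrightarrow> inv x \<otimes> (x \<otimes> y) = y"
  by (simp flip: m_assoc)

lemma (in group) commutator_pow_self:
  assumes x: "x \<in> carrier G"
  shows "commutator G (x [^] (n::nat)) x = \<one>"
proof -
  have "commutator G (x [^] n) x = inv (x [^] n) \<otimes> (inv x \<otimes> (x [^] n \<otimes> x))"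
    using x by (simp add: commutator_def m_assoc del: nat_pow_Suc)
  also have "x [^] n \<otimes> x = x \<otimes> x [^] n"
    using nat_pow_Suc2[OF x, of n] by simp
  finally show ?thesis using x by (simp flip: m_assoc)
qed

lemma (in group) generate_insert_absorb:
  assumes "S \<subseteq> carrier G" "y \<in> generate G S"
  shows "generate G (insert y S) = generate G S"
proof
  have "insert y S \<subseteq> generate G S" using assms(2) by (auto intro: generate.incl)
  then show "generate G (insert y S) \<subseteq> generate G S"
    by (intro generate_subgroup_incl generate_is_subgroup assms)
qed (intro mono_generate, auto)

lemma (in group) subgroup_pow_closed:
  "subgroup H G \<Longrightarrow> x \<in> H \<Longrightarrow> x [^] (n::nat) \<in> H"
  by (induction n) (auto simp: subgroup.one_closed subgroup.m_closed)

lemma (in group) pow_dvd_mem: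
  assumes "subgroup H G" "x \<in> carrier G" "x [^] (d::nat) \<in> H" "d dvd n"
  shows "x [^] n \<in> H"
proof -
  obtain k where "n = d * k" using assms(4) by blast
  then show ?thesis using subgroup_pow_closed[OF assms(1,3), of k] assms(2) by (simp add: nat_pow_pow)
qed

text \<open>Here n = p^a c with c prime to p, and c is invertible modulo p^M, which kills x.\<close>

lemma (in group) pow_unit_mem:
  assumes H: "subgroup H G" and x: "x \<in> carrier G" and 1: "x [^] (p ^ M) = \<one>"
    and p: "prime (p :: nat)" and a: "x [^] (n::nat) \<in> H" and n: "p ^ a dvd n" "\<not> p ^ Suc a dvd n"
  shows "x [^] (p ^ a) \<in> H"
proof -
  obtain c where c: "n = p ^ a * c" using n(1) by blast
  have "\<not> p dvd c"
  proof
    assume "p dvd c"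
    then have "p ^ a * p dvd n" unfolding c by (intro mult_dvd_mono) auto
    then show False using n(2) by (simp add: mult.commute)
  qed
  then have "coprime c (p ^ M)" using p by (metis coprime_commute coprime_power_right_iff prime_imp_coprime)
  then obtain d where "[c * d = 1] (mod p ^ M)" using cong_solve_coprime_nat by (metis One_nat_def)
  then have "[p ^ a * (c * d) = p ^ a * 1] (mod p ^ M)" by (rule cong_scalar_left)
  then have "[n * d = p ^ a] (mod p ^ M)" by (simp add: c mult.assoc)
  from pow_eq_of_cong[OF x 1 this] have "x [^] (p ^ a) = (x [^] n) [^] d" using x by (simp add: nat_pow_pow)
  then show ?thesis using subgroup_pow_closed[OF H a] by simp
qed

context padic_base
begin

lemma dvd_power_iff': "p ^ a dvd b ^ n - 1 \<longleftrightarrow> p ^ (a - m) dvd n"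
proof (cases "a \<le> m")
  case True
  have "p ^ a dvd p ^ (m + 0)" using True by (simp add: le_imp_power_dvd)
  moreover have "p ^ (m + 0) dvd b ^ n - 1" unfolding dvd_power_iff by simp
  ultimately have "p ^ a dvd b ^ n - 1" by (rule dvd_trans)
  then show ?thesis using True by simp
next
  case False
  then show ?thesis using dvd_power_iff[of "a - m" n] by simp
qed

lemma b_pos: "b > 0"
  by (simp add: b_def)

lemma qnum_eq_add: "qnum b n = n + (qnum b n - n)"
  using qnum_ge[OF b_pos, of n] by simp

lemma int_qnum_diff: "int (qnum b n - n) = int (qnum b n) - int n"
  using qnum_ge[OF b_pos, of n] by (simp add: of_nat_diff)

lemma power_eq_add: "b ^ n = 1 + (b ^ n - 1)"
  using b_pos by (simp add: Suc_leI)

lemma power_diff_dvd: "p ^ m dvd qnum b n - n"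
proof -
  have "int e dvd int (qnum b n) - int n"
    using qnum_cong_id[of e n] by (simp add: cong_iff_dvd_diff b_def)
  then have "int e dvd int (qnum b n - n)" by (simp add: int_qnum_diff)
  then have "e dvd qnum b n - n" by simp
  then show ?thesis by (auto simp: e_def)
qed

end

section \<open>Commutators of powers of A, B and C\<close>

context macdonald
begin

lemma commutator_A_pow_B:
  assumes "qnum b i = i + n"
  shows "commutator G (A [^] i) B = A [^] n \<otimes> C [^] i"
proof -
  have "commutator G (A [^] i) B = inv (A [^] i) \<otimes> inv B \<otimes> (A [^] i \<otimes> B)"
    by (simp add: commutator_def m_assoc)
  also have "\<dots> = inv (A [^] i) \<otimes> (inv B \<otimes> B) \<otimes> (A [^] i \<otimes> A [^] n) \<otimes> C [^] i"
    unfolding A_pow_B assms by (simp add: m_assoc inv_mult_cancel_left flip: nat_pow_mult)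
  also have "\<dots> = A [^] n \<otimes> C [^] i" by (simp flip: m_assoc)
  finally show ?thesis .
qed

lemma commutator_B_pow_A:
  assumes "qnum b j = j + n"
  shows "commutator G (B [^] j) A = B [^] n \<otimes> inv (C [^] j)"
proof -
  have 1: "B [^] j \<otimes> A = A \<otimes> B [^] (j + n) \<otimes> inv (C [^] j)"
    using A_B_pow[of j] by (simp add: assms m_assoc)
  have "commutator G (B [^] j) A = inv (B [^] j) \<otimes> inv A \<otimes> (B [^] j \<otimes> A)"
    by (simp add: commutator_def m_assoc)
  also have "\<dots> = inv (B [^] j) \<otimes> (inv A \<otimes> A) \<otimes> (B [^] j \<otimes> B [^] n) \<otimes> inv (C [^] j)"
    unfolding 1 by (simp add: m_assoc inv_mult_cancel_left flip: nat_pow_mult)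
  also have "\<dots> = B [^] n \<otimes> inv (C [^] j)" by (simp flip: m_assoc)
  finally show ?thesis .
qed

lemma commutator_C_pow_B:
  assumes "b ^ k = 1 + n"
  shows "commutator G (C [^] k) B = inv (B [^] n)"
proof -
  have "commutator G (C [^] k) B = inv (C [^] k) \<otimes> (inv B \<otimes> C [^] k) \<otimes> B"
    by (simp add: commutator_def m_assoc)
  also have "\<dots> = inv (B [^] Suc n) \<otimes> B"
    unfolding inv_B_C_pow assms by (simp flip: m_assoc)
  also have "\<dots> = inv (B [^] n)"
    unfolding nat_pow_Suc2[OF B] by (simp add: inv_mult_group m_assoc)
  finally show ?thesis .
qed

lemma commutator_C_pow_A:
  assumes "b ^ k = 1 + n"
  shows "commutator G (C [^] k) A = inv (C [^] k) \<otimes> A [^] n \<otimes> C [^] k"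
proof -
  have "commutator G (C [^] k) A = inv (C [^] k) \<otimes> inv A \<otimes> (C [^] k \<otimes> A [^] (1::nat))"
    by (simp add: commutator_def m_assoc)
  also have "\<dots> = inv (C [^] k) \<otimes> inv A \<otimes> (A [^] Suc n \<otimes> C [^] k)"
    unfolding C_pow_A_pow assms by simp
  also have "\<dots> = inv (C [^] k) \<otimes> (inv A \<otimes> A) \<otimes> A [^] n \<otimes> C [^] k"
    unfolding nat_pow_Suc2[OF A] by (simp add: m_assoc inv_mult_cancel_left)
  finally show ?thesis by simp
qed

end

context macdonald_p
begin

lemma inverse_power_unit: "\<exists>t. [b ^ k * t = n] (mod Q)"
proof -
  have "coprime (b ^ k) Q" unfolding Q_def using coprime_b by simp
  then have "\<exists>x. [b ^ k * x = 1] (mod Q)" using cong_solve_coprime_nat by (metis One_nat_def)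
  then obtain x where "[b ^ k * x = 1] (mod Q)" by blast
  then have "[b ^ k * x * n = 1 * n] (mod Q)" by (rule cong_scalar_right)
  then show ?thesis by (auto simp: mult.assoc)
qed

lemma p_dvd_of_unit_cong:
  assumes "[b ^ k * t = n] (mod Q)" "a \<le> v + m"
  shows "p ^ a dvd t \<longleftrightarrow> p ^ a dvd n"
proof -
  have "p ^ a dvd Q" unfolding Q_def using assms(2) by (rule le_imp_power_dvd)
  then have "p ^ a dvd b ^ k * t \<longleftrightarrow> p ^ a dvd n"
    using assms(1) by (meson cong_dvd_iff cong_dvd_modulus_nat)
  moreover have "coprime (p ^ a) (b ^ k)" using coprime_b by (simp add: coprime_commute)
  ultimately show ?thesis by (simp add: coprime_dvd_mult_right_iff)
qed

lemma p_dvd_complement: "a \<le> v + m \<Longrightarrow> p ^ a dvd (Q - 1) * n \<longleftrightarrow> p ^ a dvd n"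
proof -
  assume "a \<le> v + m"
  then have d: "p ^ a dvd Q * n" unfolding Q_def by (intro dvd_mult2 le_imp_power_dvd)
  have "(Q - 1) * n + n = Q * n" using Q_pos by (cases Q) auto
  then show ?thesis using d by (metis dvd_add_left_iff dvd_add_right_iff)
qed

lemma commutator_C_pow_A':
  assumes "b ^ k = 1 + n" "[b ^ k * t = n] (mod Q)"
  shows "commutator G (C [^] k) A = A [^] t"
proof -
  have "C [^] k \<otimes> A [^] t = A [^] n \<otimes> C [^] k"
    unfolding C_pow_A_pow using pow_eq_of_cong[OF _ A_pow_Q assms(2)] by simp
  then have "commutator G (C [^] k) A = inv (C [^] k) \<otimes> (C [^] k \<otimes> A [^] t)"
    unfolding commutator_C_pow_A[OF assms(1)] by (simp add: m_assoc)
  then show ?thesis by (simp flip: m_assoc)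
qed

text \<open>With h = C^k B^j the commutator is the conjugate by h of A^n C^i B^(-t), and a normal N
  does not see the conjugation. The congruence for t says B^(-t) h = B^(-1) h B.\<close>

lemma commutator_elt_B_iff:
  assumes N: "N \<lhd> G" and n: "qnum b i = i + n" and t: "[b ^ k * t = b ^ k - 1] (mod Q)"
  shows "commutator G (elt (i, k, j)) B \<in> N \<longleftrightarrow> elt (n, i, (Q - 1) * t) \<in> N"
proof -
  interpret N: normal N G by (rule N)
  define h where "h = C [^] k \<otimes> B [^] j"
  have h: "h \<in> carrier G" by (simp add: h_def)
  have t': "[b ^ k * t + 1 = b ^ k] (mod Q)"
    using cong_add[OF t cong_refl[of 1]] power_eq_add[of k] by (metis add.commute)
  have "[(Q - 1) * (b ^ k * t + 1) + (j + 1) = (Q - 1) * b ^ k + (j + 1)] (mod Q)"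
    using t' by (intro cong_add cong_scalar_left cong_refl)
  moreover have "(Q - 1) * (b ^ k * t + 1) + (j + 1) = b ^ k * ((Q - 1) * t) + j + Q"
  proof -
    obtain Q' where "Q = Suc Q'" using Q_pos by (cases Q) auto
    then show ?thesis by (simp add: algebra_simps)
  qed
  ultimately have "[b ^ k * ((Q - 1) * t) + j + Q = (Q - 1) * b ^ k + (j + 1)] (mod Q)" by argo
  then have c: "[b ^ k * ((Q - 1) * t) + j = (Q - 1) * b ^ k + (j + 1)] (mod Q)" by (simp add: cong_def)
  have Bt: "B [^] ((Q - 1) * t) \<otimes> h = inv B \<otimes> h \<otimes> B"
  proof -
    have "B [^] ((Q - 1) * t) \<otimes> h = C [^] k \<otimes> B [^] (b ^ k * ((Q - 1) * t) + j)"
      using B_pow_C_pow[of "(Q - 1) * t" k] by (simp add: h_def nat_pow_mult flip: m_assoc) (simp add: m_assoc nat_pow_mult)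
    also have "\<dots> = C [^] k \<otimes> B [^] ((Q - 1) * b ^ k + (j + 1))"
      using pow_eq_of_cong[OF _ B_pow_Q c] by simp
    also have "\<dots> = (C [^] k \<otimes> inv (B [^] (b ^ k))) \<otimes> B [^] j \<otimes> B"
      by (simp add: inv_B_pow m_assoc flip: nat_pow_mult)
    also have "\<dots> = inv B \<otimes> h \<otimes> B" by (simp add: h_def m_assoc flip: inv_B_C_pow)
    finally show ?thesis .
  qed
  have g: "elt (i, k, j) = A [^] i \<otimes> h" by (simp add: elt_eq h_def m_assoc)
  have "commutator G (elt (i, k, j)) B = inv h \<otimes> inv (A [^] i) \<otimes> (inv B \<otimes> A [^] i) \<otimes> h \<otimes> B"
    unfolding g using h by (simp add: commutator_def inv_mult_group m_assoc)
  also have "\<dots> = inv h \<otimes> (inv (A [^] i) \<otimes> A [^] (i + n)) \<otimes> C [^] i \<otimes> (inv B \<otimes> h \<otimes> B)"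
    unfolding inv_B_A_pow n using h by (simp add: m_assoc)
  also have "inv (A [^] i) \<otimes> A [^] (i + n) = A [^] n" by (simp flip: nat_pow_mult m_assoc)
  also have "inv h \<otimes> A [^] n \<otimes> C [^] i \<otimes> (inv B \<otimes> h \<otimes> B) = inv h \<otimes> elt (n, i, (Q - 1) * t) \<otimes> h"
    using h by (simp add: elt_eq m_assoc flip: Bt)
  finally show ?thesis using N.conj_mem_iff h by simp
qed

lemma commutator_A_pow_B_elt: "commutator G (A [^] i) B = elt (qnum b i - i, i, 0)"
  unfolding commutator_A_pow_B[OF qnum_eq_add] elt_eq by simp

lemma B_pow_eq_elt: "B [^] j = inv (A [^] i \<otimes> C [^] k) \<otimes> elt (i, k, j)"
  by (subst inv_solve_left) (auto simp: elt_eq)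

lemma commutator_B_pow_A_iff:
  assumes N: "N \<lhd> G" and n: "qnum b j = j + n"
  shows "commutator G (B [^] j) A \<in> N \<longleftrightarrow> elt (0, j, (Q - 1) * n) \<in> N"
proof -
  interpret N: normal N G by (rule N)
  have "inv (commutator G (B [^] j) A) = elt (0, j, (Q - 1) * n)"
    unfolding commutator_B_pow_A[OF n] by (simp add: inv_mult_group elt_eq inv_B_pow)
  moreover have "commutator G (B [^] j) A \<in> carrier G" by (simp add: commutator_def)
  ultimately show ?thesis by (metis N.m_inv_closed inv_inv)
qed

end

locale macdonald_sylow = macdonald_p +
  assumes generate_eq: "generate G {A, B} = carrier G"
    and faithful: "elt x = elt y \<Longrightarrow> nf q Q \<sigma> x = nf q Q \<sigma> y"
begin

lemma carrier_eq: "carrier G = range elt"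
  using generate_AB generate_eq by auto

lemma elt_eq_iff: "elt x = elt y \<longleftrightarrow> nf q Q \<sigma> x = nf q Q \<sigma> y"
  using faithful elt_nf by metis

lemma upper_central_Suc_iff': "x \<in> upper_central G (Suc s) \<longleftrightarrow>
    x \<in> carrier G \<and> commutator G x A \<in> upper_central G s \<and> commutator G x B \<in> upper_central G s"
  using upper_central_Suc_generate_iff[OF _ generate_eq] by simp

text \<open>Predicates \<open>X\<close>, \<open>Z\<close> describe the exponents of \<open>A\<close> (and \<open>B\<close>) and of \<open>C\<close> in the next
  term. Splitting off \<open>A^i\<close> and \<open>C^k\<close> by means of commutators with \<open>B\<close> reduces the commutator
  with \<open>A\<close> to that of a power of \<open>B\<close>.\<close>

lemma upper_central_step:
  assumes X: "\<And>i. X i \<Longrightarrow> elt (qnum b i - i, i, 0) \<in> upper_central G s"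
      "\<And>i. X i \<Longrightarrow> elt (0, i, (Q - 1) * (qnum b i - i)) \<in> upper_central G s"
    and Z: "\<And>k t. Z k \<Longrightarrow> [b ^ k * t = b ^ k - 1] (mod Q) \<Longrightarrow> A [^] t \<in> upper_central G s"
      "\<And>k. Z k \<Longrightarrow> B [^] (b ^ k - 1) \<in> upper_central G s"
    and XZ: "\<And>i k t. [b ^ k * t = b ^ k - 1] (mod Q) \<Longrightarrow>
      elt (qnum b i - i, i, (Q - 1) * t) \<in> upper_central G s \<Longrightarrow> X i \<and> Z k"
    and X': "\<And>j. elt (0, j, (Q - 1) * (qnum b j - j)) \<in> upper_central G s \<Longrightarrow> X j"
  shows "elt (i, k, j) \<in> upper_central G (Suc s) \<longleftrightarrow> X i \<and> Z k \<and> X j"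
proof -
  note U = upper_central_normal
  interpret N: normal "upper_central G s" G by (rule U)
  interpret N': normal "upper_central G (Suc s)" G by (rule U)
  have comm_self: "commutator G (x [^] n) x \<in> upper_central G s" if "x \<in> carrier G" for x and n :: nat
    using commutator_pow_self[OF that] by simp
  have a: "A [^] i \<in> upper_central G (Suc s)" if "X i" for i
  proof -
    have "commutator G (A [^] i) B \<in> upper_central G s"
      unfolding commutator_A_pow_B_elt by (rule X(1)[OF that])
    then show ?thesis
      unfolding upper_central_Suc_iff' using comm_self[of A] nat_pow_closed[OF A] A by blast
  qed
  have bj: "B [^] j \<in> upper_central G (Suc s)" if "X j" for j
  proof -
    have "commutator G (B [^] j) A \<in> upper_central G s"
      unfolding commutator_B_pow_A_iff[OF U qnum_eq_add] by (rule X(2)[OF that])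
    then show ?thesis
      unfolding upper_central_Suc_iff' using comm_self[of B] nat_pow_closed[OF B] B by blast
  qed
  have ck: "C [^] k \<in> upper_central G (Suc s)" if "Z k" for k
  proof -
    obtain t where t: "[b ^ k * t = b ^ k - 1] (mod Q)" using inverse_power_unit by blast
    have "commutator G (C [^] k) A \<in> upper_central G s"
      unfolding commutator_C_pow_A'[OF power_eq_add t] by (rule Z(1)[OF that t])
    moreover have "commutator G (C [^] k) B \<in> upper_central G s"
      unfolding commutator_C_pow_B[OF power_eq_add] by (rule N.m_inv_closed[OF Z(2)[OF that]])
    ultimately show ?thesis
      unfolding upper_central_Suc_iff' using nat_pow_closed[OF C] by blast
  qed
  show ?thesis
  proof
    assume g: "elt (i, k, j) \<in> upper_central G (Suc s)"
    obtain t where t: "[b ^ k * t = b ^ k - 1] (mod Q)" using inverse_power_unit by blast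
    have "commutator G (elt (i, k, j)) B \<in> upper_central G s"
      using g unfolding upper_central_Suc_iff' by blast
    then have 1: "X i \<and> Z k" unfolding commutator_elt_B_iff[OF U qnum_eq_add t] by (rule XZ[OF t])
    have "B [^] j = inv (A [^] i \<otimes> C [^] k) \<otimes> elt (i, k, j)"
      by (rule B_pow_eq_elt)
    also have "\<dots> \<in> upper_central G (Suc s)" using a ck g 1 by blast
    finally have "commutator G (B [^] j) A \<in> upper_central G s" unfolding upper_central_Suc_iff' by blast
    then show "X i \<and> Z k \<and> X j" using 1 X' unfolding commutator_B_pow_A_iff[OF U qnum_eq_add] by blast
  next
    assume "X i \<and> Z k \<and> X j"
    then show "elt (i, k, j) \<in> upper_central G (Suc s)"
      unfolding elt_eq using a bj ck by blast
  qed
qed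

text \<open>The shape of the terms of the upper central series: one bound for the exponents of A and
  B, another for that of C. That such a set is a subgroup is not clear in advance; it follows once
  it is identified with a term of the series.\<close>

definition W :: "nat \<Rightarrow> nat \<Rightarrow> 'a set" where
  "W a c = {elt (i, k, j) | i k j. p ^ a dvd i \<and> p ^ c dvd k \<and> p ^ a dvd j}"

text \<open>Exponents of equal elements agree modulo q = p^v, so divisibility by p^a and p^c is well
  defined as long as a and c do not exceed v.\<close>

lemma elt_in_W_iff:
  assumes "a \<le> v" "c \<le> v"
  shows "elt (i, k, j) \<in> W a c \<longleftrightarrow> p ^ a dvd i \<and> p ^ c dvd k \<and> p ^ a dvd j"
proof
  assume "elt (i, k, j) \<in> W a c"
  then obtain i' k' j' where eq: "elt (i, k, j) = elt (i', k', j')"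
    and d: "p ^ a dvd i'" "p ^ c dvd k'" "p ^ a dvd j'" unfolding W_def by blast
  have 1: "int q dvd int k - int k'" "int q dvd int j - int j'"
      "int Q dvd (int i - int i') - (int j - int j') + int \<sigma> * (int k - int k')"
    using eq unfolding elt_eq_iff nf_eq_iff[OF Q_pos] by blast+
  have "int q dvd int Q" by (simp add: q_def Q_def power_add)
  then have "int q dvd (int i - int i') - (int j - int j') + int \<sigma> * (int k - int k')"
    using 1(3) dvd_trans by blast
  then have "int q dvd ((int i - int i') - (int j - int j') + int \<sigma> * (int k - int k'))
      + (int j - int j') - int \<sigma> * (int k - int k')"
    by (rule dvd_diff[OF dvd_add[OF _ 1(2)] dvd_mult[OF 1(1)]])
  then have 2: "int q dvd int i - int i'" by simp
  have aq: "int (p ^ a) dvd int q" "int (p ^ c) dvd int q"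
    using assms by (simp_all add: q_def le_imp_power_dvd)
  have *: "d dvd x" if "int d dvd int q" "int q dvd int x - int y" "d dvd y" for d x y
  proof -
    have "int d dvd (int x - int y) + int y" using that by (intro dvd_add) (auto intro: dvd_trans)
    then show ?thesis by simp
  qed
  show "p ^ a dvd i \<and> p ^ c dvd k \<and> p ^ a dvd j"
    using *[OF aq(1) 2 d(1)] *[OF aq(2) 1(1) d(2)] *[OF aq(1) 1(2) d(3)] by simp
qed (auto simp: W_def)

end

declare upper_central.simps [simp del] lower_central.simps [simp del]

section \<open>The center and the recursion for the upper central series\<close>

context macdonald_sylow
begin

lemma elt_eq_one_iff:
  "elt (i, k, j) = \<one> \<longleftrightarrow> q dvd k \<and> q dvd j \<and> int Q dvd int i - int j + int \<sigma> * int k"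
proof -
  have "elt (i, k, j) = \<one> \<longleftrightarrow> elt (i, k, j) = elt (0, 0, 0)" by (simp add: elt_eq[of 0 0 0])
  also have "\<dots> \<longleftrightarrow> q dvd k \<and> q dvd j \<and> int Q dvd int i - int j + int \<sigma> * int k"
    unfolding elt_eq_iff nf_eq_iff[OF Q_pos] by simp
  finally show ?thesis .
qed

lemma elt_in_W: "p ^ a dvd i \<Longrightarrow> p ^ c dvd k \<Longrightarrow> p ^ a dvd j \<Longrightarrow> elt (i, k, j) \<in> W a c"
  by (auto simp: W_def)

lemma q_dvd_Q: "q dvd Q"
  by (simp add: q_def Q_def power_add)

lemma W_eqI:
  assumes "\<And>i k j. elt (i, k, j) \<in> N \<longleftrightarrow> p ^ a dvd i \<and> p ^ c dvd k \<and> p ^ a dvd j" "N \<subseteq> carrier G"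
  shows "N = W a c"
proof
  show "N \<subseteq> W a c"
  proof
    fix x assume x: "x \<in> N"
    then have "x \<in> range elt" using assms(2) carrier_eq by blast
    then obtain i k j where "x = elt (i, k, j)" by (metis rangeE surj_pair)
    then show "x \<in> W a c" using x assms(1) unfolding W_def by blast
  qed
qed (use assms(1) in \<open>auto simp: W_def\<close>)

lemma upper_central_subset: "upper_central G s \<subseteq> carrier G"
  using upper_central_normal normal_imp_subgroup subgroup.subset by blast

text \<open>The starting point (v, v) of the recursion for \<open>W\<close>. This set is in fact
  cyclic, since B^q and C^q are powers of A^q; see \<open>generate_q_q\<close>.\<close>

lemma upper_central_1: "upper_central G 1 = W v v"
proof (rule W_eqI)
  fix i k j
  have mem: "x \<in> upper_central G 0 \<longleftrightarrow> x = \<one>" for x by (simp add: upper_central.simps)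
  have Qn: "int Q dvd int (qnum b i - i) + int \<sigma> * int i" if "p ^ v dvd i" for i
    using qnum_q[OF that] by (simp add: Q_def int_qnum_diff)
  have qn: "q dvd qnum b i - i" if "p ^ v dvd i" for i
  proof -
    have "int q dvd int (qnum b i - i) + int \<sigma> * int i"
      using Qn[OF that] q_dvd_Q by (meson dvd_trans int_dvd_int_iff)
    moreover have "int q dvd int i" using that unfolding q_def int_dvd_int_iff .
    then have "int q dvd int \<sigma> * int i" by (rule dvd_mult)
    ultimately show ?thesis by (simp add: dvd_add_left_iff)
  qed
  have Q1: "int ((Q - 1) * t) = int Q * int t - int t" for t
    using Q_pos by (cases Q) (simp_all add: algebra_simps)
  have Qt: "int Q dvd x - int ((Q - 1) * t) + y \<longleftrightarrow> int Q dvd x + int t + y" for x y t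
  proof -
    have "x - int ((Q - 1) * t) + y = (x + int t + y) - int Q * int t" unfolding Q1 by simp
    then show ?thesis by (metis dvd_triv_left dvd_diff dvd_add diff_add_cancel)
  qed
  have Qk: "Q dvd b ^ k - 1 \<longleftrightarrow> p ^ v dvd k" for k
    using dvd_power_iff[of v k] by (simp add: Q_def add.commute)
  have Qunit: "Q dvd t \<longleftrightarrow> p ^ v dvd k" if "[b ^ k * t = b ^ k - 1] (mod Q)" for k t
    using p_dvd_of_unit_cong[OF that, of "v + m"] Qk by (simp add: Q_def)
  have one: "x [^] t = \<one>" if "x \<in> carrier G" "x [^] Q = \<one>" "Q dvd t" for x and t :: nat
    using that pow_mult_one by (metis dvdE)
  have "elt (i, k, j) \<in> upper_central G (Suc 0) \<longleftrightarrow> p ^ v dvd i \<and> p ^ v dvd k \<and> p ^ v dvd j"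
  proof (rule upper_central_step)
    show "elt (qnum b i - i, i, 0) \<in> upper_central G 0" if "p ^ v dvd i" for i
      unfolding mem elt_eq_one_iff using Qn[OF that] that by (simp add: q_def)
    show "elt (0, i, (Q - 1) * (qnum b i - i)) \<in> upper_central G 0" if "p ^ v dvd i" for i
      unfolding mem elt_eq_one_iff Qt using Qn[OF that] qn[OF that] that by (simp add: q_def)
    show "A [^] t \<in> upper_central G 0" if "p ^ v dvd k" "[b ^ k * t = b ^ k - 1] (mod Q)" for k t
      unfolding mem using one[OF A A_pow_Q] Qunit[OF that(2)] that(1) by blast
    show "B [^] (b ^ k - 1) \<in> upper_central G 0" if "p ^ v dvd k" for k
      unfolding mem using one[OF B B_pow_Q] Qk that by blast
    show "p ^ v dvd i \<and> p ^ v dvd k"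
      if t: "[b ^ k * t = b ^ k - 1] (mod Q)" and e: "elt (qnum b i - i, i, (Q - 1) * t) \<in> upper_central G 0" for i k t
    proof -
      have i: "p ^ v dvd i" and "int Q dvd int (qnum b i - i) + int t + int \<sigma> * int i"
        using e unfolding mem elt_eq_one_iff Qt by (auto simp: q_def)
      then have "int Q dvd (int (qnum b i - i) + int t + int \<sigma> * int i) - (int (qnum b i - i) + int \<sigma> * int i)"
        using Qn by (intro dvd_diff) auto
      then show ?thesis using i Qunit[OF t] by simp
    qed
    show "p ^ v dvd j" if "elt (0, j, (Q - 1) * (qnum b j - j)) \<in> upper_central G 0" for j
      using that unfolding mem elt_eq_one_iff by (simp add: q_def)
  qed
  then show "elt (i, k, j) \<in> upper_central G 1 \<longleftrightarrow> p ^ v dvd i \<and> p ^ v dvd k \<and> p ^ v dvd j" by simp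
qed (rule upper_central_subset)

text \<open>The formula [A^i, B] = A^([i] - i) C^i yields the condition \<open>X\<close> on i. The
  commutators of C^k with A and B have exponents b^k - 1 up to units and sign, and p^a divides this
  number exactly when p^(a-m) divides k.\<close>

lemma upper_central_W_step:
  assumes W: "upper_central G s = W a c" and a: "a \<le> v" and c: "c \<le> v" and t: "t = Suc s"
    and X: "\<And>i. p ^ c dvd i \<and> p ^ a dvd qnum b i - i \<longleftrightarrow> p ^ a' dvd i"
  shows "upper_central G t = W a' (a - m)"
proof (rule W_eqI)
  have av: "a \<le> v + m" using a by simp
  note Wi = elt_in_W_iff[OF a c] and comp = p_dvd_complement[OF av]
  have At: "A [^] t = elt (t, 0, 0)" and Bt: "B [^] t = elt (0, 0, t)" for t :: nat by (simp_all add: elt_eq)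
  show "elt (i, k, j) \<in> upper_central G t \<longleftrightarrow> p ^ a' dvd i \<and> p ^ (a - m) dvd k \<and> p ^ a' dvd j" for i k j
    unfolding t
  proof (rule upper_central_step, unfold W Wi comp At Bt X[symmetric])
    fix k t
    assume t: "[b ^ k * t = b ^ k - 1] (mod Q)"
    note d = p_dvd_of_unit_cong[OF t av] dvd_power_iff'[of a k]
    show "p ^ (a - m) dvd k \<Longrightarrow> p ^ a dvd t \<and> p ^ c dvd 0 \<and> p ^ a dvd 0" using d by simp
    show "p ^ a dvd qnum b i - i \<and> p ^ c dvd i \<and> p ^ a dvd t \<Longrightarrow>
      (p ^ c dvd i \<and> p ^ a dvd qnum b i - i) \<and> p ^ (a - m) dvd k" for i using d by simp
  next
    show "p ^ (a - m) dvd k \<Longrightarrow> p ^ a dvd 0 \<and> p ^ c dvd 0 \<and> p ^ a dvd b ^ k - 1" for k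
      using dvd_power_iff'[of a k] by simp
  qed auto
qed (rule upper_central_subset)

lemma W_generate:
  assumes "subgroup (W a c) G"
  shows "W a c = generate G {A [^] (p ^ a), B [^] (p ^ a), C [^] (p ^ c)}" (is "_ = generate G ?U")
proof
  have sub: "subgroup (generate G ?U) G" by (rule generate_is_subgroup) auto
  show "W a c \<subseteq> generate G ?U"
  proof
    fix x assume "x \<in> W a c"
    then obtain i k j where x: "x = elt (i, k, j)" and d: "p ^ a dvd i" "p ^ c dvd k" "p ^ a dvd j"
      unfolding W_def by blast
    have "A [^] i \<in> generate G ?U" by (rule pow_dvd_mem[OF sub _ _ d(1)]) (auto intro: generate.incl)
    moreover have "C [^] k \<in> generate G ?U" by (rule pow_dvd_mem[OF sub _ _ d(2)]) (auto intro: generate.incl)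
    moreover have "B [^] j \<in> generate G ?U" by (rule pow_dvd_mem[OF sub _ _ d(3)]) (auto intro: generate.incl)
    ultimately show "x \<in> generate G ?U" unfolding x elt_eq by (intro subgroup.m_closed[OF sub])
  qed
  have "A [^] (p ^ a) = elt (p ^ a, 0, 0)" "B [^] (p ^ a) = elt (0, 0, p ^ a)" "C [^] (p ^ c) = elt (0, p ^ c, 0)"
    by (simp_all add: elt_eq)
  then have "?U \<subseteq> W a c" by (simp add: elt_in_W)
  then show "generate G ?U \<subseteq> W a c" by (rule generate_subgroup_incl[OF _ assms])
qed

lemma upper_central_generate:
  "upper_central G s = W a c \<Longrightarrow>
    upper_central G s = generate G {A [^] (p ^ a), B [^] (p ^ a), C [^] (p ^ c)}"
  using W_generate upper_central_normal normal_imp_subgroup by metis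

lemma generate_q: "generate G {A [^] q, B [^] q, C [^] n} = generate G {A [^] q, C [^] (n::nat)}"
proof -
  have "B [^] q = (A [^] q) [^] (Q - 1)" by (simp add: B_q nat_pow_pow mult.commute)
  also have "\<dots> \<in> generate G {A [^] q, C [^] n}"
    by (rule subgroup_pow_closed[OF generate_is_subgroup]) (auto intro: generate.incl)
  finally have "generate G (insert (B [^] q) {A [^] q, C [^] n}) = generate G {A [^] q, C [^] n}"
    by (intro generate_insert_absorb) auto
  then show ?thesis by (simp add: insert_commute)
qed

lemma generate_q_q: "generate G {A [^] q, B [^] q, C [^] q} = generate G {A [^] q}"
proof -
  have "C [^] q = (A [^] q) [^] \<sigma>" by (simp add: C_q nat_pow_pow mult.commute)
  also have "\<dots> \<in> generate G {A [^] q}"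
    by (rule subgroup_pow_closed[OF generate_is_subgroup]) (auto intro: generate.incl)
  finally have "generate G (insert (C [^] q) {A [^] q}) = generate G {A [^] q}"
    by (intro generate_insert_absorb) auto
  then show ?thesis unfolding generate_q by (simp add: insert_commute)
qed

lemma W_0_0: "W 0 0 = carrier G"
  unfolding W_def carrier_eq by (auto simp: image_iff)

lemma W_neq_carrier:
  assumes "0 < a" "a \<le> v" "c \<le> v"
  shows "W a c \<noteq> carrier G"
proof
  assume "W a c = carrier G"
  then have "elt (1, 0, 0) \<in> W a c" by simp
  then have "p ^ a dvd 1" using elt_in_W_iff[OF assms(2,3)] by blast
  then show False using assms(1) p_gt_1 by simp
qed

lemma upper_central_0_neq: "upper_central G 0 \<noteq> carrier G"
proof
  assume "upper_central G 0 = carrier G"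
  then have "elt (1, 0, 0) = \<one>" using elt_closed by (metis singletonD upper_central.simps(1))
  then have "int Q dvd 1" unfolding elt_eq_one_iff by simp
  moreover have "Q > 1" unfolding Q_def using p_gt_1 m by (intro one_less_power) auto
  ultimately show False by simp
qed

text \<open>The exponent b^(p^c) - 1 has valuation exactly m + c. As c < v, also p^(m+c+1) divides
  Q, so the exponent t, known only modulo Q, has the same valuation.\<close>

lemma commutator_C_pow_mem:
  assumes H: "subgroup H G" and c: "c < v"
  shows "commutator G (C [^] (p ^ c)) A \<in> H \<Longrightarrow> A [^] (p ^ (m + c)) \<in> H"
    and "commutator G (C [^] (p ^ c)) B \<in> H \<Longrightarrow> B [^] (p ^ (m + c)) \<in> H"
proof -
  obtain t where t: "[b ^ (p ^ c) * t = b ^ (p ^ c) - 1] (mod Q)" using inverse_power_unit by blast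
  have d: "p ^ (m + c) dvd b ^ (p ^ c) - 1" unfolding dvd_power_iff by simp
  have nd: "\<not> p ^ Suc (m + c) dvd b ^ (p ^ c) - 1"
  proof
    assume "p ^ Suc (m + c) dvd b ^ (p ^ c) - 1"
    then have "p ^ Suc c dvd p ^ c" using dvd_power_iff[of "Suc c" "p ^ c"] by simp
    then show False using p_gt_1 by (metis Suc_n_not_le_n dvd_power_iff_le power_dvd_imp_le)
  qed
  have td: "p ^ (m + c) dvd t" "\<not> p ^ Suc (m + c) dvd t"
    using d nd p_dvd_of_unit_cong[OF t, of "m + c"] p_dvd_of_unit_cong[OF t, of "Suc (m + c)"] c by simp_all
  show "A [^] (p ^ (m + c)) \<in> H" if "commutator G (C [^] (p ^ c)) A \<in> H"
    using that td pow_unit_mem[OF H A A_pow_K p] unfolding commutator_C_pow_A'[OF power_eq_add t] by blast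
  show "B [^] (p ^ (m + c)) \<in> H" if "commutator G (C [^] (p ^ c)) B \<in> H"
  proof -
    have "B [^] (b ^ (p ^ c) - 1) \<in> H"
      using that subgroup.m_inv_closed[OF H] unfolding commutator_C_pow_B[OF power_eq_add]
      by (metis B inv_inv nat_pow_closed)
    then show ?thesis using pow_unit_mem[OF H B B_pow_K p] d nd by blast
  qed
qed

section \<open>Steps down the lower central series\<close>

lemma lower_central_C_pow:
  assumes "C [^] (p ^ c) \<in> lower_central G (Suc i)" "c < v"
  shows "A [^] (p ^ (m + c)) \<in> lower_central G (Suc (Suc i))" "B [^] (p ^ (m + c)) \<in> lower_central G (Suc (Suc i))"
  using commutator_C_pow_mem[OF lower_central_subgroup assms(2)]
    commutator_in_lower_central(2)[OF A assms(1)] commutator_in_lower_central(2)[OF B assms(1)] by blast+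

lemma lower_central_A_pow:
  assumes "A [^] n \<in> lower_central G (Suc i)"
  shows "A [^] (qnum b n - n) \<otimes> C [^] n \<in> lower_central G (Suc (Suc i))"
  using commutator_in_lower_central(2)[OF B assms] unfolding commutator_A_pow_B[OF qnum_eq_add] .

lemma lower_central_C_from_A:
  assumes "A [^] n \<in> lower_central G (Suc i)" "A [^] d \<in> lower_central G (Suc (Suc i))" "d dvd qnum b n - n"
  shows "C [^] n \<in> lower_central G (Suc (Suc i))"
proof -
  note sub = lower_central_subgroup[of "Suc i"]
  have 1: "A [^] (qnum b n - n) \<in> lower_central G (Suc (Suc i))"
    by (rule pow_dvd_mem[OF sub A assms(2,3)])
  have "C [^] n = inv (A [^] (qnum b n - n)) \<otimes> (A [^] (qnum b n - n) \<otimes> C [^] n)"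
    by (simp add: inv_mult_cancel_left)
  also have "\<dots> \<in> lower_central G (Suc (Suc i))"
    by (intro subgroup.m_closed[OF sub] subgroup.m_inv_closed[OF sub] 1 lower_central_A_pow assms(1))
  finally show ?thesis .
qed

lemma qnum_odd_nat:
  assumes "odd p" "p ^ c dvd n" "a \<le> c + m"
  shows "p ^ a dvd qnum b n - n"
proof -
  have "int p ^ a dvd int (qnum b n) - int n"
    using qnum_odd[OF assms(1,2)] assms(3) by (meson dvd_trans le_imp_power_dvd)
  then show ?thesis by (simp flip: int_qnum_diff add: int_dvd_int_iff[symmetric])
qed

text \<open>For odd p, once p^c divides i, [i] - i is divisible by p^(c+m) and hence by p^a. Only
  p^c dvd i remains as a condition, and the pair (a, c) is replaced by (c, a - m).\<close>

lemma upper_central_odd_step: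
  assumes "odd p" "upper_central G s = W a c" "a \<le> v" "c \<le> v" "a \<le> c + m" "t = Suc s" "d = a - m"
  shows "upper_central G t = W c d"
  unfolding assms(7)
  by (rule upper_central_W_step[OF assms(2-4,6)]) (use qnum_odd_nat[OF assms(1) _ assms(5)] in auto)

text \<open>The recursion (a, c) -> (c, d), read backwards: commutators of C^(p^d) give the powers
  p^(d+m) = p^a of A and B, and then A^(p^c) gives C^(p^c). The other inclusion holds because
  commutators with an upper central term fall into the previous one.\<close>

lemma lower_central_odd_step:
  assumes "odd p" and low: "lower_central G j = upper_central G t" and t: "t = Suc s" and j: "j \<ge> 1" "j' = Suc j"
    and Wt: "upper_central G t = W c d" and Ws: "upper_central G s = W a c"
    and a: "a = d + m" "d < v" "a \<le> c + m"
  shows "lower_central G j' = upper_central G s"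
proof -
  obtain i where i: "j = Suc i" using j(1) by (cases j) auto
  note sub = lower_central_subgroup[of "Suc i"]
  have "C [^] (p ^ d) = elt (0, p ^ d, 0)" "A [^] (p ^ c) = elt (p ^ c, 0, 0)" by (simp_all add: elt_eq)
  then have mem: "C [^] (p ^ d) \<in> lower_central G (Suc i)" "A [^] (p ^ c) \<in> lower_central G (Suc i)"
    using low Wt unfolding i by (simp_all add: elt_in_W)
  have Aa: "A [^] (p ^ a) \<in> lower_central G (Suc (Suc i))" and Ba: "B [^] (p ^ a) \<in> lower_central G (Suc (Suc i))"
    using lower_central_C_pow[OF mem(1) a(2)] by (simp_all add: a(1) add.commute)
  have Cc: "C [^] (p ^ c) \<in> lower_central G (Suc (Suc i))"
    by (rule lower_central_C_from_A[OF mem(2) Aa qnum_odd_nat[OF assms(1) _ a(3)]]) simp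
  have "upper_central G s \<subseteq> lower_central G (Suc (Suc i))"
    unfolding upper_central_generate[OF Ws] using Aa Ba Cc by (intro generate_subgroup_incl[OF _ sub]) auto
  moreover have "lower_central G (Suc (Suc i)) \<subseteq> upper_central G s"
    using low unfolding i t by (intro lower_central_le_upper_central) simp
  ultimately show ?thesis unfolding j(2) i by blast
qed

lemma lower_central_last:
  assumes "lower_central G j = upper_central G 1" "j \<ge> 1" "j' = Suc j"
  shows "lower_central G j' = upper_central G 0"
proof -
  obtain i where i: "j = Suc i" using assms(2) by (cases j) auto
  have "lower_central G (Suc (Suc i)) \<subseteq> upper_central G 0"
    using assms(1) unfolding i One_nat_def by (intro lower_central_le_upper_central) simp
  moreover have "\<one> \<in> lower_central G (Suc (Suc i))" by (rule subgroup.one_closed[OF lower_central_subgroup])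
  ultimately show ?thesis unfolding assms(3) i by (auto simp: upper_central.simps)
qed

end

section \<open>The central series in each of the three cases\<close>

context macdonald_sylow
begin

lemma nilpotency_classI:
  assumes "upper_central G c = W 0 0"
    and "\<And>s. 0 < s \<Longrightarrow> s < c \<Longrightarrow> \<exists>a d. 0 < a \<and> a \<le> v \<and> d \<le> v \<and> upper_central G s = W a d"
  shows "has_nilpotency_class G c"
  unfolding has_nilpotency_class_def
proof (intro conjI allI impI)
  show "upper_central G c = carrier G" by (simp add: assms(1) W_0_0)
  show "upper_central G s \<noteq> carrier G" if "s < c" for s
    using that assms(2)[of s] upper_central_0_neq W_neq_carrier by (cases "s = 0") auto
qed

theorem central_series_generic:
  assumes odd: "odd p" and v: "v = 2 * m"
  shows "has_nilpotency_class G 5 \<and>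
    upper_central G 1 = generate G {A [^] (p ^ (2 * m))} \<and>
    upper_central G 2 = generate G {A [^] (p ^ (2 * m)), C [^] (p ^ m)} \<and>
    upper_central G 3 = generate G {A [^] (p ^ m), B [^] (p ^ m), C [^] (p ^ m)} \<and>
    upper_central G 4 = generate G {A [^] (p ^ m), B [^] (p ^ m), C} \<and>
    (\<forall>i \<in> {1..6}. lower_central G i = upper_central G (6 - i))"
proof -
  have q: "q = p ^ (2 * m)" unfolding q_def unfolding v ..
  have u1: "upper_central G 1 = W (2 * m) (2 * m)" using upper_central_1 by (simp add: v)
  have u2: "upper_central G 2 = W (2 * m) m" by (rule upper_central_odd_step[OF odd u1]) (simp_all add: v)
  have u3: "upper_central G 3 = W m m" by (rule upper_central_odd_step[OF odd u2]) (simp_all add: v)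
  have u4: "upper_central G 4 = W m 0" by (rule upper_central_odd_step[OF odd u3]) (simp_all add: v)
  have u5: "upper_central G 5 = W 0 0" by (rule upper_central_odd_step[OF odd u4]) (simp_all add: v)
  have nilp: "has_nilpotency_class G 5"
  proof (rule nilpotency_classI[OF u5])
    fix s :: nat assume "0 < s" "s < 5"
    then have "s = 1 \<or> s = 2 \<or> s = 3 \<or> s = 4" by auto
    then show "\<exists>a d. 0 < a \<and> a \<le> v \<and> d \<le> v \<and> upper_central G s = W a d"
      using u1 u2 u3 u4 m v by (metis One_nat_def Suc_le_lessD le0 le_add2 mult_2 order_refl trans_le_add2)
  qed
  have l1: "lower_central G 1 = upper_central G 5" by (simp add: u5 W_0_0 lower_central.simps)
  have l2: "lower_central G 2 = upper_central G 4"
    by (rule lower_central_odd_step[OF odd l1 _ _ _ u5 u4]) (use m v in auto)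
  have l3: "lower_central G 3 = upper_central G 3"
    by (rule lower_central_odd_step[OF odd l2 _ _ _ u4 u3]) (use m v in auto)
  have l4: "lower_central G 4 = upper_central G 2"
    by (rule lower_central_odd_step[OF odd l3 _ _ _ u3 u2]) (use m v in auto)
  have l5: "lower_central G 5 = upper_central G 1"
    by (rule lower_central_odd_step[OF odd l4 _ _ _ u2 u1]) (use m v in auto)
  have l6: "lower_central G 6 = upper_central G 0" by (rule lower_central_last[OF l5]) simp_all
  have low: "lower_central G i = upper_central G (6 - i)" if "i \<in> {1..6}" for i
  proof -
    have "i = 1 \<or> i = 2 \<or> i = 3 \<or> i = 4 \<or> i = 5 \<or> i = 6" using that by auto
    then show ?thesis by (elim disjE) (simp_all add: l1[unfolded One_nat_def] l2 l3 l4 l5 l6)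
  qed
  show ?thesis
    using nilp low upper_central_generate[OF u1] upper_central_generate[OF u2] upper_central_generate[OF u3]
      upper_central_generate[OF u4] generate_q_q generate_q[of "p ^ m"] unfolding q by simp
qed

text \<open>The recursion (a, c) -> (c, a - 1) now starts at (3, 3) and takes six steps to reach (0,
  0), whereas from (2m, 2m) with steps of size m it takes four. This accounts for class 7 instead of
  5.\<close>

theorem central_series_exceptional:
  assumes p3: "p = 3" and m1: "m = 1" and v: "v = 3"
  shows "has_nilpotency_class G 7 \<and>
    upper_central G 1 = generate G {A [^] (27::nat)} \<and>
    upper_central G 2 = generate G {A [^] (27::nat), C [^] (9::nat)} \<and>
    upper_central G 3 = generate G {A [^] (9::nat), B [^] (9::nat), C [^] (9::nat)} \<and>
    upper_central G 4 = generate G {A [^] (9::nat), B [^] (9::nat), C [^] (3::nat)} \<and>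
    upper_central G 5 = generate G {A [^] (3::nat), B [^] (3::nat), C [^] (3::nat)} \<and>
    upper_central G 6 = generate G {A [^] (3::nat), B [^] (3::nat), C} \<and>
    (\<forall>i \<in> {1..8}. lower_central G i = upper_central G (8 - i))"
proof -
  have odd: "odd p" by (simp add: p3)
  have pw: "p ^ 3 = 27" "p ^ 2 = 9" "p ^ 1 = 3" "p ^ 0 = 1" by (simp_all add: p3)
  have q: "q = 27" unfolding q_def unfolding v p3 by simp
  have u1: "upper_central G 1 = W 3 3" using upper_central_1 by (simp add: v)
  have u2: "upper_central G 2 = W 3 2" by (rule upper_central_odd_step[OF odd u1]) (simp_all add: v m1)
  have u3: "upper_central G 3 = W 2 2" by (rule upper_central_odd_step[OF odd u2]) (simp_all add: v m1)
  have u4: "upper_central G 4 = W 2 1" by (rule upper_central_odd_step[OF odd u3]) (simp_all add: v m1)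
  have u5: "upper_central G 5 = W 1 1" by (rule upper_central_odd_step[OF odd u4]) (simp_all add: v m1)
  have u6: "upper_central G 6 = W 1 0" by (rule upper_central_odd_step[OF odd u5]) (simp_all add: v m1)
  have u7: "upper_central G 7 = W 0 0" by (rule upper_central_odd_step[OF odd u6]) (simp_all add: v m1)
  have nilp: "has_nilpotency_class G 7"
  proof (rule nilpotency_classI[OF u7])
    fix s :: nat assume "0 < s" "s < 7"
    then have "s = 1 \<or> s = 2 \<or> s = 3 \<or> s = 4 \<or> s = 5 \<or> s = 6" by auto
    then have "upper_central G s = W 3 3 \<or> upper_central G s = W 3 2 \<or> upper_central G s = W 2 2 \<or>
      upper_central G s = W 2 1 \<or> upper_central G s = W 1 1 \<or> upper_central G s = W 1 0"
      using u1 u2 u3 u4 u5 u6 by blast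
    moreover have "(0::nat) < 3 \<and> 3 \<le> v" "(0::nat) < 2 \<and> 2 \<le> v" "(0::nat) < 1 \<and> 1 \<le> v" "0 \<le> v"
      by (simp_all add: v)
    ultimately show "\<exists>a d. 0 < a \<and> a \<le> v \<and> d \<le> v \<and> upper_central G s = W a d" by metis
  qed
  have l1: "lower_central G 1 = upper_central G 7" by (simp add: u7 W_0_0 lower_central.simps)
  have l2: "lower_central G 2 = upper_central G 6"
    by (rule lower_central_odd_step[OF odd l1 _ _ _ u7 u6]) (simp_all add: m1 v)
  have l3: "lower_central G 3 = upper_central G 5"
    by (rule lower_central_odd_step[OF odd l2 _ _ _ u6 u5]) (simp_all add: m1 v)
  have l4: "lower_central G 4 = upper_central G 4"
    by (rule lower_central_odd_step[OF odd l3 _ _ _ u5 u4]) (simp_all add: m1 v)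
  have l5: "lower_central G 5 = upper_central G 3"
    by (rule lower_central_odd_step[OF odd l4 _ _ _ u4 u3]) (simp_all add: m1 v)
  have l6: "lower_central G 6 = upper_central G 2"
    by (rule lower_central_odd_step[OF odd l5 _ _ _ u3 u2]) (simp_all add: m1 v)
  have l7: "lower_central G 7 = upper_central G 1"
    by (rule lower_central_odd_step[OF odd l6 _ _ _ u2 u1]) (simp_all add: m1 v)
  have l8: "lower_central G 8 = upper_central G 0" by (rule lower_central_last[OF l7]) simp_all
  have low: "lower_central G i = upper_central G (8 - i)" if "i \<in> {1..8}" for i
  proof -
    have "i = 1 \<or> i = 2 \<or> i = 3 \<or> i = 4 \<or> i = 5 \<or> i = 6 \<or> i = 7 \<or> i = 8" using that by auto
    then show ?thesis by (elim disjE) (simp_all add: l1[unfolded One_nat_def] l2 l3 l4 l5 l6 l7 l8)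
  qed
  note g = u1[THEN upper_central_generate, unfolded pw] u2[THEN upper_central_generate, unfolded pw]
    u3[THEN upper_central_generate, unfolded pw] u4[THEN upper_central_generate, unfolded pw]
    u5[THEN upper_central_generate, unfolded pw] u6[THEN upper_central_generate, unfolded pw]
  show ?thesis
    using nilp low g generate_q_q generate_q[of 9] unfolding q by simp
qed

lemma normal_generateI':
  assumes U: "U \<subseteq> carrier G"
    and c: "\<And>w. w \<in> U \<Longrightarrow> commutator G w A \<in> generate G U \<and> commutator G w B \<in> generate G U"
  shows "generate G U \<lhd> G"
proof (rule normal_generate_commutators[OF _ generate_eq _ U])
  have "inv x = x [^] (Q - 1)" if "x \<in> carrier G" "x [^] Q = \<one>" for x
  proof -
    have "x [^] (Q - 1) \<otimes> x = \<one>" using pow_complement(1)[OF that Q_pos, of 1] that(1) by simp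
    then show ?thesis using that(1) by (simp add: inv_equality)
  qed
  then show "\<exists>n::nat. inv s = s [^] n" if "s \<in> {A, B}" for s using that A_pow_Q B_pow_Q A B by blast
qed (use c in auto)

lemma lower_central_generateI:
  assumes low: "lower_central G j = generate G U" and U: "U \<subseteq> carrier G" and j: "j \<ge> 1" "j' = Suc j"
    and V: "generate G V \<lhd> G" "V \<subseteq> lower_central G j'"
    and c: "\<And>w. w \<in> U \<Longrightarrow> commutator G w A \<in> generate G V \<and> commutator G w B \<in> generate G V"
  shows "lower_central G j' = generate G V"
proof -
  obtain i where i: "j = Suc i" using j(1) by (cases j) auto
  have "lower_central G (Suc (Suc i)) \<subseteq> generate G V"
    by (rule lower_central_Suc_le[OF V(1) _ generate_eq U]) (use c low i in auto)
  moreover have "generate G V \<subseteq> lower_central G (Suc (Suc i))"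
    using V(2) unfolding i j(2) by (intro generate_subgroup_incl lower_central_subgroup)
  ultimately show ?thesis unfolding i j(2) by blast
qed

lemma commutator_A_mem:
  assumes "subgroup H G" "A [^] (d::nat) \<in> H" "d dvd qnum b n - n" "C [^] n \<in> H"
  shows "commutator G (A [^] n) A \<in> H \<and> commutator G (A [^] n) B \<in> H"
  using assms pow_dvd_mem[OF assms(1) A assms(2,3)] commutator_pow_self[OF A]
  by (simp add: commutator_A_pow_B[OF qnum_eq_add] subgroup.one_closed subgroup.m_closed)

lemma commutator_B_mem:
  assumes "subgroup H G" "B [^] (d::nat) \<in> H" "d dvd qnum b n - n" "C [^] n \<in> H"
  shows "commutator G (B [^] n) A \<in> H \<and> commutator G (B [^] n) B \<in> H"
  using assms pow_dvd_mem[OF assms(1) B assms(2,3)] commutator_pow_self[OF B]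
  by (simp add: commutator_B_pow_A[OF qnum_eq_add] subgroup.one_closed subgroup.m_closed subgroup.m_inv_closed)

lemma commutator_C_mem:
  assumes H: "subgroup H G" and AB: "A [^] (p ^ a) \<in> H" "B [^] (p ^ a) \<in> H" and a: "a \<le> v + m"
    and k: "p ^ (a - m) dvd k"
  shows "commutator G (C [^] k) A \<in> H \<and> commutator G (C [^] k) B \<in> H"
proof -
  obtain t where t: "[b ^ k * t = b ^ k - 1] (mod Q)" using inverse_power_unit by blast
  have d: "p ^ a dvd b ^ k - 1" unfolding dvd_power_iff' by (rule k)
  then have dt: "p ^ a dvd t" unfolding p_dvd_of_unit_cong[OF t a] .
  have "commutator G (C [^] k) A \<in> H"
    unfolding commutator_C_pow_A'[OF power_eq_add t] by (rule pow_dvd_mem[OF H A AB(1) dt])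
  moreover have "commutator G (C [^] k) B \<in> H"
    unfolding commutator_C_pow_B[OF power_eq_add]
    by (intro subgroup.m_inv_closed[OF H] pow_dvd_mem[OF H B AB(2) d])
  ultimately show ?thesis ..
qed

lemma inv_B_pow_q: "q dvd n \<Longrightarrow> inv (B [^] n) = A [^] n"
proof -
  assume "q dvd n"
  then obtain k where n: "n = q * k" by blast
  have "A [^] n \<otimes> B [^] n = A [^] (q * k) \<otimes> A [^] ((Q - 1) * (q * k))"
    by (simp add: n B_q mult.assoc nat_pow_pow flip: nat_pow_pow[of B q])
  also have "\<dots> = \<one>" by (rule pow_complement(2)[OF A A_pow_Q Q_pos])
  finally show ?thesis by (simp add: inv_equality)
qed

lemma commutator_central_mult:
  assumes "z \<in> carrier G" "x \<in> carrier G" "y \<in> carrier G"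
    and "z \<otimes> x = x \<otimes> z" "z \<otimes> y = y \<otimes> z"
  shows "commutator G (z \<otimes> x) y = commutator G x y"
proof -
  have "commutator G (z \<otimes> x) y = inv (z \<otimes> x) \<otimes> (inv y \<otimes> z \<otimes> x \<otimes> y)"
    using assms(1-3) by (simp add: commutator_def m_assoc)
  also have "inv y \<otimes> z = z \<otimes> inv y" using commutes_inv[OF assms(1,3,5)] by simp
  also have "inv (z \<otimes> x) \<otimes> (z \<otimes> inv y \<otimes> x \<otimes> y) = commutator G x y"
    using assms(1-3) by (simp add: commutator_def inv_mult_group m_assoc inv_mult_cancel_left)
  finally show ?thesis .
qed

lemma power_max_dvd_iff: "p ^ max a c dvd n \<longleftrightarrow> p ^ a dvd n \<and> p ^ c dvd n"
proof (cases "a \<le> c")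
  case True
  then show ?thesis using dvd_trans[OF le_imp_power_dvd[OF True, of p]] by (auto simp: max_absorb2)
next
  case False
  then have "c \<le> a" by simp
  then show ?thesis using dvd_trans[OF le_imp_power_dvd[of c a p]] by (auto simp: max_absorb1)
qed

text \<open>By \<open>qnum_two\<close>, which needs c \<ge> 1, [i] - i = -2^(m-1) i modulo 2^(c+m)
  and so modulo 2^a. Hence 2^a divides it exactly when 2^(a-(m-1)) divides i; this condition on i is
  added to 2^c dvd i, and the maximum results.\<close>

lemma upper_central_two_step:
  assumes p: "p = 2" and W: "upper_central G s = W a c" "a \<le> v" "c \<le> v"
    and c: "1 \<le> c" "a \<le> c + m" "m - 1 \<le> a" and t: "t = Suc s" and a': "a' = max c (a - (m - 1))" "d = a - m"
  shows "upper_central G t = W a' d"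
  unfolding a'(2)
proof (rule upper_central_W_step[OF W t])
  fix i
  have "p ^ a dvd qnum b i - i \<longleftrightarrow> p ^ (a - (m - 1)) dvd i" if i: "p ^ c dvd i"
  proof -
    have "2 ^ (c + m) dvd int (qnum b i) - int i + 2 ^ (m - 1) * int i"
      using qnum_two[OF p _ c(1)] i p by simp
    then have "2 ^ a dvd int (qnum b i) - int i + 2 ^ (m - 1) * int i"
      using c(2) by (meson dvd_trans le_imp_power_dvd)
    then have "int (2 ^ a) dvd int (qnum b i - i) + int (2 ^ (m - 1) * i)"
      by (simp add: int_qnum_diff)
    then have "2 ^ a dvd (qnum b i - i) + 2 ^ (m - 1) * i" by (metis int_dvd_int_iff of_nat_add)
    then have "2 ^ a dvd qnum b i - i \<longleftrightarrow> 2 ^ a dvd 2 ^ (m - 1) * i"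
      by (metis dvd_add_left_iff dvd_add_right_iff)
    also have "\<dots> \<longleftrightarrow> 2 ^ (a - (m - 1)) dvd i"
    proof -
      have "(2::nat) ^ a = 2 ^ (m - 1) * 2 ^ (a - (m - 1))" using c(3) by (simp flip: power_add)
      then show ?thesis by simp
    qed
    finally show ?thesis by (simp add: p)
  qed
  moreover have "p ^ a' dvd i \<longleftrightarrow> p ^ c dvd i \<and> p ^ (a - (m - 1)) dvd i"
    unfolding a'(1) by (rule power_max_dvd_iff)
  ultimately show "p ^ c dvd i \<and> p ^ a dvd qnum b i - i \<longleftrightarrow> p ^ a' dvd i" by blast
qed

text \<open>The lower central terms do not come out as the upper ones here. Each is enclosed from
  two sides by \<open>lower_central_generateI\<close>: commutators of the old generators lie in the
  normal subgroup of the new ones, and the new generators arise as commutators.\<close>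

theorem central_series_two:
  assumes p: "p = 2" and v: "v = 2 * m - 1"
  shows "has_nilpotency_class G 5 \<and>
    upper_central G 1 = generate G {A [^] ((2::nat) ^ (2 * m - 1))} \<and>
    upper_central G 2 = generate G {A [^] ((2::nat) ^ (2 * m - 1)), C [^] ((2::nat) ^ (m - 1))} \<and>
    upper_central G 3 =
      generate G {A [^] ((2::nat) ^ m), B [^] ((2::nat) ^ m), C [^] ((2::nat) ^ (m - 1))} \<and>
    upper_central G 4 = generate G {A [^] ((2::nat) ^ (m - 1)), B [^] ((2::nat) ^ (m - 1)), C} \<and>
    lower_central G 2 = generate G {A [^] ((2::nat) ^ m), B [^] ((2::nat) ^ m), C} \<and>
    lower_central G 3 = generate G {A [^] ((2::nat) ^ m), B [^] ((2::nat) ^ m), C [^] ((2::nat) ^ m)} \<and>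
    lower_central G 4 = generate G {A [^] ((2::nat) ^ (2 * m)), commutator G A (B [^] ((2::nat) ^ m))} \<and>
    lower_central G 5 = generate G {A [^] ((2::nat) ^ (2 * m))}"
proof -
  have m2: "m \<ge> 2" using p2 p by simp
  have q: "q = 2 ^ (2 * m - 1)" unfolding q_def unfolding v p ..
  have pp: "p ^ n = 2 ^ n" for n by (simp add: p)
  have u1: "upper_central G 1 = W (2 * m - 1) (2 * m - 1)" using upper_central_1 by (simp add: v)
  have u2: "upper_central G 2 = W (2 * m - 1) (m - 1)"
    by (rule upper_central_two_step[OF p u1]) (use v m2 in auto)
  have u3: "upper_central G 3 = W m (m - 1)"
    by (rule upper_central_two_step[OF p u2]) (use v m2 in auto)
  have u4: "upper_central G 4 = W (m - 1) 0"
    by (rule upper_central_two_step[OF p u3]) (use v m2 in auto)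
  \<comment> \<open>Now c = 0 and \<open>upper_central_two_step\<close> does not apply. But p^m
    divides [i] - i for every i, so no condition on i is left; the subtraction (m - 1) - m is
    truncated to 0.\<close>
  have "upper_central G 5 = W 0 ((m - 1) - m)"
  proof (rule upper_central_W_step[OF u4])
    show "p ^ 0 dvd i \<and> p ^ (m - 1) dvd qnum b i - i \<longleftrightarrow> p ^ 0 dvd i" for i
      using dvd_trans[OF le_imp_power_dvd[of "m - 1" m p] power_diff_dvd[of i]] by simp
  qed (use v m2 in auto)
  then have u5: "upper_central G 5 = W 0 0" by simp
  have nilp: "has_nilpotency_class G 5"
  proof (rule nilpotency_classI[OF u5])
    fix s :: nat assume "0 < s" "s < 5"
    then have "s = 1 \<or> s = 2 \<or> s = 3 \<or> s = 4" by auto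
    then have "upper_central G s = W (2 * m - 1) (2 * m - 1) \<or> upper_central G s = W (2 * m - 1) (m - 1) \<or>
      upper_central G s = W m (m - 1) \<or> upper_central G s = W (m - 1) 0" using u1 u2 u3 u4 by blast
    moreover have "0 < 2 * m - 1 \<and> 2 * m - 1 \<le> v" "0 < m \<and> m \<le> v" "0 < m - 1 \<and> m - 1 \<le> v" "0 \<le> v"
      using m2 v by auto
    ultimately show "\<exists>a d. 0 < a \<and> a \<le> v \<and> d \<le> v \<and> upper_central G s = W a d" by metis
  qed
  have upper: "upper_central G 1 = generate G {A [^] q}" "upper_central G 2 = generate G {A [^] q, C [^] ((2::nat) ^ (m - 1))}"
    using u1[THEN upper_central_generate] u2[THEN upper_central_generate] generate_q_q generate_q[of "2 ^ (m - 1)"]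
    unfolding pp q by simp_all

  define x where "x = (2::nat) ^ m"
  define n where "n = qnum b x - x"
  \<comment> \<open>D equals both [A^x, B] and [A, B^x]. It is the second generator of the fourth
    lower central term, and it differs from C^x by the central element A^n.\<close>
  define D where "D = A [^] n \<otimes> C [^] x"
  have xp: "x = p ^ m" by (simp add: x_def p)
  have x0: "C = C [^] (p ^ 0)" by simp
  have xn: "x dvd n" unfolding n_def xp by (rule power_diff_dvd)
  \<comment> \<open>[x] - x = -2^(m-1) x = -2^(2m-1) modulo 2^(2m), so q divides n, and A^n is
    central.\<close>
  have qn: "q dvd n"
  proof -
    have "int x dvd int (2 ^ m)" by (simp add: x_def)
    have "2 ^ (m + m) dvd int (qnum b x) - int x + 2 ^ (m - 1) * int x"
      using qnum_two[OF p, of m x] m2 by (simp add: x_def)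
    moreover have "(2::int) ^ (2 * m - 1) dvd 2 ^ (m + m)" by (intro le_imp_power_dvd) simp
    ultimately have "2 ^ (2 * m - 1) dvd int n + 2 ^ (m - 1) * int x"
      unfolding n_def int_qnum_diff by (rule dvd_trans[rotated])
    moreover have "2 ^ (m - 1) * int x = 2 ^ (2 * m - 1)"
      using m2 by (simp add: x_def mult_2 flip: power_add)
    ultimately have "2 ^ (2 * m - 1) dvd int n" by (simp add: dvd_add_left_iff)
    then have "int (2 ^ (2 * m - 1)) dvd int n" by simp
    then show ?thesis unfolding q int_dvd_int_iff .
  qed
  have qx: "q dvd 2 ^ (2 * m)" unfolding q by (intro le_imp_power_dvd) simp
  have Dc: "D \<in> carrier G" by (simp add: D_def)
  have AB: "commutator G A B = C"
    using commutator_A_pow_B[of 1 0] by simp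
  have AxB: "commutator G (A [^] x) B = D"
    unfolding D_def n_def by (rule commutator_A_pow_B[OF qnum_eq_add])
  have BxA: "commutator G (B [^] x) A = inv D"
  proof -
    have "inv (commutator G (B [^] x) A) = C [^] x \<otimes> inv (B [^] n)"
      unfolding commutator_B_pow_A[OF qnum_eq_add] n_def by (simp add: inv_mult_group)
    also have "\<dots> = D" unfolding inv_B_pow_q[OF qn] D_def by (rule A_pow_q_central[OF qn]) simp
    finally show ?thesis by (metis inv_inv commutator_closed A B nat_pow_closed)
  qed
  then have ABx: "commutator G A (B [^] x) = D"
    using inv_commutator[of "B [^] x" A] Dc by simp

  let ?U2 = "{A [^] x, B [^] x, C}" and ?U3 = "{A [^] x, B [^] x, C [^] x}"
    and ?U4 = "{A [^] (p ^ (2 * m)), D}" and ?U5 = "{A [^] (p ^ (2 * m))}"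
  have c: "?U2 \<subseteq> carrier G" "?U3 \<subseteq> carrier G" "?U4 \<subseteq> carrier G" "?U5 \<subseteq> carrier G" using Dc by auto
  note sub = c[THEN generate_is_subgroup]
  have inc: "w \<in> U \<Longrightarrow> w \<in> generate G U" for w U by (rule generate.incl)
  have B2: "B [^] (p ^ (2 * m)) \<in> H" if H: "subgroup H G" "A [^] (p ^ (2 * m)) \<in> H" for H
    using inv_B_pow_q[OF qx] subgroup.m_inv_closed[OF H] by (metis pp B inv_inv nat_pow_closed)
  have Am: "m \<le> v + m" "2 * m \<le> v + m" using v m2 by auto

  have comm_C: "commutator G C A \<in> H \<and> commutator G C B \<in> H"
    if "subgroup H G" "A [^] x \<in> H" "B [^] x \<in> H" for H
    using commutator_C_mem[OF that(1) _ _ Am(1), of 1] that(2,3) by (simp add: xp)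
  have comm_Cx: "commutator G (C [^] x) A \<in> H \<and> commutator G (C [^] x) B \<in> H"
    if H: "subgroup H G" "A [^] (p ^ (2 * m)) \<in> H" for H
    using commutator_C_mem[OF H(1) H(2) B2[OF H] Am(2), of x] by (simp add: xp)
  have comm_A2: "commutator G (A [^] (p ^ (2 * m))) g = \<one>" if g: "g \<in> {A, B}" for g
  proof -
    have gc: "g \<in> carrier G" using g by auto
    have "g [^] (1::nat) \<otimes> A [^] (p ^ (2 * m)) = A [^] (p ^ (2 * m)) \<otimes> g [^] (1::nat)"
      by (rule A_pow_q_central) (use qx g in \<open>auto simp: p\<close>)
    then have "commutator G (A [^] (p ^ (2 * m)) \<otimes> \<one>) g = commutator G \<one> g"
      using gc by (intro commutator_central_mult) auto
    then show ?thesis using gc by (simp add: commutator_def)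
  qed
  \<comment> \<open>A central factor does not affect commutators, so those of D are those of
    C^x.\<close>
  have comm_D: "commutator G D g = commutator G (C [^] x) g" if g: "g \<in> {A, B}" for g
    unfolding D_def
  proof (rule commutator_central_mult)
    show "A [^] n \<otimes> C [^] x = C [^] x \<otimes> A [^] n" using A_pow_q_central[OF qn, of C x] by simp
    show "A [^] n \<otimes> g = g \<otimes> A [^] n" using A_pow_q_central[OF qn, of g 1] g by auto
  qed (use g in auto)
  have comm_3: "commutator G w A \<in> generate G ?U3 \<and> commutator G w B \<in> generate G ?U3" if w: "w \<in> insert C ?U3" for w
  proof -
    have g: "A [^] x \<in> generate G ?U3" "B [^] x \<in> generate G ?U3" "C [^] x \<in> generate G ?U3"
      by (auto intro: generate.incl)
    have "A [^] (p ^ (2 * m)) \<in> generate G ?U3"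
      by (rule pow_dvd_mem[OF sub(2) A g(1)]) (simp add: xp le_imp_power_dvd)
    from comm_Cx[OF sub(2) this] show ?thesis
      using w comm_C[OF sub(2) g(1,2)] commutator_A_mem[OF sub(2) g(1) xn[unfolded n_def] g(3)]
        commutator_B_mem[OF sub(2) g(2) xn[unfolded n_def] g(3)] by blast
  qed
  have comm_2: "commutator G w A \<in> generate G ?U2 \<and> commutator G w B \<in> generate G ?U2" if w: "w \<in> ?U2" for w
  proof -
    have "C [^] x \<in> generate G ?U2" by (rule subgroup_pow_closed[OF sub(1)]) (auto intro: generate.incl)
    then have "?U3 \<subseteq> generate G ?U2" by (auto intro: generate.incl)
    then have "generate G ?U3 \<subseteq> generate G ?U2" by (intro generate_subgroup_incl sub)
    then show ?thesis using comm_3[of w] w by blast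
  qed
  have comm_5: "commutator G w A \<in> generate G ?U5 \<and> commutator G w B \<in> generate G ?U5" if w: "w \<in> insert (C [^] x) ?U4" for w
  proof -
    have "A [^] (p ^ (2 * m)) \<in> generate G ?U5" by (rule inc) simp
    note 1 = comm_Cx[OF sub(4) this]
    then have "commutator G D A \<in> generate G ?U5 \<and> commutator G D B \<in> generate G ?U5" using comm_D by simp
    moreover have "commutator G (A [^] (p ^ (2 * m))) A \<in> generate G ?U5 \<and>
        commutator G (A [^] (p ^ (2 * m))) B \<in> generate G ?U5"
      using comm_A2 subgroup.one_closed[OF sub(4)] by simp
    ultimately show ?thesis using w 1 by blast
  qed
  have comm_4: "commutator G w A \<in> generate G ?U4 \<and> commutator G w B \<in> generate G ?U4" if w: "w \<in> insert (C [^] x) ?U4" for w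
    using comm_5[OF w] mono_generate[of ?U5 ?U4] by blast
  have comm_34: "commutator G w A \<in> generate G ?U4 \<and> commutator G w B \<in> generate G ?U4" if w: "w \<in> ?U3" for w
  proof -
    have D: "D \<in> generate G ?U4" by (rule inc) simp
    have "commutator G (A [^] x) A \<in> generate G ?U4 \<and> commutator G (A [^] x) B \<in> generate G ?U4"
      using AxB D commutator_pow_self[OF A, of x] subgroup.one_closed[OF sub(3)] by simp
    moreover have "commutator G (B [^] x) A \<in> generate G ?U4 \<and> commutator G (B [^] x) B \<in> generate G ?U4"
      using BxA subgroup.m_inv_closed[OF sub(3) D] commutator_pow_self[OF B, of x] subgroup.one_closed[OF sub(3)]
      by simp
    ultimately show ?thesis using w comm_4[of "C [^] x"] by blast
  qed

  have l1: "lower_central G 1 = generate G {A, B}" using generate_eq by (simp add: lower_central.simps)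
  have C1: "C [^] (p ^ 0) \<in> lower_central G (Suc 0)" by (simp add: lower_central.simps)
  have v0: "0 < v" "m < v" using v m2 by auto
  have l2: "lower_central G 2 = generate G ?U2"
  proof (rule lower_central_generateI[OF l1])
    show "generate G ?U2 \<lhd> G" by (rule normal_generateI'[OF c(1) comm_2])
    have "C \<in> lower_central G (Suc (Suc 0))"
      using commutator_in_lower_central(1)[OF A, of B 0] AB by (simp add: lower_central.simps(2))
    then show "?U2 \<subseteq> lower_central G 2"
      using lower_central_C_pow[OF C1 v0(1)] by (simp add: xp numeral_2_eq_2)
    show "commutator G w A \<in> generate G ?U2 \<and> commutator G w B \<in> generate G ?U2" if "w \<in> {A, B}" for w
    proof -
      have 1: "C \<in> generate G ?U2" by (auto intro: generate.incl)
      have "commutator G B A = inv C" using inv_commutator[OF A B] AB by simp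
      then show ?thesis
        using that AB 1 subgroup.m_inv_closed[OF sub(1) 1] subgroup.one_closed[OF sub(1)]
          commutator_pow_self[OF A, of 1] commutator_pow_self[OF B, of 1] by auto
    qed
  qed auto
  have A2: "A [^] x \<in> lower_central G (Suc 1)" and C2: "C [^] (p ^ 0) \<in> lower_central G (Suc 1)"
    using inc[of _ ?U2] l2 by (simp_all add: numeral_2_eq_2)
  have l3: "lower_central G 3 = generate G ?U3"
  proof (rule lower_central_generateI[OF l2 c(1)])
    show "generate G ?U3 \<lhd> G" by (rule normal_generateI'[OF c(2) comm_3]) blast
    have AB3: "A [^] x \<in> lower_central G (Suc (Suc 1))" "B [^] x \<in> lower_central G (Suc (Suc 1))"
      using lower_central_C_pow[OF C2 v0(1)] by (simp_all add: xp)
    have "C [^] x \<in> lower_central G (Suc (Suc 1))"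
      by (rule lower_central_C_from_A[OF A2 AB3(1) xn[unfolded n_def]])
    then show "?U3 \<subseteq> lower_central G 3" using AB3 by (simp add: numeral_3_eq_3)
    show "commutator G w A \<in> generate G ?U3 \<and> commutator G w B \<in> generate G ?U3" if "w \<in> ?U2" for w
      using comm_3[of w] that by blast
  qed auto
  have A3: "A [^] x \<in> lower_central G (Suc 2)" and C3: "C [^] (p ^ m) \<in> lower_central G (Suc 2)"
    using inc[of _ ?U3] l3 by (simp_all add: xp)
  have l4: "lower_central G 4 = generate G ?U4"
  proof (rule lower_central_generateI[OF l3 c(2)])
    show "generate G ?U4 \<lhd> G" by (rule normal_generateI'[OF c(3) comm_4]) blast
    have "A [^] (p ^ (2 * m)) \<in> lower_central G (Suc (Suc 2))"
      using lower_central_C_pow(1)[OF C3 v0(2)] by (simp add: mult_2)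
    moreover have "D \<in> lower_central G (Suc (Suc 2))"
      unfolding D_def n_def by (rule lower_central_A_pow[OF A3])
    ultimately show "?U4 \<subseteq> lower_central G 4" by simp
  qed (use comm_34 in auto)
  have D4: "D \<in> lower_central G (Suc 3)" using inc[of D ?U4] l4 by simp
  have l5: "lower_central G 5 = generate G ?U5"
  proof (rule lower_central_generateI[OF l4 c(3)])
    show "generate G ?U5 \<lhd> G" by (rule normal_generateI'[OF c(4) comm_5]) blast
    have "commutator G (C [^] (p ^ m)) A \<in> lower_central G (Suc (Suc 3))"
      using commutator_in_lower_central(2)[OF A D4] comm_D[of A] by (simp add: xp)
    from commutator_C_pow_mem(1)[OF lower_central_subgroup v0(2) this]
    show "?U5 \<subseteq> lower_central G 5" by (simp add: mult_2)
  qed (use comm_5 in auto)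
  show ?thesis
    using nilp upper l2 l3 l4 l5 u3[THEN upper_central_generate] u4[THEN upper_central_generate]
    unfolding q ABx[unfolded x_def] pp x_def by simp
qed

end

section \<open>Valuations in the three cases\<close>

text \<open>For b = 1 + e this is 6 times [b] - b, the exponent y of \<open>key_relation\<close> for
  n = 1; the factor 6 clears the denominators of the binomial coefficients.\<close>

lemma six_qnum_Suc:
  "\<exists>r. 6 * (int (qnum (Suc e) (Suc e)) - int (Suc e))
    = 3 * int e ^ 2 * (1 + int e) + int e ^ 3 * (int e ^ 2 - 1) + 6 * int e ^ 3 * r"
proof -
  define N where "N = Suc e"
  define x where "x = int e"
  have N: "int N = 1 + x" by (simp add: N_def x_def)
  obtain r where r: "int (qnum (Suc e) N) = int N + x * c2 (int N) + x ^ 2 * c3 (int N) + x ^ 3 * r"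
    using qnum_expansion[of e N] unfolding x_def by blast
  have "6 * (int (qnum (Suc e) N) - int N) = 3 * x * (2 * c2 (int N)) + x ^ 2 * (6 * c3 (int N)) + 6 * x ^ 3 * r"
    unfolding r by (simp add: algebra_simps)
  also have "\<dots> = 3 * x ^ 2 * (1 + x) + x ^ 3 * (x ^ 2 - 1) + 6 * x ^ 3 * r"
    unfolding two_c2 six_c3 N by (simp add: algebra_simps eval_nat_numeral)
  finally show ?thesis unfolding N_def x_def by blast
qed

text \<open>Denominators are cleared by 24, the right side acquires a factor 27, and cancelling 3
  leaves 8, a unit at the prime 3. The cubic term of the expansion is needed since e is divisible by
  3 only once in the application.\<close>

lemma eight_qnum_Suc:
  assumes e: "int e = 3 * E" and N: "int N = 1 + 3 * M"
  shows "\<exists>r. 8 * (int (qnum (Suc e) N) - int N) = 9 * (4 * E * int N * M * (1 + E * (int N - 2))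
    + 3 * E ^ 3 * int N * M * (int N - 2) * (int N - 3) + 9 * r)"
proof -
  obtain r where r: "int (qnum (Suc e) N) = int N + int e * c2 (int N) + int e ^ 2 * c3 (int N)
    + int e ^ 3 * c4 (int N) + int e ^ 4 * r"
    using qnum_expansion4[of e N] by blast
  have "24 * (int (qnum (Suc e) N) - int N) = 12 * int e * (2 * c2 (int N)) + 4 * int e ^ 2 * (6 * c3 (int N))
     + int e ^ 3 * (24 * c4 (int N)) + 24 * int e ^ 4 * r"
    unfolding r by (simp add: algebra_simps)
  also have "\<dots> = 27 * (4 * E * int N * M * (1 + E * (int N - 2))
    + 3 * E ^ 3 * int N * M * (int N - 2) * (int N - 3) + 9 * (8 * E ^ 4 * r))"
    unfolding two_c2 six_c3 c4_eq e N by (simp add: algebra_simps eval_nat_numeral)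
  finally have "8 * (int (qnum (Suc e) N) - int N) = 9 * (4 * E * int N * M * (1 + E * (int N - 2))
    + 3 * E ^ 3 * int N * M * (int N - 2) * (int N - 3) + 9 * (8 * E ^ 4 * r))" by simp
  then show ?thesis by blast
qed

context padic_base
begin

lemma key_from_multiple:
  assumes "int D * int y = int p ^ v * z" "coprime D p" "\<not> int p dvd z"
  shows "\<exists>c. y = p ^ v * c \<and> \<not> p dvd c"
proof -
  have "int (p ^ v) dvd int D * int y" unfolding assms(1) by simp
  then have "p ^ v dvd D * y" by (metis int_dvd_int_iff of_nat_mult)
  moreover have "coprime (p ^ v) D" using assms(2) by (simp add: coprime_commute)
  ultimately have "p ^ v dvd y" by (simp add: coprime_dvd_mult_right_iff)
  then obtain c where c: "y = p ^ v * c" by blast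
  have "int p ^ v * (int D * int c) = int p ^ v * z" using assms(1) by (simp add: c mult_ac)
  then have "z = int D * int c" using p_pos by simp
  then have "\<not> p dvd c" using assms(3) by auto
  then show ?thesis using c by blast
qed

lemma six_qnum_b: "\<exists>r. 6 * int (qnum b b - b) = 3 * int e ^ 2 * (1 + int e) + int e ^ 3 * (int e ^ 2 - 1) + 6 * int e ^ 3 * r"
  using six_qnum_Suc[of e] unfolding int_qnum_diff unfolding b_def .

lemma e_square: "int e ^ 2 = int p ^ (2 * m) * int u ^ 2"
  by (simp add: e_def power_mult_distrib mult.commute flip: power_mult)

lemma p_not_dvd_u_square: "\<not> int p dvd int u ^ 2"
  using u p by (metis int_dvd_int_iff of_nat_power prime_dvd_power)

lemma keyI: "\<exists>c. qnum b (b ^ n) - b ^ n = p ^ v * c \<and> \<not> p dvd c \<Longrightarrow>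
    \<exists>n c. qnum b (b ^ n) = b ^ n + p ^ v * c \<and> \<not> p dvd c"
  using qnum_eq_add[of "b ^ n"] by metis

text \<open>For p > 3 the term 3 e^2 dominates and the valuation is 2m. For p = 3 the contribution
  -e^3 competes: after division by 3 there remains e^2 times 1 - e/3 modulo 3, and this factor
  vanishes exactly when m = 1 and u = 1 modulo 3.\<close>

lemma key_generic:
  assumes "p > 3 \<or> p = 3 \<and> (m > 1 \<or> u mod 3 = 2)"
  shows "\<exists>n c. qnum b (b ^ n) = b ^ n + p ^ (2 * m) * c \<and> \<not> p dvd c"
proof (rule keyI[of 1], unfold power_one_right)
  obtain r where r: "6 * int (qnum b b - b) = 3 * int e ^ 2 * (1 + int e) + int e ^ 3 * (int e ^ 2 - 1) + 6 * int e ^ 3 * r"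
    using six_qnum_b by blast
  show "\<exists>c. qnum b b - b = p ^ (2 * m) * c \<and> \<not> p dvd c"
  proof (cases "p = 3")
    case False
    then have p3: "p > 3" using assms by blast
    define s where "s = 3 + (int e ^ 2 - 1) + 6 * r"
    have "int 6 * int (qnum b b - b) = int p ^ (2 * m) * (int u ^ 2 * (3 + int e * s))"
      using r unfolding s_def mult.assoc[symmetric] e_square[symmetric] by (simp add: algebra_simps power2_eq_square power3_eq_cube)
    moreover have "coprime 6 p"
    proof -
      have "prime (2::nat)" "prime (3::nat)" by simp_all
      then have "coprime 2 p" "coprime 3 p" using p3 p by (intro primes_coprime; simp)+
      then have "coprime (2 * 3) p" using coprime_mult_left_iff by blast
      then show ?thesis by simp
    qed
    moreover have "\<not> int p dvd int u ^ 2 * (3 + int e * s)"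
    proof
      assume "int p dvd int u ^ 2 * (3 + int e * s)"
      then have "int p dvd 3 + int e * s" using p_not_dvd_u_square prime_int_p prime_dvd_mult_iff by blast
      moreover have "int p dvd int e * s" using m by (auto simp: e_def intro!: dvd_mult2 dvd_power)
      ultimately have "int p dvd int 3" by (simp add: dvd_add_left_iff)
      then show False using p3 dvd_imp_le[of p 3] unfolding int_dvd_int_iff by simp
    qed
    ultimately show ?thesis by (rule key_from_multiple)
  next
    case True
    define f where "f = 3 ^ (m - 1) * int u"
    have ef: "int e = 3 * f"
      using m unfolding e_def unfolding True f_def by (cases m) auto
    define s where "s = f + 3 * f ^ 3 + 2 * f * r"
    have "3 * (int 2 * int (qnum b b - b)) = 3 * (int e ^ 2 * (1 - f + 3 * s))"
      using r unfolding s_def ef by (simp add: algebra_simps power2_eq_square power3_eq_cube power_def)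
    then have "int 2 * int (qnum b b - b) = int p ^ (2 * m) * (int u ^ 2 * (1 - f + 3 * s))"
      unfolding e_square by simp
    moreover have "coprime 2 p" unfolding True by simp
    moreover have "\<not> int p dvd int u ^ 2 * (1 - f + 3 * s)"
    proof
      assume "int p dvd int u ^ 2 * (1 - f + 3 * s)"
      then have "int p dvd 1 - f + 3 * s" using p_not_dvd_u_square prime_int_p prime_dvd_mult_iff by blast
      then have 3: "3 dvd 1 - f" by (simp add: True dvd_add_left_iff)
      show False
      proof (cases "m > 1")
        case True
        then have "3 dvd f" by (auto simp: f_def intro!: dvd_mult2 dvd_power)
        then show False using 3 by presburger
      next
        case False
        then have "f = int u" "u mod 3 = 2" using m assms True by (auto simp: f_def)
        then show False using 3 by presburger
      qed
    qed
    ultimately show ?thesis by (rule key_from_multiple)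
  qed
qed

text \<open>Here 6 ([b] - b) is e^2 times an odd number, and cancelling the factor 2 of 6 lowers the
  valuation from 2m to 2m - 1.\<close>

lemma key_two:
  assumes p: "p = 2"
  shows "\<exists>n c. qnum b (b ^ n) = b ^ n + p ^ (2 * m - 1) * c \<and> \<not> p dvd c"
proof (rule keyI[of 1], unfold power_one_right)
  obtain r where r: "6 * int (qnum b b - b) = 3 * int e ^ 2 * (1 + int e) + int e ^ 3 * (int e ^ 2 - 1) + 6 * int e ^ 3 * r"
    using six_qnum_b by blast
  define s where "s = 3 + (int e ^ 2 - 1) + 6 * r"
  have "6 * int (qnum b b - b) = int e ^ 2 * (3 + int e * s)"
    unfolding r s_def by (simp add: algebra_simps power2_eq_square power3_eq_cube)
  also have "int e ^ 2 = 2 * (2 ^ (2 * m - 1) * int u ^ 2)"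
  proof -
    have "2 * m = Suc (2 * m - 1)" using m by simp
    then have "int p ^ (2 * m) = 2 * 2 ^ (2 * m - 1)" unfolding p by (metis of_nat_numeral power_Suc)
    then show ?thesis unfolding e_square by simp
  qed
  finally have "int 3 * int (qnum b b - b) = int p ^ (2 * m - 1) * (int u ^ 2 * (3 + int e * s))"
    by (simp add: p)
  moreover have "coprime 3 p" unfolding p by simp
  moreover have "\<not> int p dvd int u ^ 2 * (3 + int e * s)"
  proof
    assume "int p dvd int u ^ 2 * (3 + int e * s)"
    then have "int p dvd 3 + int e * s" using p_not_dvd_u_square prime_int_p prime_dvd_mult_iff by blast
    moreover have "2 dvd int e * s" using m unfolding e_def unfolding p by (auto intro!: dvd_mult2 dvd_power)
    ultimately have "2 dvd (3::int)" unfolding p by (simp add: dvd_add_left_iff)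
    then show False by simp
  qed
  ultimately show "\<exists>c. qnum b b - b = p ^ (2 * m - 1) * c \<and> \<not> p dvd c" by (rule key_from_multiple)
qed

text \<open>The exponent \<open>n = 1\<close> used in the other cases gives a multiple of \<open>81\<close> when \<open>9\<close>
  divides \<open>u - 1\<close>; then \<open>n = 2\<close> works.\<close>

lemma key_exceptional:
  assumes p3: "p = 3" and m1: "m = 1" and u1: "u mod 3 = 1"
  shows "\<exists>n c. qnum b (b ^ n) = b ^ n + p ^ 3 * c \<and> \<not> p dvd c"
proof -
  define E where "E = int u"
  have e: "int e = 3 * E" unfolding e_def unfolding p3 m1 E_def by simp
  have b: "int b = 1 + 3 * E" using e by (simp add: b_def)
  \<comment> \<open>The bracket of \<open>eight_qnum_Suc\<close> depends modulo 9 only on the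
    residues of E, b^n and M. Valuation 3 is reached as soon as its residue is 3 z with z prime to
    3, which is then checked by evaluation.\<close>
  have key: "\<exists>n c. qnum b (b ^ n) = b ^ n + p ^ 3 * c \<and> \<not> p dvd c"
    if N: "int (b ^ n) = 1 + 3 * M" and MN: "[int (b ^ n) = N'] (mod 9)" "[M = M'] (mod 9)" "[E = E'] (mod 9)"
      and z: "(4 * E' * N' * M' * (1 + E' * (N' - 2)) + 3 * E' ^ 3 * N' * M' * (N' - 2) * (N' - 3)) mod 9 = 3 * z"
        "\<not> 3 dvd z" for n M N' M' E' z
  proof (rule keyI[of n])
    obtain r where r: "8 * int (qnum b (b ^ n) - b ^ n) = 9 * (4 * E * int (b ^ n) * M * (1 + E * (int (b ^ n) - 2))
      + 3 * E ^ 3 * int (b ^ n) * M * (int (b ^ n) - 2) * (int (b ^ n) - 3) + 9 * r)"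
      using eight_qnum_Suc[OF e N] unfolding int_qnum_diff unfolding b_def by blast
    define X where "X = 4 * E * int (b ^ n) * M * (1 + E * (int (b ^ n) - 2))
      + 3 * E ^ 3 * int (b ^ n) * M * (int (b ^ n) - 2) * (int (b ^ n) - 3)"
    have "[X = 4 * E' * N' * M' * (1 + E' * (N' - 2)) + 3 * E' ^ 3 * N' * M' * (N' - 2) * (N' - 3)] (mod 9)"
      unfolding X_def by (intro cong_add cong_mult cong_pow cong_diff cong_refl MN)
    then have "X mod 9 = 3 * z" using z(1) by (simp add: cong_def)
    then have X: "X = 3 * z + 9 * (X div 9)" by presburger
    have "int 8 * int (qnum b (b ^ n) - b ^ n) = 9 * (X + 9 * r)" using r by (simp add: X_def)
    also have "\<dots> = int p ^ 3 * (z + 3 * (X div 9 + r))"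
      using X by (simp add: p3)
    finally have "int 8 * int (qnum b (b ^ n) - b ^ n) = int p ^ 3 * (z + 3 * (X div 9 + r))" .
    moreover have "coprime 8 p"
    proof -
      have "coprime (2 ^ 3) (3::nat)" by (subst coprime_power_left_iff) simp
      then show ?thesis by (simp add: p3)
    qed
    moreover have "\<not> int p dvd z + 3 * (X div 9 + r)" using z(2) by (simp add: p3 dvd_add_left_iff)
    ultimately show "\<exists>c. qnum b (b ^ n) - b ^ n = p ^ 3 * c \<and> \<not> p dvd c" by (rule key_from_multiple)
  qed
  have "u mod 9 = 1 \<or> u mod 9 = 4 \<or> u mod 9 = 7" using u1 by presburger
  then have "E mod 9 = 1 \<or> E mod 9 = 4 \<or> E mod 9 = 7"
    unfolding E_def using zmod_int[of u 9] by auto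
  then show ?thesis
  proof (elim disjE)
    assume "E mod 9 = 1"
    then have E: "[E = 1] (mod 9)" by (simp add: cong_def)
    define M where "M = 2 * E + 3 * E ^ 2"
    have "[M = 2 * 1 + 3 * 1 ^ 2] (mod 9)" unfolding M_def by (intro cong_add cong_mult cong_pow cong_refl E)
    moreover have "[(1 + 3 * E) ^ 2 = (1 + 3 * 1) ^ 2] (mod 9)" by (intro cong_add cong_mult cong_pow cong_refl E)
    moreover have "(1 + 3 * E) ^ 2 = 1 + 3 * M" unfolding M_def by (simp add: algebra_simps power2_eq_square)
    ultimately show ?thesis
      by (intro key[of 2 M "(1 + 3 * 1) ^ 2" "2 * 1 + 3 * 1 ^ 2" 1 2] E) (simp_all only: of_nat_power b, simp_all)
  next
    assume "E mod 9 = 4"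
    then have E: "[E = 4] (mod 9)" by (simp add: cong_def)
    have "[1 + 3 * E = 1 + 3 * 4] (mod 9)" by (intro cong_add cong_mult cong_refl E)
    then show ?thesis
      by (intro key[of 1 E "1 + 3 * 4" 4 4 2] E) (simp_all only: b power_one_right, simp_all)
  next
    assume "E mod 9 = 7"
    then have E: "[E = 7] (mod 9)" by (simp add: cong_def)
    have "[1 + 3 * E = 1 + 3 * 7] (mod 9)" by (intro cong_add cong_mult cong_refl E)
    then show ?thesis
      by (intro key[of 1 E "1 + 3 * 7" 7 7 1] E) (simp_all only: b power_one_right, simp_all)
  qed
qed

lemma model_generic:
  assumes "p > 3 \<or> p = 3 \<and> (m > 1 \<or> u mod 3 = 2)"
  shows "macdonald_model p m u (2 * m) 0"
proof -
  have odd: "odd p" using assms p prime_odd_nat[OF p] by linarith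
  have m3: "2 * m + m = 3 * m" by simp
  show ?thesis
  proof (intro macdonald_model.intro padic_base_axioms macdonald_model_axioms.intro,
      unfold m3 of_nat_0 mult_zero_left add_0_right)
    show "p ^ (2 * m) dvd n \<Longrightarrow> int p ^ (3 * m) dvd int (qnum b n) - int n" for n
      using qnum_odd[OF odd, of "2 * m" n] unfolding m3 .
  qed (rule key_generic[OF assms] model_relation_odd[OF odd])+
qed

lemma model_two:
  assumes p: "p = 2"
  shows "macdonald_model p m u (2 * m - 1) (2 ^ (m - 1))"
proof -
  have m3: "2 * m - 1 + m = 3 * m - 1" "2 * m - 1 \<ge> 1" using m by auto
  have p': "int p ^ a = 2 ^ a" "int (2 ^ a) = 2 ^ a" for a by (simp_all add: p)
  show ?thesis
  proof (intro macdonald_model.intro padic_base_axioms macdonald_model_axioms.intro, unfold m3(1) p')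
    show "p ^ (2 * m - 1) dvd n \<Longrightarrow> 2 ^ (3 * m - 1) dvd int (qnum b n) - int n + 2 ^ (m - 1) * int n" for n
      using qnum_two[OF p _ m3(2), of n] unfolding m3(1) unfolding p .
  qed (rule key_two[OF p] model_relation_two[OF p])+
qed

lemma model_exceptional:
  assumes "p = 3" "m = 1" "u mod 3 = 1"
  shows "macdonald_model p m u 3 0"
proof -
  have odd: "odd p" by (simp add: assms)
  have pw: "int p ^ (3 + m) = 81" "int p ^ 3 = 27" by (simp_all add: assms(1,2))
  show ?thesis
  proof (intro macdonald_model.intro padic_base_axioms macdonald_model_axioms.intro,
      unfold pw of_nat_0 mult_zero_left add_0_right)
    show "p ^ 3 dvd n \<Longrightarrow> 81 dvd int (qnum b n) - int n" for n
      using qnum_odd[OF odd, of 3 n] unfolding pw .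
  qed (rule key_exceptional[OF assms] model_relation_three[OF assms])+
qed

end

section \<open>The normal form in the Sylow subgroup\<close>

context group
begin

lemma int_pow_eq_of_cong:
  assumes "x \<in> carrier G" "x [^] (n::nat) = \<one>" "[i = j] (mod int n)"
  shows "x [^] (i::int) = x [^] j"
proof -
  have "int (ord x) dvd int n" using assms(1,2) pow_eq_id by simp
  then have "int (ord x) dvd j - i"
    using assms(3) by (metis cong_iff_dvd_diff cong_sym dvd_trans)
  then show ?thesis using assms(1) int_pow_eq by blast
qed

lemma conjugate_pow:
  assumes "x \<in> carrier G" "h \<in> carrier G"
  shows "conjugate G x h [^] (n::nat) = conjugate G (x [^] n) h"
proof (induction n)
  case (Suc n)
  have "conjugate G x h [^] Suc n = conjugate G (x [^] n) h \<otimes> conjugate G x h" by (simp add: Suc)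
  also have "\<dots> = conjugate G (x [^] Suc n) h"
    using assms inv_mult_cancel_left[of "inv h" "x \<otimes> h"] by (simp add: conjugate_def m_assoc)
  finally show ?case .
qed (use assms in \<open>simp add: conjugate_def\<close>)

text \<open>On elements killed by n, raising to the powers \<alpha> and \<beta> are mutually
  inverse; a conjugate of x is killed by n together with x.\<close>

lemma conjugate_eq_pow_iff:
  assumes x: "x \<in> carrier G" and h: "h \<in> carrier G" and n: "x [^] (n::nat) = \<one>"
    and ab: "[\<alpha> * int \<beta> = 1] (mod int n)"
  shows "conjugate G x h = x [^] \<alpha> \<longleftrightarrow> conjugate G (x [^] \<beta>) h = x"
proof
  have e: "x [^] (\<alpha> * int \<beta>) = x"
    using int_pow_eq_of_cong[OF x n ab] x by (simp add: int_pow_1)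
  show "conjugate G (x [^] \<beta>) h = x" if "conjugate G x h = x [^] \<alpha>"
  proof -
    have "conjugate G (x [^] \<beta>) h = (x [^] \<alpha>) [^] int \<beta>"
      using that conjugate_pow[OF x h, of \<beta>] by (simp add: int_pow_int)
    then show ?thesis using e x by (simp add: int_pow_pow)
  qed
  show "conjugate G x h = x [^] \<alpha>" if eq: "conjugate G (x [^] \<beta>) h = x"
  proof -
    define y where "y = conjugate G x h"
    have y: "y \<in> carrier G" unfolding y_def using x h by simp
    have yb: "y [^] \<beta> = x" unfolding y_def conjugate_pow[OF x h] by (rule eq)
    have "y [^] n = \<one>" unfolding y_def conjugate_pow[OF x h] n using h by (simp add: conjugate_def)
    moreover have "[int \<beta> * \<alpha> = 1] (mod int n)" using ab by (simp add: mult.commute)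
    ultimately have "y [^] (int \<beta> * \<alpha>) = y [^] (1::int)" by (intro int_pow_eq_of_cong[OF y])
    then have "(y [^] int \<beta>) [^] \<alpha> = y" using y by (simp add: int_pow_pow int_pow_1)
    then show ?thesis using yb by (simp add: int_pow_int y_def)
  qed
qed

text \<open>Raising the defining relations to the power \<open>\<beta>\<close>, an inverse of \<open>\<alpha>\<close>, gives relations with
  positive exponents that move \<open>C\<close> past \<open>A\<close> and \<open>B\<close>.\<close>

lemma macdonald_relations_iff:
  assumes A: "A \<in> carrier G" and B: "B \<in> carrier G"
    and n: "A [^] (n::nat) = \<one>" "B [^] n = \<one>" and ab: "[\<alpha> * int \<beta> = 1] (mod int n)"
  shows "macdonald_relations G \<alpha> A B \<longleftrightarrow> macdonald G A B (commutator G A B) \<beta>"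
proof -
  define C where "C = commutator G A B"
  have C: "C \<in> carrier G" unfolding C_def using A B by simp
  have AB: "A \<otimes> B = B \<otimes> A \<otimes> C"
    unfolding C_def commutator_def using A B by (simp add: m_assoc) (simp flip: m_assoc)
  have inv: "commutator G B A = inv C" unfolding C_def using inv_commutator[OF A B] by simp
  have 1: "conjugate G A C = A [^] \<alpha> \<longleftrightarrow> C \<otimes> A = A [^] \<beta> \<otimes> C"
  proof -
    have "conjugate G A C = A [^] \<alpha> \<longleftrightarrow> A = inv C \<otimes> (A [^] \<beta> \<otimes> C)"
      unfolding conjugate_eq_pow_iff[OF A C n(1) ab] using A C by (auto simp: conjugate_def m_assoc)
    also have "\<dots> \<longleftrightarrow> C \<otimes> A = A [^] \<beta> \<otimes> C"
      using A C by (subst inv_solve_left) auto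
    finally show ?thesis .
  qed
  have 2: "conjugate G B (inv C) = B [^] \<alpha> \<longleftrightarrow> B \<otimes> C = C \<otimes> B [^] \<beta>"
  proof -
    have "conjugate G B (inv C) = B [^] \<alpha> \<longleftrightarrow> B = (C \<otimes> B [^] \<beta>) \<otimes> inv C"
      unfolding conjugate_eq_pow_iff[OF B inv_closed[OF C] n(2) ab] using B C by (auto simp: conjugate_def)
    also have "\<dots> \<longleftrightarrow> B \<otimes> C = C \<otimes> B [^] \<beta>"
      using B C by (subst inv_solve_right) auto
    finally show ?thesis .
  qed
  show ?thesis
    unfolding macdonald_relations_def C_def[symmetric] inv 1 2 macdonald_def macdonald_axioms_def
    using A B C AB is_group by blast
qed

end

lemma (in macdonald) commutator_eq: "commutator G A B = C"
  using commutator_A_pow_B[of 1 0] by simp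

text \<open>Let \<alpha> = 1 + p^m w. From \<alpha> \<beta> = 1 + p^K s one gets \<beta> = 1 + p^m u
  with u = p^(K-m) s - w \<beta>. Since m < K and \<beta> = 1 modulo p, u = -w modulo p; this sign
  exchanges the residues 1 and -1 between (\<alpha> - 1) / 3 and u.\<close>

lemma inverse_exponent:
  fixes \<alpha> :: int and p m K :: nat
  assumes p: "prime p" and m: "m = multiplicity (int p) (\<alpha> - 1)" and d: "int p dvd \<alpha> - 1" and \<alpha>: "\<alpha> \<noteq> 1"
    and K: "m < K"
  shows "\<exists>u. \<not> p dvd u \<and> [\<alpha> * int (Suc (p ^ m * u)) = 1] (mod int (p ^ K)) \<and>
    [int u = - ((\<alpha> - 1) div int p ^ m)] (mod int p)"
proof -
  have pi: "prime (int p)" using p by simp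
  then have "\<not> is_unit (int p)" by auto
  define w where "w = (\<alpha> - 1) div int p ^ m"
  have w: "\<alpha> - 1 = int p ^ m * w" unfolding w_def m by (simp add: multiplicity_dvd)
  have pw: "\<not> int p dvd w"
  proof
    assume "int p dvd w"
    then have "int p ^ Suc m dvd \<alpha> - 1" unfolding w by (simp add: mult.commute mult_dvd_mono)
    then show False
      using \<alpha> \<open>\<not> is_unit (int p)\<close> power_dvd_iff_le_multiplicity[of "\<alpha> - 1" "int p" "Suc m"]
      unfolding m by (simp add: multiplicity_eq_zero_iff)
  qed
  have "\<not> int p dvd \<alpha>"
  proof
    assume "int p dvd \<alpha>"
    then have "int p dvd \<alpha> - (\<alpha> - 1)" using d by (rule dvd_diff)
    then show False using \<open>\<not> is_unit (int p)\<close> by simp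
  qed
  then have "coprime \<alpha> (int p ^ K)" using pi by (metis coprime_commute coprime_power_left_iff prime_imp_coprime)
  then obtain x where "[\<alpha> * x = 1] (mod int p ^ K)" using cong_solve_coprime_int by blast
  moreover define \<beta> where "\<beta> = x mod int p ^ K"
  ultimately have b: "[\<alpha> * \<beta> = 1] (mod int p ^ K)" by (simp add: cong_def mod_mult_right_eq)
  have pK: "int p dvd int p ^ K" using K by (simp add: dvd_power)
  have b0: "\<beta> \<ge> 0" unfolding \<beta>_def using p prime_gt_0_nat[of p] by simp
  have bp: "[\<beta> = 1] (mod int p)"
  proof -
    have "int p dvd \<alpha> * \<beta> - 1" using b pK by (meson cong_iff_dvd_diff dvd_trans)
    moreover have "int p dvd (\<alpha> - 1) * \<beta>" using d by simp
    ultimately have "int p dvd (\<alpha> * \<beta> - 1) - (\<alpha> - 1) * \<beta>" by (rule dvd_diff)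
    then show ?thesis by (simp add: cong_iff_dvd_diff algebra_simps)
  qed
  have "\<beta> \<noteq> 0" using bp \<open>\<not> is_unit (int p)\<close> by (auto simp: cong_iff_dvd_diff)
  then have b1: "\<beta> \<ge> 1" using b0 by simp
  obtain s where s: "\<alpha> * \<beta> = 1 + int p ^ K * s" using b by (rule cong_intE)
  define u where "u = int p ^ (K - m) * s - w * \<beta>"
  have "int p ^ K = int p ^ m * int p ^ (K - m)" using K by (simp flip: power_add)
  then have bu: "\<beta> - 1 = int p ^ m * u"
    using s w unfolding u_def by (simp add: algebra_simps)
  have "int p ^ m > 0" using p prime_gt_0_nat[of p] by simp
  then have u0: "u \<ge> 0" using b1 bu by (metis diff_ge_0_iff_ge zero_le_mult_iff not_less order_less_imp_le)
  have "int p dvd int p ^ (K - m) * s" using K by (simp add: dvd_power)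
  moreover have "int p dvd w * (\<beta> - 1)" using bp by (simp add: cong_iff_dvd_diff)
  ultimately have "int p dvd int p ^ (K - m) * s - w * (\<beta> - 1)" by (rule dvd_diff)
  then have uw: "[u = - w] (mod int p)" by (simp add: cong_iff_dvd_diff u_def algebra_simps)
  then have pu: "\<not> int p dvd u" using pw cong_dvd_iff[OF uw] by simp
  have \<beta>: "int (Suc (p ^ m * nat u)) = \<beta>" using u0 bu by simp
  show ?thesis
  proof (intro exI[of _ "nat u"] conjI)
    show "\<not> p dvd nat u" using pu u0 by (metis int_dvd_int_iff nat_0_le)
    show "[\<alpha> * int (Suc (p ^ m * nat u)) = 1] (mod int (p ^ K))" unfolding \<beta> using b by simp
    show "[int (nat u) = - ((\<alpha> - 1) div int p ^ m)] (mod int p)" using uw u0 by (simp add: w_def)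
  qed
qed

text \<open>Normal forms are unique in \<open>J\<close> since they are in the image of \<open>J\<close> in the permutation
  model.\<close>

lemma sylow_normal_form:
  fixes \<alpha> :: int and \<pi> :: "gen word set set \<Rightarrow> gen word set set" and J :: "gen word set set set"
  defines "T \<equiv> (macdonald_group \<alpha>)\<lparr>carrier := J\<rparr>"
    and "A \<equiv> \<pi> (macdonald_gen \<alpha> GenA)" and "B \<equiv> \<pi> (macdonald_gen \<alpha> GenB)"
  assumes p: "prime p" and J: "sylow_subgroup (macdonald_group \<alpha>) p J"
    and \<pi>: "sylow_projection (macdonald_group \<alpha>) p J \<pi>"
    and order: "order T = p ^ n" "n \<le> K" and K: "v + m \<le> K"
    and ab: "[\<alpha> * int (Suc (p ^ m * u)) = 1] (mod int (p ^ K))"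
    and model: "macdonald_model p m u v \<sigma>"
  shows "macdonald_sylow p m u T A B (commutator T A B) K v \<sigma>"
proof -
  note T = macdonald_sylow_facts[OF p J \<pi>, folded T_def A_def B_def]
  interpret M: macdonald_model p m u v \<sigma> by (rule model)
  interpret T: group T by (rule T(1))
  have bdef: "M.b = Suc (p ^ m * u)" by (simp add: M.b_def M.e_def)
  have tors: "x [^]\<^bsub>T\<^esub> (p ^ K) = \<one>\<^bsub>T\<^esub>" if "x \<in> carrier T" for x
  proof -
    obtain k where "p ^ K = p ^ n * k" using le_imp_power_dvd[OF order(2), of p] by blast
    then show ?thesis using T.pow_order_eq_1[OF that] that T.pow_mult_one unfolding order(1) by simp
  qed
  have mac: "macdonald T A B (commutator T A B) M.b"
    using T.macdonald_relations_iff[OF T(2,3) tors[OF T(2)] tors[OF T(3)] ab] T(5) bdef by simp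
  interpret P: macdonald_p p m u T A B "commutator T A B" K v \<sigma>
    by (intro macdonald_p.intro M.padic_base_axioms mac macdonald_p_axioms.intro tors T(2,3) M.key M.qnum_q)
  note mod = M.model_exists
  interpret MM: macdonald M.M M.a "inv\<^bsub>M.M\<^esub> M.d" M.c M.b using mod by blast
  obtain L where L: "\<And>g. g \<in> generate M.M {M.a, inv\<^bsub>M.M\<^esub> M.d} \<Longrightarrow> g [^]\<^bsub>M.M\<^esub> (p ^ L) = \<one>\<^bsub>M.M\<^esub>"
    using mod by blast
  \<comment> \<open>K is large enough for \<alpha> and b to be inverse also modulo the exponent Q of
    the generators of the model, so the relations with b there are the Macdonald relations for
    \<alpha>.\<close>
  have "int M.Q dvd int (p ^ K)" unfolding M.Q_def int_dvd_int_iff using K by (rule le_imp_power_dvd)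
  then have "[\<alpha> * int M.b = 1] (mod int M.Q)"
    using ab unfolding bdef by (meson cong_dvd_modulus)
  then have "macdonald_relations M.M \<alpha> M.a (inv\<^bsub>M.M\<^esub> M.d)"
    using group.macdonald_relations_iff[OF M.group_M MM.A MM.B _ _] mod MM.commutator_eq MM.macdonald_axioms by metis
  then obtain \<phi> where \<phi>: "\<phi> \<in> hom T M.M" "\<phi> A = M.a" "\<phi> B = inv\<^bsub>M.M\<^esub> M.d"
    using T(7)[OF M.group_M MM.A MM.B _ L] by blast
  interpret \<phi>: group_hom T M.M \<phi> by (intro group_hom.intro T.is_group M.group_M group_hom_axioms.intro \<phi>(1))
  have \<phi>C: "\<phi> (commutator T A B) = M.c"
    using \<phi>.hom_commutator[OF T(2,3)] MM.commutator_eq unfolding \<phi>(2,3) by simp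
  have \<phi>_elt: "\<phi> (P.elt (i, k, j)) = M.a [^]\<^bsub>M.M\<^esub> i \<otimes>\<^bsub>M.M\<^esub> M.c [^]\<^bsub>M.M\<^esub> k \<otimes>\<^bsub>M.M\<^esub> inv\<^bsub>M.M\<^esub> M.d [^]\<^bsub>M.M\<^esub> j" for i k j
    by (simp add: P.elt_eq \<phi>.hom_nat_pow \<phi>(2,3) \<phi>C)
  have qQ: "P.q = M.q" "P.Q = M.Q" by (simp_all add: P.q_def P.Q_def M.q_def M.Q_def)
  show ?thesis
  proof (intro macdonald_sylow.intro P.macdonald_p_axioms macdonald_sylow_axioms.intro T(4), unfold qQ)
    fix x y assume "P.elt x = P.elt y"
    moreover obtain i k j i' k' j' where "x = (i, k, j)" "y = (i', k', j')" by (metis surj_pair)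
    ultimately show "nf M.q M.Q \<sigma> x = nf M.q M.Q \<sigma> y"
      using mod \<phi>_elt[of i k j] \<phi>_elt[of i' k' j'] by metis
  qed
qed

theorem theorem8p1:
  fixes \<alpha> :: int and p m :: nat
    and J :: "gen word set set set" and \<pi> :: "gen word set set \<Rightarrow> gen word set set"
    and T :: "gen word set set monoid" and A B C :: "gen word set set"
  assumes "\<alpha> \<notin> {0, 1, 2}"
    and "prime p" and "int p dvd \<alpha> - 1" and "m = multiplicity (int p) (\<alpha> - 1)"
    and "sylow_subgroup (macdonald_group \<alpha>) p J"
    and "sylow_projection (macdonald_group \<alpha>) p J \<pi>"
    and "T = (macdonald_group \<alpha>)\<lparr>carrier := J\<rparr>"
    and "A = \<pi> (macdonald_gen \<alpha> GenA)" and "B = \<pi> (macdonald_gen \<alpha> GenB)"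
    and "C = commutator T A B"
  shows
    "(p > 3 \<or> p = 3 \<and> (m > 1 \<or> [(\<alpha> - 1) div 3 = 1] (mod 3)) \<longrightarrow>
        has_nilpotency_class T 5 \<and>
        upper_central T 1 = generate T {A [^]\<^bsub>T\<^esub> (p ^ (2 * m))} \<and>
        upper_central T 2 = generate T {A [^]\<^bsub>T\<^esub> (p ^ (2 * m)), C [^]\<^bsub>T\<^esub> (p ^ m)} \<and>
        upper_central T 3 = generate T {A [^]\<^bsub>T\<^esub> (p ^ m), B [^]\<^bsub>T\<^esub> (p ^ m), C [^]\<^bsub>T\<^esub> (p ^ m)} \<and>
        upper_central T 4 = generate T {A [^]\<^bsub>T\<^esub> (p ^ m), B [^]\<^bsub>T\<^esub> (p ^ m), C} \<and>
        (\<forall>i \<in> {1..6}. lower_central T i = upper_central T (6 - i))) \<and>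
     (p = 2 \<and> m > 1 \<longrightarrow>
        has_nilpotency_class T 5 \<and>
        upper_central T 1 = generate T {A [^]\<^bsub>T\<^esub> ((2::nat) ^ (2 * m - 1))} \<and>
        upper_central T 2 =
          generate T {A [^]\<^bsub>T\<^esub> ((2::nat) ^ (2 * m - 1)), C [^]\<^bsub>T\<^esub> ((2::nat) ^ (m - 1))} \<and>
        upper_central T 3 =
          generate T {A [^]\<^bsub>T\<^esub> ((2::nat) ^ m), B [^]\<^bsub>T\<^esub> ((2::nat) ^ m), C [^]\<^bsub>T\<^esub> ((2::nat) ^ (m - 1))} \<and>
        upper_central T 4 =
          generate T {A [^]\<^bsub>T\<^esub> ((2::nat) ^ (m - 1)), B [^]\<^bsub>T\<^esub> ((2::nat) ^ (m - 1)), C} \<and>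
        lower_central T 2 = generate T {A [^]\<^bsub>T\<^esub> ((2::nat) ^ m), B [^]\<^bsub>T\<^esub> ((2::nat) ^ m), C} \<and>
        lower_central T 3 =
          generate T {A [^]\<^bsub>T\<^esub> ((2::nat) ^ m), B [^]\<^bsub>T\<^esub> ((2::nat) ^ m), C [^]\<^bsub>T\<^esub> ((2::nat) ^ m)} \<and>
        lower_central T 4 =
          generate T {A [^]\<^bsub>T\<^esub> ((2::nat) ^ (2 * m)), commutator T A (B [^]\<^bsub>T\<^esub> ((2::nat) ^ m))} \<and>
        lower_central T 5 = generate T {A [^]\<^bsub>T\<^esub> ((2::nat) ^ (2 * m))}) \<and>
     (p = 3 \<and> m = 1 \<and> [(\<alpha> - 1) div 3 = - 1] (mod 3) \<longrightarrow>
        has_nilpotency_class T 7 \<and>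
        upper_central T 1 = generate T {A [^]\<^bsub>T\<^esub> (27::nat)} \<and>
        upper_central T 2 = generate T {A [^]\<^bsub>T\<^esub> (27::nat), C [^]\<^bsub>T\<^esub> (9::nat)} \<and>
        upper_central T 3 =
          generate T {A [^]\<^bsub>T\<^esub> (9::nat), B [^]\<^bsub>T\<^esub> (9::nat), C [^]\<^bsub>T\<^esub> (9::nat)} \<and>
        upper_central T 4 =
          generate T {A [^]\<^bsub>T\<^esub> (9::nat), B [^]\<^bsub>T\<^esub> (9::nat), C [^]\<^bsub>T\<^esub> (3::nat)} \<and>
        upper_central T 5 =
          generate T {A [^]\<^bsub>T\<^esub> (3::nat), B [^]\<^bsub>T\<^esub> (3::nat), C [^]\<^bsub>T\<^esub> (3::nat)} \<and>
        upper_central T 6 = generate T {A [^]\<^bsub>T\<^esub> (3::nat), B [^]\<^bsub>T\<^esub> (3::nat), C} \<and>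
        (\<forall>i \<in> {1..8}. lower_central T i = upper_central T (8 - i)))"
proof -
  have p: "prime p" and J: "sylow_subgroup (macdonald_group \<alpha>) p J"
    and \<pi>: "sylow_projection (macdonald_group \<alpha>) p J \<pi>" by fact+
  obtain n where n: "order T = p ^ n"
    using macdonald_sylow_facts(6)[OF p J \<pi>] assms(7) by blast
  \<comment> \<open>Chosen so that p^K kills T, that m < K, and that v + m \<le> K in every case, v
    + m being 3m, 3m - 1 or 4.\<close>
  define K where "K = n + 3 * m + 5"
  have \<alpha>1: "\<alpha> \<noteq> 1" and mK: "m < K" using assms(1) by (auto simp: K_def)
  obtain u where u: "\<not> p dvd u" and ab: "[\<alpha> * int (Suc (p ^ m * u)) = 1] (mod int (p ^ K))"
    and uw: "[int u = - ((\<alpha> - 1) div int p ^ m)] (mod int p)"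
    using inverse_exponent[OF p assms(4) assms(3) \<alpha>1 mK] by blast
  have m1: "m \<ge> 1"
    using assms(3) \<alpha>1 p power_dvd_iff_le_multiplicity[of "\<alpha> - 1" "int p" 1] prime_gt_1_nat[OF p]
    unfolding assms(4) by auto
  have base: "padic_base p m u" if "p = 2 \<Longrightarrow> m > 1"
    by (intro padic_base.intro) (use p m1 u that in auto)
  have sylow: "macdonald_sylow p m u T A B C K v \<sigma>" if "macdonald_model p m u v \<sigma>" "v + m \<le> K" for v \<sigma>
    using sylow_normal_form[OF p J \<pi> _ _ that(2) ab that(1), of n] n unfolding assms(7-10) by (simp add: K_def)
  have u3: "u mod 3 = 2" if "p = 3" "m = 1" "[(\<alpha> - 1) div 3 = 1] (mod 3)"
  proof -
    have "[int u = - 1] (mod 3)"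
      using uw that cong_trans cong_minus_minus_iff[of "(\<alpha> - 1) div 3" 1 3] by auto
    then have "int (u mod 3) = 2" by (simp add: cong_def zmod_int)
    then show ?thesis by simp
  qed
  have u3': "u mod 3 = 1" if "p = 3" "m = 1" "[(\<alpha> - 1) div 3 = - 1] (mod 3)"
  proof -
    have "[int u = 1] (mod 3)"
      using uw that cong_trans cong_minus_minus_iff[of "(\<alpha> - 1) div 3" "- 1" 3] by auto
    then have "int (u mod 3) = 1" by (simp add: cong_def zmod_int)
    then show ?thesis by simp
  qed
  show ?thesis
  proof (intro conjI[of "_ \<longrightarrow> _"] impI)
    assume c: "p > 3 \<or> p = 3 \<and> (m > 1 \<or> [(\<alpha> - 1) div 3 = 1] (mod 3))"
    interpret padic_base p m u by (rule base) (use c in auto)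
    have "p > 3 \<or> p = 3 \<and> (m > 1 \<or> u mod 3 = 2)" using c m1 u3 by (cases "m = 1") auto
    then interpret macdonald_sylow p m u T A B C K "2 * m" 0
      by (intro sylow model_generic) (auto simp: K_def)
    show "has_nilpotency_class T 5 \<and>
        upper_central T 1 = generate T {A [^]\<^bsub>T\<^esub> (p ^ (2 * m))} \<and>
        upper_central T 2 = generate T {A [^]\<^bsub>T\<^esub> (p ^ (2 * m)), C [^]\<^bsub>T\<^esub> (p ^ m)} \<and>
        upper_central T 3 = generate T {A [^]\<^bsub>T\<^esub> (p ^ m), B [^]\<^bsub>T\<^esub> (p ^ m), C [^]\<^bsub>T\<^esub> (p ^ m)} \<and>
        upper_central T 4 = generate T {A [^]\<^bsub>T\<^esub> (p ^ m), B [^]\<^bsub>T\<^esub> (p ^ m), C} \<and>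
        (\<forall>i \<in> {1..6}. lower_central T i = upper_central T (6 - i))"
      by (rule central_series_generic) (use c p prime_odd_nat[OF p] in auto)
  next
    assume c: "p = 2 \<and> m > 1"
    interpret padic_base p m u by (rule base) (use c in auto)
    interpret macdonald_sylow p m u T A B C K "2 * m - 1" "2 ^ (m - 1)"
      by (intro sylow model_two) (use c in \<open>auto simp: K_def\<close>)
    show "has_nilpotency_class T 5 \<and>
        upper_central T 1 = generate T {A [^]\<^bsub>T\<^esub> ((2::nat) ^ (2 * m - 1))} \<and>
        upper_central T 2 =
          generate T {A [^]\<^bsub>T\<^esub> ((2::nat) ^ (2 * m - 1)), C [^]\<^bsub>T\<^esub> ((2::nat) ^ (m - 1))} \<and>
        upper_central T 3 =
          generate T {A [^]\<^bsub>T\<^esub> ((2::nat) ^ m), B [^]\<^bsub>T\<^esub> ((2::nat) ^ m), C [^]\<^bsub>T\<^esub> ((2::nat) ^ (m - 1))} \<and>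
        upper_central T 4 =
          generate T {A [^]\<^bsub>T\<^esub> ((2::nat) ^ (m - 1)), B [^]\<^bsub>T\<^esub> ((2::nat) ^ (m - 1)), C} \<and>
        lower_central T 2 = generate T {A [^]\<^bsub>T\<^esub> ((2::nat) ^ m), B [^]\<^bsub>T\<^esub> ((2::nat) ^ m), C} \<and>
        lower_central T 3 =
          generate T {A [^]\<^bsub>T\<^esub> ((2::nat) ^ m), B [^]\<^bsub>T\<^esub> ((2::nat) ^ m), C [^]\<^bsub>T\<^esub> ((2::nat) ^ m)} \<and>
        lower_central T 4 =
          generate T {A [^]\<^bsub>T\<^esub> ((2::nat) ^ (2 * m)), commutator T A (B [^]\<^bsub>T\<^esub> ((2::nat) ^ m))} \<and>
        lower_central T 5 = generate T {A [^]\<^bsub>T\<^esub> ((2::nat) ^ (2 * m))}"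
      by (rule central_series_two) (use c in auto)
  next
    assume c: "p = 3 \<and> m = 1 \<and> [(\<alpha> - 1) div 3 = - 1] (mod 3)"
    interpret padic_base p m u by (rule base) (use c in auto)
    interpret macdonald_sylow p m u T A B C K 3 0
      by (intro sylow model_exceptional) (use c u3' in \<open>auto simp: K_def\<close>)
    show "has_nilpotency_class T 7 \<and>
        upper_central T 1 = generate T {A [^]\<^bsub>T\<^esub> (27::nat)} \<and>
        upper_central T 2 = generate T {A [^]\<^bsub>T\<^esub> (27::nat), C [^]\<^bsub>T\<^esub> (9::nat)} \<and>
        upper_central T 3 =
          generate T {A [^]\<^bsub>T\<^esub> (9::nat), B [^]\<^bsub>T\<^esub> (9::nat), C [^]\<^bsub>T\<^esub> (9::nat)} \<and>
        upper_central T 4 =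
          generate T {A [^]\<^bsub>T\<^esub> (9::nat), B [^]\<^bsub>T\<^esub> (9::nat), C [^]\<^bsub>T\<^esub> (3::nat)} \<and>
        upper_central T 5 =
          generate T {A [^]\<^bsub>T\<^esub> (3::nat), B [^]\<^bsub>T\<^esub> (3::nat), C [^]\<^bsub>T\<^esub> (3::nat)} \<and>
        upper_central T 6 = generate T {A [^]\<^bsub>T\<^esub> (3::nat), B [^]\<^bsub>T\<^esub> (3::nat), C} \<and>
        (\<forall>i \<in> {1..8}. lower_central T i = upper_central T (8 - i))"
      by (rule central_series_exceptional) (use c in auto)
  qed
qed

end
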